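(* Consider the $N$-converter system described in the context, with converter admittances $\mathbf{Y}_{\mathrm{C},i}(s)$, steady-state angles $\theta_i\in\mathbb{R}$, capacity ratios $S_i>0$, Kron-reduced network admittance $\mathbf{Y}_{\rm grid}(s)$, re-scaling matrix $\mathbf{D}=\mathrm{diag}\{D_1,\dots,D_N\}$ with $D_i>0$, and re-scaling transfer matrix $\widetilde F_\epsilon(s)$. Let $$\widetilde{\mathbf{Y}}_{\mathrm{C},i}(s)=D_i\,\mathbf{Y}_{\mathrm{C},i}(s)\,\widetilde F_\epsilon^{-1}(s),\quad i\in\{1,\dots,N\},$$ $$\widetilde{\mathbf{Y}}_{\rm grid}(s)=(\mathbf{S}^{-\frac12}\otimes I_2)\,\mathbf{Y}_{\rm grid}(s)\,(\mathbf{S}^{-\frac12}\mathbf{D}\otimes\widetilde F_\epsilon^{-1}(s)).$$ Suppose that the two open-loop systems $e^{J\vartheta}\mathbf{Y}_{\rm C}^N(s)e^{-J\vartheta}(\mathbf{D}\otimes\widetilde F_\epsilon^{-1}(s))$ and $\widetilde{\mathbf{Y}}_{\rm grid}^{-1}(s)$ are stable (i.e., belong to $\mathcal{RH}_\infty^{2N\times 2N}$), and that for each $\omega\in[0,\infty]$ at least one of the following two conditions holds: (i) (decentralized gain condition) $$\max_i\ \overline\sigma(\widetilde{\mathbf{Y}}_{\mathrm{C},i}(j\omega))<\underline\sigma(\widetilde{\mathbf{Y}}_{\rm grid}(j\omega));$$ (ii) (decentralized phase condition) all of the following hold: a) $\max_i\ \overline\phi(\widetilde{\mathbf{Y}}_{\mathrm{C},i}(j\omega))<\pi-\overline\phi(\widetilde{\mathbf{Y}}_{\rm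 grid}^{-1}(j\omega))$; b) $\min_i\ \underline\phi(\widetilde{\mathbf{Y}}_{\mathrm{C},i}(j\omega))>-\pi-\underline\phi(\widetilde{\mathbf{Y}}_{\rm grid}^{-1}(j\omega))$; c) $\widetilde{\mathbf{Y}}_{\rm grid}(j\omega)$ is sectorial; d) $\max_i\ \overline\phi(\widetilde{\mathbf{Y}}_{\mathrm{C},i}(j\omega))-\min_i\ \underline\phi(\widetilde{\mathbf{Y}}_{\mathrm{C},i}(j\omega))<\pi$. Then the multi-converter system is stable, i.e., the feedback interconnection $$\big[e^{J\vartheta}\,\mathbf{Y}_{\rm C}^N(s)\,e^{-J\vartheta}(\mathbf{D}\otimes\widetilde F_\epsilon^{-1}(s))\big]\ \#\ \widetilde{\mathbf{Y}}_{\rm grid}^{-1}(s)$$ is stable.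
   Context: **Gains and phases.** For $A\in\mathbb{C}^{n\times n}$, $\overline\sigma(A)$ and $\underline\sigma(A)$ are its largest and smallest singular values. The numerical range is $W(A)=\{x^*Ax: x\in\mathbb{C}^n,\ \|x\|=1\}$. $A$ is sectorial if $0\notin W(A)$. A sectorial $A$ can be written $A=T^*\Delta T$ with $T$ nonsingular and $\Delta$ diagonal unitary; $\Delta$ is unique up to permutation and its diagonal entries lie on an arc of the unit circle of length less than $\pi$. The phases of $A$, $\overline\phi(A)=\phi_1(A)\ge\dots\ge\phi_n(A)=\underline\phi(A)$, are the arguments of the diagonal entries of $\Delta$, chosen as real numbers so that $\overline\phi(A)-\underline\phi(A)<\pi$ (they are determined up to adding a common integer multiple of $2\pi$; for each matrix and each frequency some such choice is fixed). If $A$ is not sectorial, set $\overline\phi(A)=+\infty$, $\underline\phi(A)=-\infty$, so a phase condition involving $A$ fails. **Feedback stability.** $\mathcal{RH}_\infty^{m\times m}$ is the set of $m\times m$ real rational proper stable transfer function matrices. The feedback interconnection $G\#H$ is stable if $$G\#H=\begin{bmatrix}(I+HG)^{-1}&(I+HG)^{-1}H\\ G(I+HG)^{-1}&G(I+HG)^{-1}H\end{bmatrix}\in\mathcal{RH}_\infty^{2m\times 2m}.$$ **Converters.** $N\ge1$ converters; the $i$-th has small-signal admittance $\mathbf{Y}_{\mathrm{C},i}(s)$, a $2\times2$ real rational transfer matrix. $\mathbf{Y}_{\rm C}^N(s)=\mathrm{diag}(\mathbf{Y}_{\mathrm{C},1}(s),\dots,\mathbf{Y}_{\mathrm{C},N}(s))$;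 $\mathbf{S}=\mathrm{diag}\{S_1,\dots,S_N\}$ with $S_i>0$; $e^{J\theta_i}=\begin{bmatrix}\cos\theta_i&-\sin\theta_i\\ \sin\theta_i&\cos\theta_i\end{bmatrix}$ and $e^{\pm J\vartheta}=\mathrm{diag}\{e^{\pm J\theta_1},\dots,e^{\pm J\theta_N}\}$. With $\mathbf I,\mathbf U$ the stacked $dq$ current and voltage perturbations, the converters satisfy $-\mathbf I=(\mathbf S\otimes I_2)e^{J\vartheta}\mathbf{Y}_{\rm C}^N(s)e^{-J\vartheta}\mathbf U$. **Network.** There are nodes $1,\dots,M$ ($M\ge N$; nodes $1,\dots,N$ are converter nodes, the others interior) and a grounded node $M+1$. The branch between nodes $i\neq j$ has a $2\times 2$ real rational admittance matrix $Y_{ij}(s)=Y_{ji}(s)$ (zero if there is no branch). The $2M\times2M$ grounded Laplacian $\mathbf{Y}(s)$ has $2\times2$ blocks $\mathbf{Y}_{ij}=-Y_{ij}$ for $i\ne j$ and $\mathbf{Y}_{ii}=\sum_{j\in\{1,\dots,M+1\},\,j\ne i}Y_{ij}$. Partition $\mathbf{Y}=\begin{bmatrix}\mathbf{Y}_1&\mathbf{Y}_2\\ \mathbf{Y}_3&\mathbf{Y}_4\end{bmatrix}$ with $\mathbf{Y}_1$ of size $2N\times2N$. Then $\mathbf{Y}_{\rm grid}=\mathbf{Y}_1-\mathbf{Y}_2\mathbf{Y}_4^{-1}\mathbf{Y}_3$, and the network satisfies $\mathbf I=\mathbf{Y}_{\rm grid}(s)\mathbf U$. The inverses of $\mathbf{Y}_4$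 and $\mathbf{Y}_{\rm grid}$ as rational matrices are assumed to exist. **Re-scaling.** With nominal frequency $\omega_0>0$ and a parameter $\widetilde\epsilon\ge0$ (an R/X ratio), $$\widetilde F_\epsilon(s)=\begin{bmatrix}s/\omega_0+\widetilde\epsilon&-1\\1&s/\omega_0+\widetilde\epsilon\end{bmatrix}^{-1}.$$ **Closed loop.** The closed loop $[(\mathbf S\otimes I_2)e^{J\vartheta}\mathbf{Y}_{\rm C}^N e^{-J\vartheta}]\#\mathbf{Y}_{\rm grid}^{-1}$ of converters and network is represented by the re-scaled interconnection $[e^{J\vartheta}\mathbf{Y}_{\rm C}^N e^{-J\vartheta}(\mathbf D\otimes\widetilde F_\epsilon^{-1})]\#\widetilde{\mathbf{Y}}_{\rm grid}^{-1}$, and stability of the multi-converter system means stability of this re-scaled interconnection. **Values at exceptional frequencies.** Values at $\omega=\infty$ are limits of proper transfer matrices. If $\widetilde{\mathbf{Y}}_{\rm grid}$ has no finite value at $j\omega$, then $\underline\sigma(\widetilde{\mathbf{Y}}_{\rm grid}(j\omega))$ is read as $1/\overline\sigma(\widetilde{\mathbf{Y}}_{\rm grid}^{-1}(j\omega))$ (with $1/0=+\infty$), and sectoriality of $\widetilde{\mathbf{Y}}_{\rm grid}(j\omega)$ is read as sectoriality of $\widetilde{\mathbf{Y}}_{\rm grid}^{-1}(j\omega)$. *)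

theory Defs
  imports
    "Jordan_Normal_Form.Schur_Decomposition"
    "Jordan_Normal_Form.Gauss_Jordan_Elimination"
    "HOL-Computational_Algebra.Normalized_Fraction"
    "HOL-Computational_Algebra.Field_as_Ring"
    "HOL-Library.Extended_Real"
begin

definition singular_values :: "complex mat \<Rightarrow> real set" where
  "singular_values A =
     {\<sigma>. 0 \<le> \<sigma> \<and> eigenvalue (mat_adjoint A * A) (complex_of_real (\<sigma>\<^sup>2))}"

definition sigma_max :: "complex mat \<Rightarrow> real" where
  "sigma_max A = Max (singular_values A)"

definition sigma_min :: "complex mat \<Rightarrow> real" where
  "sigma_min A = Min (singular_values A)"

text \<open>\<open>(A *\<^sub>v x) \<bullet>c x\<close> is \<open>x\<^sup>* A x\<close>: the product \<open>\<bullet>c\<close> conjugates its second argument.\<close>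

definition numerical_range :: "complex mat \<Rightarrow> complex set" where
  "numerical_range A =
     {(A *\<^sub>v x) \<bullet>c x | x. x \<in> carrier_vec (dim_row A)
        \<and> sqrt (\<Sum>i<dim_row A. (cmod (x $ i))\<^sup>2) = 1}"

definition sectorial :: "complex mat \<Rightarrow> bool" where
  "sectorial A \<longleftrightarrow> 0 \<notin> numerical_range A"

text \<open>\<open>is_phases A \<phi>\<close>: the reals \<open>\<phi> 0 \<ge> \<dots> \<ge> \<phi> (n - 1)\<close> are an admissible choice of phases of
  the \<open>n \<times> n\<close> matrix \<open>A\<close>. Such a choice is unique only up to a common multiple of \<open>2 * pi\<close>.\<close>

definition is_phases :: "complex mat \<Rightarrow> (nat \<Rightarrow> real) \<Rightarrow> bool" where
  "is_phases A \<phi> \<longleftrightarrow> (let n = dim_row A in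
     (\<exists>T \<in> carrier_mat n n. invertible_mat T \<and>
        A = mat_adjoint T * mat_diag n (\<lambda>k. cis (\<phi> k)) * T) \<and>
     (\<forall>i j. i \<le> j \<longrightarrow> j < n \<longrightarrow> \<phi> j \<le> \<phi> i) \<and>
     \<phi> 0 - \<phi> (n - 1) < pi)"

definition phase_max :: "complex mat \<Rightarrow> (nat \<Rightarrow> real) \<Rightarrow> ereal" where
  "phase_max A \<phi> = (if sectorial A then ereal (\<phi> 0) else \<infinity>)"

definition phase_min :: "complex mat \<Rightarrow> (nat \<Rightarrow> real) \<Rightarrow> ereal" where
  "phase_min A \<phi> = (if sectorial A then ereal (\<phi> (dim_row A - 1)) else -\<infinity>)"

type_synonym tf = "real poly fract"

text \<open>\<^const>\<open>quot_of_fract\<close> returns a coprime numerator and denominator, so the roots of the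
  denominator are exactly the poles.\<close>

definition tf_num :: "tf \<Rightarrow> real poly" where
  "tf_num f = fst (quot_of_fract f)"

definition tf_den :: "tf \<Rightarrow> real poly" where
  "tf_den f = snd (quot_of_fract f)"

definition tf_const :: "real \<Rightarrow> tf" where
  "tf_const c = Fract [:c:] 1"

definition tf_s :: tf where
  "tf_s = Fract [:0, 1:] 1"

definition cpoly :: "real poly \<Rightarrow> complex \<Rightarrow> complex" where
  "cpoly p s = poly (map_poly complex_of_real p) s"

definition tf_eval :: "tf \<Rightarrow> complex \<Rightarrow> complex" where
  "tf_eval f s = cpoly (tf_num f) s / cpoly (tf_den f) s"

definition tf_proper :: "tf \<Rightarrow> bool" where
  "tf_proper f \<longleftrightarrow> degree (tf_num f) \<le> degree (tf_den f)"

definition tf_stable :: "tf \<Rightarrow> bool" where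
  "tf_stable f \<longleftrightarrow> (\<forall>s. 0 \<le> Re s \<longrightarrow> cpoly (tf_den f) s \<noteq> 0)"

definition RH_inf :: "nat \<Rightarrow> tf mat set" where
  "RH_inf m = {A \<in> carrier_mat m m. \<forall>i<m. \<forall>j<m. tf_proper (A $$ (i,j)) \<and> tf_stable (A $$ (i,j))}"

text \<open>The value at \<open>\<omega> = \<infinity>\<close> is the limit along the imaginary axis, which is finite exactly for
  proper functions.\<close>

definition tf_finite_at :: "tf \<Rightarrow> ereal \<Rightarrow> bool" where
  "tf_finite_at f \<omega> \<longleftrightarrow>
     (if \<omega> = \<infinity> then tf_proper f
      else cpoly (tf_den f) (\<i> * complex_of_real (real_of_ereal \<omega>)) \<noteq> 0)"

definition tf_freq :: "tf \<Rightarrow> ereal \<Rightarrow> complex" where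
  "tf_freq f \<omega> =
     (if \<omega> = \<infinity> then Lim at_top (\<lambda>t::real. tf_eval f (\<i> * complex_of_real t))
      else tf_eval f (\<i> * complex_of_real (real_of_ereal \<omega>)))"

definition finite_at :: "tf mat \<Rightarrow> ereal \<Rightarrow> bool" where
  "finite_at A \<omega> \<longleftrightarrow> (\<forall>i<dim_row A. \<forall>j<dim_col A. tf_finite_at (A $$ (i,j)) \<omega>)"

definition freq :: "tf mat \<Rightarrow> ereal \<Rightarrow> complex mat" where
  "freq A \<omega> = map_mat (\<lambda>f. tf_freq f \<omega>) A"

text \<open>Unspecified for singular matrices.\<close>

definition mat_inv :: "'a::field mat \<Rightarrow> 'a mat" where
  "mat_inv A = the (mat_inverse A)"

definition kron :: "'a::times mat \<Rightarrow> 'a mat \<Rightarrow> 'a mat"  (infixl \<open>\<otimes>\<^sub>k\<close> 70) where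
  "A \<otimes>\<^sub>k B = Matrix.mat (dim_row A * dim_row B) (dim_col A * dim_col B)
     (\<lambda>(i,j). A $$ (i div dim_row B, j div dim_col B) * B $$ (i mod dim_row B, j mod dim_col B))"

definition feedback :: "nat \<Rightarrow> tf mat \<Rightarrow> tf mat \<Rightarrow> tf mat" where
  "feedback m G H = (let R = mat_inv (1\<^sub>m m + H * G) in
     four_block_mat R (R * H) (G * R) (G * R * H))"

definition feedback_stable :: "nat \<Rightarrow> tf mat \<Rightarrow> tf mat \<Rightarrow> bool" where
  "feedback_stable m G H \<longleftrightarrow>
     invertible_mat (1\<^sub>m m + H * G) \<and> feedback m G H \<in> RH_inf (2 * m)"

definition diag_const :: "nat \<Rightarrow> (nat \<Rightarrow> real) \<Rightarrow> tf mat" where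
  "diag_const N d = mat_diag N (\<lambda>i. tf_const (d i))"

definition exp_J :: "real \<Rightarrow> tf mat" where
  "exp_J a = map_mat tf_const (mat_of_rows_list 2 [[cos a, - sin a], [sin a, cos a]])"

definition F_tilde :: "real \<Rightarrow> real \<Rightarrow> tf mat" where
  "F_tilde \<omega>\<^sub>0 \<epsilon> = mat_inv (mat_of_rows_list 2
     [[tf_s / tf_const \<omega>\<^sub>0 + tf_const \<epsilon>, - 1],
      [1, tf_s / tf_const \<omega>\<^sub>0 + tf_const \<epsilon>]])"

text \<open>Nodes are numbered from \<open>0\<close>: the converter nodes are \<open>{..<N}\<close>, the interior nodes \<open>{N..<M}\<close>,
  and \<open>M\<close> is the grounded node. \<open>Yb i j\<close> is the \<open>2 \<times> 2\<close> admittance of the branch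
  between \<open>i \<noteq> j\<close>; the values \<open>Yb i i\<close> are never used.\<close>

definition grounded_laplacian :: "nat \<Rightarrow> (nat \<Rightarrow> nat \<Rightarrow> tf mat) \<Rightarrow> tf mat" where
  "grounded_laplacian M Yb = Matrix.mat (2 * M) (2 * M) (\<lambda>(r,c).
     let i = r div 2; j = c div 2; e = (r mod 2, c mod 2) in
     if i = j then (\<Sum>k \<in> {..M} - {i}. Yb i k $$ e) else - (Yb i j $$ e))"

definition interior_block :: "nat \<Rightarrow> nat \<Rightarrow> (nat \<Rightarrow> nat \<Rightarrow> tf mat) \<Rightarrow> tf mat" where
  "interior_block N M Yb =
     (case split_block (grounded_laplacian M Yb) (2 * N) (2 * N) of (Y1, Y2, Y3, Y4) \<Rightarrow> Y4)"

definition Y_grid :: "nat \<Rightarrow> nat \<Rightarrow> (nat \<Rightarrow> nat \<Rightarrow> tf mat) \<Rightarrow> tf mat" where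
  "Y_grid N M Yb =
     (case split_block (grounded_laplacian M Yb) (2 * N) (2 * N) of (Y1, Y2, Y3, Y4) \<Rightarrow>
        Y1 - Y2 * mat_inv Y4 * Y3)"

definition converter_loop ::
  "nat \<Rightarrow> (nat \<Rightarrow> tf mat) \<Rightarrow> (nat \<Rightarrow> real) \<Rightarrow> (nat \<Rightarrow> real) \<Rightarrow> real \<Rightarrow> real \<Rightarrow> tf mat" where
  "converter_loop N YC \<theta> D \<omega>\<^sub>0 \<epsilon> =
     diag_block_mat (map (\<lambda>i. exp_J (\<theta> i)) [0..<N])
     * diag_block_mat (map YC [0..<N])
     * diag_block_mat (map (\<lambda>i. exp_J (- \<theta> i)) [0..<N])
     * (diag_const N D \<otimes>\<^sub>k mat_inv (F_tilde \<omega>\<^sub>0 \<epsilon>))"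

definition rescaled_converter ::
  "(nat \<Rightarrow> tf mat) \<Rightarrow> (nat \<Rightarrow> real) \<Rightarrow> real \<Rightarrow> real \<Rightarrow> nat \<Rightarrow> tf mat" where
  "rescaled_converter YC D \<omega>\<^sub>0 \<epsilon> i = tf_const (D i) \<cdot>\<^sub>m YC i * mat_inv (F_tilde \<omega>\<^sub>0 \<epsilon>)"

definition rescaled_grid ::
  "nat \<Rightarrow> nat \<Rightarrow> (nat \<Rightarrow> nat \<Rightarrow> tf mat) \<Rightarrow> (nat \<Rightarrow> real) \<Rightarrow> (nat \<Rightarrow> real) \<Rightarrow> real \<Rightarrow> real \<Rightarrow> tf mat"
  where
  "rescaled_grid N M Yb S D \<omega>\<^sub>0 \<epsilon> =
     (let S' = diag_const N (\<lambda>i. S i powr (- 1 / 2)) in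
      (S' \<otimes>\<^sub>k 1\<^sub>m 2) * Y_grid N M Yb * (S' * diag_const N D \<otimes>\<^sub>k mat_inv (F_tilde \<omega>\<^sub>0 \<epsilon>)))"

text \<open>Where \<open>Yg\<close> has a pole, the next two notions are read off its inverse. Division on
  \<^typ>\<open>ereal\<close> satisfies \<open>1 / 0 = \<infinity>\<close>.\<close>

definition grid_sigma_min :: "tf mat \<Rightarrow> ereal \<Rightarrow> ereal" where
  "grid_sigma_min Yg \<omega> =
     (if finite_at Yg \<omega> then ereal (sigma_min (freq Yg \<omega>))
      else 1 / ereal (sigma_max (freq (mat_inv Yg) \<omega>)))"

definition grid_sectorial :: "tf mat \<Rightarrow> ereal \<Rightarrow> bool" where
  "grid_sectorial Yg \<omega> \<longleftrightarrow>
     (if finite_at Yg \<omega> then sectorial (freq Yg \<omega>) else sectorial (freq (mat_inv Yg) \<omega>))"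

definition gain_condition :: "nat \<Rightarrow> (nat \<Rightarrow> tf mat) \<Rightarrow> tf mat \<Rightarrow> ereal \<Rightarrow> bool" where
  "gain_condition N Yc Yg \<omega> \<longleftrightarrow>
     (MAX i\<in>{..<N}. ereal (sigma_max (freq (Yc i) \<omega>))) < grid_sigma_min Yg \<omega>"

text \<open>\<open>\<phi>C i \<omega>\<close> and \<open>\<phi>G \<omega>\<close> are the chosen phases of \<open>freq (Yc i) \<omega>\<close> and
  \<open>freq (mat_inv Yg) \<omega>\<close>.\<close>

definition phase_condition ::
  "nat \<Rightarrow> (nat \<Rightarrow> tf mat) \<Rightarrow> tf mat \<Rightarrow> (nat \<Rightarrow> ereal \<Rightarrow> nat \<Rightarrow> real) \<Rightarrow> (ereal \<Rightarrow> nat \<Rightarrow> real)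
     \<Rightarrow> ereal \<Rightarrow> bool" where
  "phase_condition N Yc Yg \<phi>C \<phi>G \<omega> \<longleftrightarrow>
     (let cmax = (MAX i\<in>{..<N}. phase_max (freq (Yc i) \<omega>) (\<phi>C i \<omega>));
          cmin = (MIN i\<in>{..<N}. phase_min (freq (Yc i) \<omega>) (\<phi>C i \<omega>));
          ginv = freq (mat_inv Yg) \<omega> in
      cmax < ereal pi - phase_max ginv (\<phi>G \<omega>) \<and>
      cmin > - ereal pi - phase_min ginv (\<phi>G \<omega>) \<and>
      grid_sectorial Yg \<omega> \<and>
      cmax - cmin < ereal pi)"

end

(* Write L = H G for the loop matrix, with H the inverse of the rescaled grid admittance. At every
   frequency either condition forces det (I + tau L) to be nonzero for all tau in [0,1]: under the
   gain condition the product of the gains of H and G is below 1; under the phase condition a kernel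
   vector v with y = G v would give (v* G v)(y* H y) < 0, although the two factors lie in sectors
   whose angles add up to something strictly between -pi and pi. The rotations exp(J theta) commute
   with the rescaling, so G is unitarily block diagonal with the rescaled converters as blocks and
   inherits their gains and sectors.

   The set of tau for which I + tau L has no zero in the closed right half plane is then open and
   closed in [0,1]. Open: no zero can come from infinity, and the rest of the half plane is compact.
   Closed: a polynomial q with all roots in the open left half plane satisfies
   |q (i Im s)| <= |q s| for Re s >= 0, an inequality that survives limits in tau, while the left
   side is nonzero because the axis is free of zeros. Hence no argument principle is needed. *)

theory Submission
  imports Defs "HOL-Analysis.Topology_Euclidean_Space" "HOL-Analysis.Convex"
begin

hide_type (open) Finite_Cartesian_Product.vec
hide_const (open) Finite_Cartesian_Product.mat Finite_Cartesian_Product.vec Finite_Cartesian_Product.row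
unbundle no vec_syntax
unbundle no inner_syntax

section \<open>Evaluation of transfer functions\<close>

text \<open>Evaluation at a point is not a ring homomorphism on rational functions. It is one only
  on those without a pole there, and at a pole the value is an artefact of division by zero.
  Identities between transfer matrices are therefore carried to a frequency through
  \<open>partial_hom\<close>, and each use owes a proof that the entries are finite there. This is
  delicate for the individual converters, since only the assembled loop is assumed stable, and for
  the grid, since only its inverse is.

  Membership of the closed loop in \<open>RH_inf\<close> comes down to one scalar: by Cramer's rule
  it is enough that \<open>det (1 + H G)\<close> is a unit among the proper stable functions, that
  is, nonzero on the closed right half plane and at infinity.

  The homotopy is run on polynomials in s obtained by clearing denominators. Their degree may drop
  as tau varies, so roots cannot simply be followed; the norm inequality for stable polynomials is
  pointwise in s and does not see the degree.\<close>

interpretation of_real_poly_hom: map_poly_inj_idom_hom complex_of_real ..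

lemma cpoly_simps [simp]:
  "cpoly 0 s = 0" "cpoly 1 s = 1" "cpoly [:c:] s = complex_of_real c"
  "cpoly (p + q) s = cpoly p s + cpoly q s" "cpoly (- p) s = - cpoly p s"
  "cpoly (p * q) s = cpoly p s * cpoly q s"
  by (simp_all add: cpoly_def of_real_hom.map_poly_pCons_hom of_real_poly_hom.hom_add of_real_poly_hom.hom_mult
      of_real_poly_hom.hom_uminus)

lemma cpoly_prod: "cpoly (prod f A) s = (\<Prod>a\<in>A. cpoly (f a) s)"
  by (induction A rule: infinite_finite_induct) auto

lemma cpoly_cnj: "cpoly p (cnj s) = cnj (cpoly p s)"
  by (simp add: cpoly_def poly_altdef coeff_map_poly)

lemma cpoly_dvd_zero: "p dvd q \<Longrightarrow> cpoly p s = 0 \<Longrightarrow> cpoly q s = 0"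
  by (auto elim!: dvdE)

lemma tf_den_neq_0 [simp]: "tf_den f \<noteq> 0"
  by (simp add: tf_den_def)

lemma tf_eq_Fract: "f = Fract (tf_num f) (tf_den f)"
  by (simp add: tf_num_def tf_den_def)

text \<open>Links an arbitrary representation p / q with the reduced one; the facts about poles,
  values and degrees are read off this equation.\<close>

lemma tf_cross: "q \<noteq> 0 \<Longrightarrow> p * tf_den (Fract p q) = tf_num (Fract p q) * q"
  using tf_eq_Fract[of "Fract p q"] by (simp add: eq_fract(1))

text \<open>Reduction only cancels factors: the reduced denominator divides numerator times q and is
  coprime to the numerator. So no pole arises that is not already a root of q.\<close>

lemma tf_den_dvd:
  assumes "q \<noteq> 0" shows "tf_den (Fract p q) dvd q"
proof -
  have "tf_den (Fract p q) dvd tf_num (Fract p q) * q"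
    using tf_cross[OF assms, of p] by (metis dvd_triv_right)
  moreover have "coprime (tf_den (Fract p q)) (tf_num (Fract p q))"
    by (simp add: tf_num_def tf_den_def coprime_quot_of_fract coprime_commute)
  ultimately show ?thesis
    by (simp add: coprime_dvd_mult_right_iff)
qed

lemma tf_eval_Fract:
  assumes "cpoly q s \<noteq> 0"
  shows "cpoly (tf_den (Fract p q)) s \<noteq> 0" "tf_eval (Fract p q) s = cpoly p s / cpoly q s"
proof -
  have q: "q \<noteq> 0" using assms by auto
  show d: "cpoly (tf_den (Fract p q)) s \<noteq> 0"
    using cpoly_dvd_zero[OF tf_den_dvd[OF q]] assms by blast
  have "cpoly p s * cpoly (tf_den (Fract p q)) s = cpoly (tf_num (Fract p q)) s * cpoly q s"
    using tf_cross[OF q, of p] by (metis cpoly_simps(6))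
  with d assms show "tf_eval (Fract p q) s = cpoly p s / cpoly q s"
    by (simp add: tf_eval_def frac_eq_eq)
qed

text \<open>Cancelling a common factor lowers both degrees by the same amount. The zero numerator is
  treated apart because degrees of products add up only for nonzero factors.\<close>

lemma tf_proper_Fract:
  assumes q: "q \<noteq> 0"
  shows "tf_proper (Fract p q) \<longleftrightarrow> degree p \<le> degree q"
proof (cases "p = 0")
  case True
  hence "tf_num (Fract p q) = 0"
    using tf_cross[OF q, of p] q by simp
  with True show ?thesis by (simp add: tf_proper_def)
next
  case False
  with tf_cross[OF q, of p] have n: "tf_num (Fract p q) \<noteq> 0" by auto
  from tf_cross[OF q, of p]
  have "degree p + degree (tf_den (Fract p q)) = degree (tf_num (Fract p q)) + degree q"
    using False n q by (metis degree_mult_eq tf_den_neq_0)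
  thus ?thesis by (auto simp: tf_proper_def)
qed

text \<open>A ring homomorphism defined on the subring \<open>R\<close> only; outside \<open>R\<close> the value of \<open>h\<close>
  carries no information.\<close>

locale partial_hom =
  fixes R :: "'a::comm_ring_1 set" and h :: "'a \<Rightarrow> 'b::comm_ring_1"
  assumes one: "1 \<in> R" "h 1 = 1"
    and add: "x \<in> R \<Longrightarrow> y \<in> R \<Longrightarrow> x + y \<in> R \<and> h (x + y) = h x + h y"
    and mult: "x \<in> R \<Longrightarrow> y \<in> R \<Longrightarrow> x * y \<in> R \<and> h (x * y) = h x * h y"
    and uminus: "x \<in> R \<Longrightarrow> - x \<in> R \<and> h (- x) = - h x"
begin

lemma zero: "0 \<in> R" "h 0 = 0"
  using add[OF one(1) uminus[THEN conjunct1, OF one(1)]] uminus[OF one(1)] by simp_all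

lemma sum: "(\<And>i. i \<in> I \<Longrightarrow> f i \<in> R) \<Longrightarrow> sum f I \<in> R \<and> h (sum f I) = (\<Sum>i\<in>I. h (f i))"
  by (induction I rule: infinite_finite_induct) (auto simp: zero add)

lemma prod: "(\<And>i. i \<in> I \<Longrightarrow> f i \<in> R) \<Longrightarrow> prod f I \<in> R \<and> h (prod f I) = (\<Prod>i\<in>I. h (f i))"
  by (induction I rule: infinite_finite_induct) (auto simp: one mult)

definition MR :: "'a mat set" where
  "MR = {A. \<forall>i<dim_row A. \<forall>j<dim_col A. A $$ (i,j) \<in> R}"

lemma MR_mult:
  assumes "A \<in> MR" "B \<in> MR" "dim_col A = dim_row B"
  shows "A * B \<in> MR \<and> map_mat h (A * B) = map_mat h A * map_mat h B"
proof -
  have *: "(A * B) $$ (i,j) \<in> R \<and> h ((A * B) $$ (i,j)) = (\<Sum>k<dim_row B. h (A $$ (i,k)) * h (B $$ (k,j)))"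
    if "i < dim_row A" "j < dim_col B" for i j
    using that assms sum[of "{..<dim_row B}" "\<lambda>k. A $$ (i,k) * B $$ (k,j)"] mult
    by (auto simp: scalar_prod_def MR_def atLeast0LessThan)
  show ?thesis
    using * assms(3) by (auto simp: MR_def scalar_prod_def atLeast0LessThan intro!: eq_matI)
qed

lemma MR_add:
  assumes "A \<in> MR" "B \<in> MR" "dim_row A = dim_row B" "dim_col A = dim_col B"
  shows "A + B \<in> MR \<and> map_mat h (A + B) = map_mat h A + map_mat h B"
  using assms add by (auto simp: MR_def intro!: eq_matI)

lemma MR_one: "1\<^sub>m n \<in> MR \<and> map_mat h (1\<^sub>m n) = 1\<^sub>m n"
  by (auto simp: MR_def one zero intro!: eq_matI)

text \<open>The Leibniz expansion consists of ring operations and signs, so it never leaves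
  \<open>R\<close>, unlike elimination, which divides.\<close>

lemma MR_det:
  assumes A: "A \<in> carrier_mat n n" "A \<in> MR"
  shows "det A \<in> R \<and> h (det A) = det (map_mat h A)"
proof -
  let ?t = "\<lambda>p. signof p * (\<Prod>i = 0..<n. A $$ (i, p i))"
  have s: "signof p \<in> R \<and> h (signof p) = signof p" for p :: "nat \<Rightarrow> nat"
    using one uminus[OF one(1)] by (auto simp: sign_def)
  have t: "?t p \<in> R \<and> h (?t p) = signof p * (\<Prod>i = 0..<n. map_mat h A $$ (i, p i))"
    if "p permutes {0..<n}" for p
  proof -
    have "A $$ (i, p i) \<in> R \<and> map_mat h A $$ (i, p i) = h (A $$ (i, p i))" if "i \<in> {0..<n}" for i
      using A permutes_in_image[OF \<open>p permutes {0..<n}\<close>, of i] that by (auto simp: MR_def)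
    thus ?thesis using prod[of "{0..<n}" "\<lambda>i. A $$ (i, p i)"] mult s[of p] by simp
  qed
  have "det (map_mat h A) = (\<Sum>p\<in>{p. p permutes {0..<n}}. h (?t p))"
    unfolding det_def'[OF map_carrier_mat[THEN iffD2, OF A(1)]]
    using t by (intro sum.cong) auto
  thus ?thesis
    using sum[of "{p. p permutes {0..<n}}" ?t] t unfolding det_def'[OF A(1)] by simp
qed

end

lemma tf_arith_Fract:
  "f + g = Fract (tf_num f * tf_den g + tf_num g * tf_den f) (tf_den f * tf_den g)"
  "f * g = Fract (tf_num f * tf_num g) (tf_den f * tf_den g)"
  "- f = Fract (- tf_num f) (tf_den f)"
proof -
  note fg = tf_eq_Fract[of f] tf_eq_Fract[of g]
  have "Fract (tf_num f) (tf_den f) + Fract (tf_num g) (tf_den g) =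
      Fract (tf_num f * tf_den g + tf_num g * tf_den f) (tf_den f * tf_den g)"
    "Fract (tf_num f) (tf_den f) * Fract (tf_num g) (tf_den g) =
      Fract (tf_num f * tf_num g) (tf_den f * tf_den g)"
    "- Fract (tf_num f) (tf_den f) = Fract (- tf_num f) (tf_den f)"
    by simp_all
  thus "f + g = Fract (tf_num f * tf_den g + tf_num g * tf_den f) (tf_den f * tf_den g)"
    "f * g = Fract (tf_num f * tf_num g) (tf_den f * tf_den g)"
    "- f = Fract (- tf_num f) (tf_den f)"
    by (simp_all flip: fg)
qed

lemma partial_hom_tf_eval:
  "partial_hom {f. cpoly (tf_den f) s \<noteq> 0} (\<lambda>f. tf_eval f s)"
proof unfold_locales
  show "1 \<in> {f. cpoly (tf_den f) s \<noteq> 0}" "tf_eval 1 s = 1"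
    using tf_eval_Fract[of 1 s 1] by (simp_all add: One_fract_def)
  fix f g assume "f \<in> {f. cpoly (tf_den f) s \<noteq> 0}" "g \<in> {f. cpoly (tf_den f) s \<noteq> 0}"
  hence f: "cpoly (tf_den f) s \<noteq> 0" and g: "cpoly (tf_den g) s \<noteq> 0" by simp_all
  hence q: "cpoly (tf_den f * tf_den g) s \<noteq> 0" by simp
  have "tf_eval (f + g) s = tf_eval f s + tf_eval g s"
    unfolding tf_arith_Fract(1)[of f g] tf_eval_Fract(2)[OF q]
    using f g by (simp add: tf_eval_def add_frac_eq)
  thus "f + g \<in> {f. cpoly (tf_den f) s \<noteq> 0} \<and> tf_eval (f + g) s = tf_eval f s + tf_eval g s"
    unfolding mem_Collect_eq tf_arith_Fract(1)[of f g] using tf_eval_Fract(1)[OF q] by blast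
  have "tf_eval (f * g) s = tf_eval f s * tf_eval g s"
    unfolding tf_arith_Fract(2)[of f g] tf_eval_Fract(2)[OF q] by (simp add: tf_eval_def)
  thus "f * g \<in> {f. cpoly (tf_den f) s \<noteq> 0} \<and> tf_eval (f * g) s = tf_eval f s * tf_eval g s"
    unfolding mem_Collect_eq tf_arith_Fract(2)[of f g] using tf_eval_Fract(1)[OF q] by blast
next
  fix f assume "f \<in> {f. cpoly (tf_den f) s \<noteq> 0}"
  hence f: "cpoly (tf_den f) s \<noteq> 0" by simp
  have "tf_eval (- f) s = - tf_eval f s"
    unfolding tf_arith_Fract(3)[of f] tf_eval_Fract(2)[OF f] by (simp add: tf_eval_def)
  thus "- f \<in> {f. cpoly (tf_den f) s \<noteq> 0} \<and> tf_eval (- f) s = - tf_eval f s"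
    unfolding mem_Collect_eq tf_arith_Fract(3)[of f] using tf_eval_Fract(1)[OF f] by blast
qed

lemma tf_eval_const [simp]:
  "cpoly (tf_den (tf_const c)) s \<noteq> 0" "tf_eval (tf_const c) s = complex_of_real c"
  using tf_eval_Fract[of 1 s "[:c:]"] by (simp_all add: tf_const_def)

lemma tf_eval_cnj: "tf_eval f (cnj s) = cnj (tf_eval f s)"
  by (simp add: tf_eval_def cpoly_cnj)

section \<open>Values at infinity\<close>

lemma cpoly_at_infinity:
  "((\<lambda>s. cpoly p s / s ^ degree p) \<longlongrightarrow> complex_of_real (lead_coeff p)) at_infinity"
  using poly_divide_tendsto_aux[of "map_poly complex_of_real p"]
  by (simp add: cpoly_def coeff_map_poly)

lemma eventually_cpoly_neq_0:
  assumes "p \<noteq> 0" shows "eventually (\<lambda>s. cpoly p s \<noteq> 0) at_infinity"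
proof -
  have "eventually (\<lambda>s. cpoly p s / s ^ degree p \<noteq> 0) at_infinity"
    using tendsto_imp_eventually_ne[OF cpoly_at_infinity[of p], of 0] assms by simp
  thus ?thesis by eventually_elim auto
qed

text \<open>The second conjunct is kept because equal degrees are what makes \<open>1 / f\<close>
  proper later, in \<open>RH_inverse\<close>.\<close>

lemma tf_proper_tendsto_ex:
  assumes "tf_proper f"
  shows "\<exists>l. (tf_eval f \<longlongrightarrow> l) at_infinity \<and>
    (l \<noteq> 0 \<longrightarrow> degree (tf_num f) = degree (tf_den f))"
proof -
  let ?p = "tf_num f" and ?q = "tf_den f"
  show ?thesis
  proof (cases "degree ?p < degree ?q")
    case True
    hence "((\<lambda>x. poly (map_poly complex_of_real ?p) x / poly (map_poly complex_of_real ?q) x) \<longlongrightarrow> 0) at_infinity"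
      by (intro poly_divide_tendsto_0_at_infinity) simp
    with True show ?thesis by (auto simp: tf_eval_def[abs_def] cpoly_def)
  next
    case False
    with assms have eq: "degree ?p = degree ?q" by (simp add: tf_proper_def)
    let ?l = "complex_of_real (lead_coeff ?p) / complex_of_real (lead_coeff ?q)"
    have "((\<lambda>s. (cpoly ?p s / s ^ degree ?p) / (cpoly ?q s / s ^ degree ?q)) \<longlongrightarrow> ?l) at_infinity"
      by (intro tendsto_divide cpoly_at_infinity) simp
    moreover have "eventually (\<lambda>s. (cpoly ?p s / s ^ degree ?p) / (cpoly ?q s / s ^ degree ?q) = tf_eval f s) at_infinity"
      by (rule eventually_at_infinityI[of 1]) (auto simp: tf_eval_def eq)
    ultimately have *: "(tf_eval f \<longlongrightarrow> ?l) at_infinity"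
      by (rule Lim_transform_eventually)
    with eq show ?thesis by auto
  qed
qed

lemma filterlim_imaginary_axis: "filterlim (\<lambda>t::real. \<i> * complex_of_real t) at_infinity at_top"
  by (rule filterlim_at_infinity_imp_norm_at_top[THEN filterlim_at_infinity_conv_norm_at_top[THEN iffD2], OF
      filterlim_at_infinity_conv_norm_at_top[THEN iffD2]])
     (simp add: norm_mult filterlim_abs_real)

text \<open>\<open>tf_freq\<close> takes the limit along the imaginary axis only, whereas zeros have
  to be excluded for all large s. For a proper function the limit exists in every direction, so the
  two agree.\<close>

lemma tf_freq_infinity:
  assumes "tf_proper f"
  shows "(tf_eval f \<longlongrightarrow> tf_freq f \<infinity>) at_infinity"
    "tf_freq f \<infinity> \<noteq> 0 \<Longrightarrow> degree (tf_num f) = degree (tf_den f)"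
proof -
  obtain l where l: "(tf_eval f \<longlongrightarrow> l) at_infinity"
    "l \<noteq> 0 \<Longrightarrow> degree (tf_num f) = degree (tf_den f)"
    using tf_proper_tendsto_ex[OF assms] by blast
  have "((\<lambda>t::real. tf_eval f (\<i> * complex_of_real t)) \<longlongrightarrow> l) at_top"
    by (rule filterlim_compose[OF l(1) filterlim_imaginary_axis])
  hence "tf_freq f \<infinity> = l"
    by (simp add: tf_freq_def tendsto_Lim)
  with l show "(tf_eval f \<longlongrightarrow> tf_freq f \<infinity>) at_infinity"
    "tf_freq f \<infinity> \<noteq> 0 \<Longrightarrow> degree (tf_num f) = degree (tf_den f)" by auto
qed

text \<open>Away from the finitely many poles the evaluation laws hold, hence for all large s, and
  they pass to the limit; uniqueness of limits identifies the result.\<close>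

lemma partial_hom_tf_infinity: "partial_hom {f. tf_proper f} (\<lambda>f. tf_freq f \<infinity>)"
proof -
  have lim: "tf_freq h \<infinity> = l"
    if "tf_proper h" "(g \<longlongrightarrow> l) at_infinity" "eventually (\<lambda>s. g s = tf_eval h s) at_infinity" for g h l
    using tendsto_unique[OF trivial_limit_at_infinity tf_freq_infinity(1)[OF that(1)]
        Lim_transform_eventually[OF that(2,3)]] .
  have ev: "eventually (\<lambda>s. cpoly (tf_den f) s \<noteq> 0) at_infinity" for f
    by (rule eventually_cpoly_neq_0) simp
  have nz: "f \<noteq> 0" if "tf_num f \<noteq> 0" for f using that by (auto simp: tf_num_def)
  show ?thesis
  proof unfold_locales
    show one: "1 \<in> {f. tf_proper f}" by (simp add: tf_proper_def tf_num_def tf_den_def)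
    show "tf_freq 1 \<infinity> = 1"
      by (rule lim[OF _ tendsto_const]) (use one in \<open>simp_all add: tf_eval_def tf_num_def tf_den_def\<close>)
    fix f g assume "f \<in> {f. tf_proper f}" "g \<in> {f. tf_proper f}"
    hence fg: "tf_proper f" "tf_proper g" by auto
    have "degree (tf_num f * tf_den g + tf_num g * tf_den f) \<le> degree (tf_den f * tf_den g)"
      using fg by (intro degree_add_le order.trans[OF degree_mult_le])
        (simp_all add: tf_proper_def degree_mult_eq)
    hence a: "tf_proper (f + g)" unfolding tf_arith_Fract by (subst tf_proper_Fract) simp_all
    have "degree (tf_num f * tf_num g) \<le> degree (tf_den f * tf_den g)"
      using fg by (intro order.trans[OF degree_mult_le])
        (simp_all add: tf_proper_def degree_mult_eq)
    hence m: "tf_proper (f * g)" unfolding tf_arith_Fract by (subst tf_proper_Fract) simp_all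
    have "eventually (\<lambda>s. tf_eval f s + tf_eval g s = tf_eval (f + g) s) at_infinity"
      using ev[of f] ev[of g] by eventually_elim (simp add: partial_hom.add[OF partial_hom_tf_eval])
    thus "f + g \<in> {f. tf_proper f} \<and> tf_freq (f + g) \<infinity> = tf_freq f \<infinity> + tf_freq g \<infinity>"
      using lim[OF a tendsto_add[OF tf_freq_infinity(1)[OF fg(1)] tf_freq_infinity(1)[OF fg(2)]]] a by simp
    have "eventually (\<lambda>s. tf_eval f s * tf_eval g s = tf_eval (f * g) s) at_infinity"
      using ev[of f] ev[of g] by eventually_elim (simp add: partial_hom.mult[OF partial_hom_tf_eval])
    thus "f * g \<in> {f. tf_proper f} \<and> tf_freq (f * g) \<infinity> = tf_freq f \<infinity> * tf_freq g \<infinity>"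
      using lim[OF m tendsto_mult[OF tf_freq_infinity(1)[OF fg(1)] tf_freq_infinity(1)[OF fg(2)]]] m by simp
  next
    fix f assume "f \<in> {f. tf_proper f}"
    hence f: "tf_proper f" by auto
    hence u: "tf_proper (- f)" unfolding tf_arith_Fract(3)[of f]
      by (subst tf_proper_Fract) (simp_all add: tf_proper_def)
    have "eventually (\<lambda>s. - tf_eval f s = tf_eval (- f) s) at_infinity"
      using ev[of f] by eventually_elim (simp add: partial_hom.uminus[OF partial_hom_tf_eval])
    thus "- f \<in> {f. tf_proper f} \<and> tf_freq (- f) \<infinity> = - tf_freq f \<infinity>"
      using lim[OF u tendsto_minus[OF tf_freq_infinity(1)[OF f]]] u by simp
  qed
qed

lemma partial_hom_tf_freq: "partial_hom {f. tf_finite_at f \<omega>} (\<lambda>f. tf_freq f \<omega>)"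
proof (cases "\<omega> = \<infinity>")
  case True
  thus ?thesis using partial_hom_tf_infinity by (simp add: tf_finite_at_def)
next
  case False
  thus ?thesis using partial_hom_tf_eval[of "\<i> * complex_of_real (real_of_ereal \<omega>)"]
    by (simp add: tf_finite_at_def tf_freq_def)
qed

lemma tf_proper_const: "tf_proper (tf_const c)"
  by (simp add: tf_const_def tf_proper_Fract)

lemma tf_freq_const [simp]:
  "tf_finite_at (tf_const c) \<omega>" "tf_freq (tf_const c) \<omega> = complex_of_real c"
  by (auto simp: tf_finite_at_def tf_freq_def tf_proper_const intro: tendsto_Lim)

section \<open>Homotopies of stable polynomials\<close>

text \<open>Moving s horizontally onto the imaginary axis brings it closer to every root, since all
  roots lie to the left of the axis. The factorization into linear factors multiplies these
  estimates.\<close>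

lemma stable_poly_norm_mono:
  fixes q :: "complex poly"
  assumes "\<And>z. poly q z = 0 \<Longrightarrow> Re z < 0" and s: "0 \<le> Re s"
  shows "cmod (poly q (\<i> * complex_of_real (Im s))) \<le> cmod (poly q s)"
proof -
  let ?t = "\<i> * complex_of_real (Im s)"
  obtain as where q: "smult (lead_coeff q) (\<Prod>a\<leftarrow>as. [:- a, 1:]) = q"
    using fundamental_theorem_algebra_factorized by blast
  have lc: "lead_coeff q \<noteq> 0" using assms(1)[of 0] assms(1)[of 1] by auto
  have "Re a < 0" if "a \<in> set as" for a
  proof (rule assms(1))
    have "poly (\<Prod>a\<leftarrow>as. [:- a, 1:]) a = 0" using that by (induction as) auto
    thus "poly q a = 0" by (subst q[symmetric]) simp
  qed
  hence "cmod (poly (\<Prod>a\<leftarrow>as. [:- a, 1:]) ?t) \<le> cmod (poly (\<Prod>a\<leftarrow>as. [:- a, 1:]) s)"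
  proof (induction as)
    case (Cons a as)
    have "\<bar>Re (?t - a)\<bar> \<le> \<bar>Re (s - a)\<bar>" "Im (?t - a) = Im (s - a)"
      using Cons.prems[of a] s by auto
    hence "cmod (?t - a) \<le> cmod (s - a)"
      unfolding cmod_def by (simp add: abs_le_square_iff del: minus_complex.sel)
    moreover have "poly (\<Prod>a\<leftarrow>a # as. [:- a, 1:]) z = (z - a) * poly (\<Prod>a\<leftarrow>as. [:- a, 1:]) z" for z
      by (simp add: algebra_simps)
    ultimately show ?case
      using Cons by (simp add: norm_mult mult_mono del: list.map prod_list.Cons)
  qed simp
  thus ?thesis
    by (subst (1 2) q[symmetric]) (simp add: norm_mult mult_left_mono)
qed

lemma tendsto_det:
  fixes A :: "'b \<Rightarrow> 'a::{real_normed_field} mat"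
  assumes "\<And>x. A x \<in> carrier_mat n n" "B \<in> carrier_mat n n"
    and "\<And>i j. i < n \<Longrightarrow> j < n \<Longrightarrow> ((\<lambda>x. A x $$ (i,j)) \<longlongrightarrow> B $$ (i,j)) F"
  shows "((\<lambda>x. det (A x)) \<longlongrightarrow> det B) F"
proof -
  have "((\<lambda>x. \<Sum>p\<in>{p. p permutes {0..<n}}. signof p * (\<Prod>i = 0..<n. A x $$ (i, p i))) \<longlongrightarrow>
      (\<Sum>p\<in>{p. p permutes {0..<n}}. signof p * (\<Prod>i = 0..<n. B $$ (i, p i)))) F"
    using permutes_in_image by (intro tendsto_intros assms(3)) force+
  thus ?thesis unfolding det_def'[OF assms(1)] det_def'[OF assms(2)] .
qed

text \<open>\<open>d\<close> is a common denominator of the entries of \<open>L\<close>, so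
  \<open>Q\<close> below is the polynomial \<open>det (d I + tau P)\<close>, equal to
  \<open>d ^ n\<close> times the determinant of interest on the closed right half plane. Its zeros
  there are exactly the ones to be excluded. \<open>inf\<close> is what prevents zeros from arriving
  from infinity.\<close>

lemma det_homotopy_nonzero:
  fixes L :: "complex \<Rightarrow> complex mat" and d :: "complex poly" and P :: "complex poly mat"
  assumes P: "P \<in> carrier_mat n n" and L: "\<And>s. L s \<in> carrier_mat n n"
    and Linf: "Linf \<in> carrier_mat n n"
    and d: "\<And>s. 0 \<le> Re s \<Longrightarrow> poly d s \<noteq> 0"
    and LP: "\<And>s i j. 0 \<le> Re s \<Longrightarrow> i < n \<Longrightarrow> j < n \<Longrightarrow> poly d s * L s $$ (i,j) = poly (P $$ (i,j)) s"
    and lim: "\<And>i j. i < n \<Longrightarrow> j < n \<Longrightarrow> ((\<lambda>s. L s $$ (i,j)) \<longlongrightarrow> Linf $$ (i,j)) at_infinity"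
    and axis: "\<And>\<tau> y. 0 \<le> \<tau> \<Longrightarrow> \<tau> \<le> 1 \<Longrightarrow>
      det (1\<^sub>m n + complex_of_real \<tau> \<cdot>\<^sub>m L (\<i> * complex_of_real y)) \<noteq> 0"
    and inf: "\<And>\<tau>. 0 \<le> \<tau> \<Longrightarrow> \<tau> \<le> 1 \<Longrightarrow> det (1\<^sub>m n + complex_of_real \<tau> \<cdot>\<^sub>m Linf) \<noteq> 0"
    and s: "0 \<le> Re s"
  shows "det (1\<^sub>m n + L s) \<noteq> 0"
proof -
  have ent: "(1\<^sub>m n + c \<cdot>\<^sub>m A) $$ (i,j) = (if i = j then 1 else 0) + c * A $$ (i,j)"
    if "A \<in> carrier_mat n n" "i < n" "j < n" for A :: "complex mat" and c i j
    using that by simp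
  define F where "F \<tau> s = det (1\<^sub>m n + complex_of_real \<tau> \<cdot>\<^sub>m L s)" for \<tau> s
  define Q where "Q \<tau> = det (d \<cdot>\<^sub>m 1\<^sub>m n + [:complex_of_real \<tau>:] \<cdot>\<^sub>m P)" for \<tau>
  \<comment> \<open>As a determinant of evaluated entries the value is jointly continuous in tau and
    s, whatever the degree of \<open>Q\<close> does.\<close>
  have polyQ: "poly (Q \<tau>) s =
      det (Matrix.mat n n (\<lambda>(i,j). (if i = j then poly d s else 0) + \<tau> * poly (P $$ (i,j)) s))" for \<tau> s
    unfolding Q_def comm_ring_hom.hom_det[OF poly_hom.comm_ring_hom_axioms, symmetric] using P
    by (intro arg_cong[of _ _ det]) (auto intro!: eq_matI)
  have QF: "poly (Q \<tau>) s = poly d s ^ n * F \<tau> s" if "0 \<le> Re s" for \<tau> s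
  proof -
    have "Matrix.mat n n (\<lambda>(i,j). (if i = j then poly d s else 0) + \<tau> * poly (P $$ (i,j)) s)
        = poly d s \<cdot>\<^sub>m (1\<^sub>m n + complex_of_real \<tau> \<cdot>\<^sub>m L s)"
      using L[of s] LP[OF that, symmetric] by (auto intro!: eq_matI simp: algebra_simps)
    thus ?thesis using L[of s] by (simp add: polyQ F_def)
  qed
  have contQ: "continuous_on UNIV (\<lambda>(\<tau>,s). poly (Q \<tau>) s)"
    unfolding continuous_on_def polyQ case_prod_beta
    by (intro ballI tendsto_det[where n = n]) (auto intro!: tendsto_intros)
  define T where "T = {\<tau>\<in>{0..1}. \<forall>s. 0 \<le> Re s \<longrightarrow> poly (Q \<tau>) s \<noteq> 0}"
  have ax: "poly (Q \<tau>) (\<i> * complex_of_real y) \<noteq> 0" if "\<tau> \<in> {0..1}" for \<tau> y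
    using QF[of "\<i> * complex_of_real y" \<tau>] axis[of \<tau> y] d[of "\<i> * complex_of_real y"] that by (auto simp: F_def)
  \<comment> \<open>This trades a condition of the form "nonzero", open in tau, for weak
    inequalities, one for each s, which are closed in tau.\<close>
  have "T = {0..1} \<inter> (\<Inter>s\<in>{s. 0 \<le> Re s}. {\<tau>. cmod (poly (Q \<tau>) (\<i> * complex_of_real (Im s))) \<le> cmod (poly (Q \<tau>) s)})"
    (is "_ = _ \<inter> ?I")
  proof (intro equalityI subsetI IntI)
    fix \<tau> assume t: "\<tau> \<in> T"
    thus "\<tau> \<in> {0..1}" by (simp add: T_def)
    have "Re z < 0" if "poly (Q \<tau>) z = 0" for z
      using t that by (force simp: T_def)
    thus "\<tau> \<in> ?I" using stable_poly_norm_mono by auto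
  next
    fix \<tau> assume "\<tau> \<in> {0..1} \<inter> ?I"
    thus "\<tau> \<in> T" using ax by (fastforce simp: T_def)
  qed
  moreover have "closed ?I"
  proof (intro closed_INT ballI closed_Collect_le)
    have "continuous_on UNIV (\<lambda>\<tau>. poly (Q \<tau>) z)" for z
      using continuous_on_compose2[OF contQ, of UNIV "\<lambda>\<tau>. (\<tau>, z)"]
      by (simp add: continuous_on_Pair)
    thus "continuous_on UNIV (\<lambda>\<tau>. cmod (poly (Q \<tau>) (\<i> * complex_of_real (Im z))))"
      "continuous_on UNIV (\<lambda>\<tau>. cmod (poly (Q \<tau>) z))" for z
      by (auto intro: continuous_on_norm)
  qed
  ultimately have "closedin (top_of_set {0..1}) T"
    using closedin_closed by blast
  moreover have "openin (top_of_set {0..1}) T"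
  proof (subst openin_subopen, intro ballI)
    fix \<tau>0 assume t0: "\<tau>0 \<in> T"
    hence t01: "0 \<le> \<tau>0" "\<tau>0 \<le> 1" by (auto simp: T_def)
    \<comment> \<open>The limit is taken jointly in tau and s, so that one radius \<open>b\<close>
      serves all tau near \<open>\<tau>0\<close>.\<close>
    have "((\<lambda>x. F (fst x) (snd x)) \<longlongrightarrow> det (1\<^sub>m n + complex_of_real \<tau>0 \<cdot>\<^sub>m Linf)) (nhds \<tau>0 \<times>\<^sub>F at_infinity)"
      unfolding F_def
    proof (rule tendsto_det[where n = n])
      fix i j assume ij: "i < n" "j < n"
      have "((\<lambda>x. L (snd x) $$ (i,j)) \<longlongrightarrow> Linf $$ (i,j)) (nhds \<tau>0 \<times>\<^sub>F at_infinity)"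
        by (rule filterlim_compose[OF lim[OF ij] filterlim_snd])
      moreover have "(fst \<longlongrightarrow> \<tau>0) (nhds \<tau>0 \<times>\<^sub>F at_infinity)"
        by (rule filterlim_fst)
      ultimately have "((\<lambda>x. (if i = j then 1 else 0) + complex_of_real (fst x) * L (snd x) $$ (i,j))
         \<longlongrightarrow> (if i = j then 1 else 0) + complex_of_real \<tau>0 * Linf $$ (i,j)) (nhds \<tau>0 \<times>\<^sub>F at_infinity)"
        by (intro tendsto_intros)
      thus "((\<lambda>x. (1\<^sub>m n + complex_of_real (fst x) \<cdot>\<^sub>m L (snd x)) $$ (i, j)) \<longlongrightarrow>
          (1\<^sub>m n + complex_of_real \<tau>0 \<cdot>\<^sub>m Linf) $$ (i, j)) (nhds \<tau>0 \<times>\<^sub>F at_infinity)"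
        unfolding ent[OF L ij] ent[OF Linf ij] .
    qed (use L Linf in auto)
    from tendsto_imp_eventually_ne[OF this inf[OF t01]]
    obtain Pf Pg where Pf: "eventually Pf (nhds \<tau>0)" and Pg: "eventually Pg at_infinity"
      and PF: "\<And>\<tau> s. Pf \<tau> \<Longrightarrow> Pg s \<Longrightarrow> F \<tau> s \<noteq> 0"
      unfolding eventually_prod_filter by auto
    obtain X where X: "open X" "\<tau>0 \<in> X" "\<And>\<tau>. \<tau> \<in> X \<Longrightarrow> Pf \<tau>"
      using Pf unfolding eventually_nhds by blast
    obtain b where b: "\<And>s. b \<le> cmod s \<Longrightarrow> Pg s"
      using Pg unfolding eventually_at_infinity by blast
    let ?K = "{s. 0 \<le> Re s} \<inter> cball 0 b"
    have K: "compact ?K" by (intro closed_Int_compact closed_Collect_le compact_cball continuous_intros)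
    have "open ((\<lambda>(\<tau>,s). poly (Q \<tau>) s) -` (- {0}))"
      using contQ unfolding continuous_on_open_vimage[OF open_UNIV] Int_UNIV_right by blast
    \<comment> \<open>On the remaining compact half disc the tube lemma spreads the absence of zeros
      from \<open>\<tau>0\<close> to a neighbourhood.\<close>
    then obtain Y where Y: "open Y" "\<tau>0 \<in> Y" "Y \<times> ?K \<subseteq> (\<lambda>(\<tau>,s). poly (Q \<tau>) s) -` (- {0})"
      using tube_lemma[OF K, of _ \<tau>0] t0 by (force simp: T_def)
    have "{0..1} \<inter> (X \<inter> Y) \<subseteq> T"
    proof (clarsimp simp: T_def)
      fix \<tau> s assume t: "0 \<le> \<tau>" "\<tau> \<le> 1" "\<tau> \<in> X" "\<tau> \<in> Y" and s: "0 \<le> Re s" and 0: "poly (Q \<tau>) s = 0"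
      show False
      proof (cases "b \<le> cmod s")
        case True
        with PF X(3) b t have "F \<tau> s \<noteq> 0" by blast
        with 0 s d[OF s] show False by (simp add: QF)
      next
        case False
        hence "(\<tau>, s) \<in> Y \<times> ?K" using t s by simp
        from subsetD[OF Y(3) this] 0 show False by simp
      qed
    qed
    thus "\<exists>U. openin (top_of_set {0..1}) U \<and> \<tau>0 \<in> U \<and> U \<subseteq> T"
      using X Y t01 by (intro exI[of _ "{0..1} \<inter> (X \<inter> Y)"]) (auto simp: openin_open_Int)
  qed
  moreover have "0 \<in> T"
  proof -
    have "F 0 s = 1" for s
    proof -
      have "1\<^sub>m n + complex_of_real 0 \<cdot>\<^sub>m L s = 1\<^sub>m n" using L[of s] by (auto intro!: eq_matI)
      thus ?thesis by (simp add: F_def)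
    qed
    thus ?thesis using d by (simp add: T_def QF)
  qed
  ultimately have "T = {0..1}"
    using connected_Icc[of "0::real" 1] unfolding connected_clopen by blast
  hence "1 \<in> T" by simp
  hence "F 1 s \<noteq> 0" using s QF[OF s] by (auto simp: T_def)
  moreover have "complex_of_real 1 \<cdot>\<^sub>m L s = L s" by (auto intro!: eq_matI)
  ultimately show ?thesis by (simp add: F_def)
qed

section \<open>Singular values and quadratic forms\<close>

definition norm_sq :: "complex vec \<Rightarrow> real" where
  "norm_sq x = (\<Sum>i<dim_vec x. (cmod (x $ i))\<^sup>2)"

lemma norm_sq_nonneg [simp]: "0 \<le> norm_sq x"
  by (simp add: norm_sq_def sum_nonneg)

lemma norm_sq_eq_0: "x \<in> carrier_vec n \<Longrightarrow> norm_sq x = 0 \<longleftrightarrow> x = 0\<^sub>v n"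
  by (auto simp: norm_sq_def sum_nonneg_eq_0_iff intro!: eq_vecI)

lemma norm_sq_pos: "x \<in> carrier_vec n \<Longrightarrow> x \<noteq> 0\<^sub>v n \<Longrightarrow> 0 < norm_sq x"
  using norm_sq_eq_0[of x n] norm_sq_nonneg[of x] by linarith

lemma cscalar_prod_sum:
  "x \<in> carrier_vec n \<Longrightarrow> y \<in> carrier_vec n \<Longrightarrow> x \<bullet>c y = (\<Sum>i<n. x $ i * cnj (y $ i))"
  by (auto simp: scalar_prod_def atLeast0LessThan intro!: sum.cong)

lemma cscalar_prod_self: "x \<bullet>c x = complex_of_real (norm_sq x)"
  by (simp add: cscalar_prod_sum[of x "dim_vec x"] norm_sq_def complex_norm_square del: of_real_power)

lemma cscalar_prod_cnj:
  "x \<in> carrier_vec n \<Longrightarrow> y \<in> carrier_vec n \<Longrightarrow> y \<bullet>c x = cnj (x \<bullet>c y)"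
  by (simp add: cscalar_prod_sum mult.commute)

lemma cscalar_prod_diff_smult:
  assumes c: "u \<in> carrier_vec n" "v \<in> carrier_vec n" "x \<in> carrier_vec n" "y \<in> carrier_vec n"
  shows "(u - a \<cdot>\<^sub>v v) \<bullet>c (x - b \<cdot>\<^sub>v y) =
    u \<bullet>c x - a * (v \<bullet>c x) - cnj b * (u \<bullet>c y) + a * cnj b * (v \<bullet>c y)"
proof -
  have "u - a \<cdot>\<^sub>v v \<in> carrier_vec n" "x - b \<cdot>\<^sub>v y \<in> carrier_vec n" using c by auto
  thus ?thesis using c
    by (simp add: cscalar_prod_sum[where n = n] sum_distrib_left algebra_simps sum.distrib sum_subtractf)
qed

lemma cscalar_prod_smult:
  assumes "u \<in> carrier_vec n" "v \<in> carrier_vec n"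
  shows "(a \<cdot>\<^sub>v u) \<bullet>c (b \<cdot>\<^sub>v v) = a * cnj b * (u \<bullet>c v)"
proof -
  have "a \<cdot>\<^sub>v u \<in> carrier_vec n" "b \<cdot>\<^sub>v v \<in> carrier_vec n" using assms by auto
  thus ?thesis using assms by (simp add: cscalar_prod_sum[where n = n] sum_distrib_left mult_ac)
qed

lemma norm_sq_smult: "norm_sq (c \<cdot>\<^sub>v x) = (cmod c)\<^sup>2 * norm_sq x"
  by (simp add: norm_sq_def norm_mult power_mult_distrib sum_distrib_left)

section \<open>Adjoints and Hermitian forms\<close>

lemma mat_adjoint_simps [simp]:
  "dim_row (mat_adjoint A) = dim_col A" "dim_col (mat_adjoint A) = dim_row A"
  by (simp_all add: mat_adjoint_def)

lemma mat_adjoint_carrier [simp]: "mat_adjoint A \<in> carrier_mat n m \<longleftrightarrow> A \<in> carrier_mat m n"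
  unfolding carrier_mat_def mem_Collect_eq by auto

lemma mat_adjoint_index [simp]:
  "i < dim_col A \<Longrightarrow> j < dim_row A \<Longrightarrow> mat_adjoint A $$ (i,j) = cnj (A $$ (j,i))"
  by (simp add: mat_adjoint_def mat_of_rows_index)

lemma cscalar_prod_adjoint:
  fixes A :: "complex mat"
  assumes "A \<in> carrier_mat m n" "x \<in> carrier_vec n" "y \<in> carrier_vec m"
  shows "(A *\<^sub>v x) \<bullet>c y = x \<bullet>c (mat_adjoint A *\<^sub>v y)"
proof -
  have "(A *\<^sub>v x) \<bullet>c y = (\<Sum>i<m. \<Sum>j<n. A $$ (i,j) * x $ j * cnj (y $ i))"
    using assms by (subst cscalar_prod_sum[of _ m])
      (auto simp: scalar_prod_def atLeast0LessThan sum_distrib_right intro!: sum.cong)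
  also have "\<dots> = (\<Sum>j<n. \<Sum>i<m. A $$ (i,j) * x $ j * cnj (y $ i))"
    by (rule sum.swap)
  also have "\<dots> = x \<bullet>c (mat_adjoint A *\<^sub>v y)"
    using assms by (subst cscalar_prod_sum[of _ n])
      (auto simp: scalar_prod_def atLeast0LessThan sum_distrib_left mult_ac intro!: sum.cong)
  finally show ?thesis .
qed

lemma norm_sq_mult_bound:
  assumes A: "A \<in> carrier_mat m n"
  obtains K where "0 < K" "\<And>x. x \<in> carrier_vec n \<Longrightarrow> norm_sq (A *\<^sub>v x) \<le> K * norm_sq x"
proof
  \<comment> \<open>The squared Frobenius norm, by Cauchy-Schwarz in each row. The 1 added to it
    keeps the constant positive for the zero matrix.\<close>
  let ?K = "\<Sum>i<m. \<Sum>j<n. (cmod (A $$ (i,j)))\<^sup>2"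
  show "0 < ?K + 1" by (intro add_nonneg_pos sum_nonneg) auto
  fix x :: "complex vec" assume x: "x \<in> carrier_vec n"
  have "(cmod ((A *\<^sub>v x) $ i))\<^sup>2 \<le> (\<Sum>j<n. (cmod (A $$ (i,j)))\<^sup>2) * norm_sq x" if "i < m" for i
  proof -
    have "cmod ((A *\<^sub>v x) $ i) \<le> (\<Sum>j<n. cmod (A $$ (i,j)) * cmod (x $ j))"
      using A x that by (auto simp: scalar_prod_def atLeast0LessThan norm_mult intro!: sum_norm_le)
    hence "(cmod ((A *\<^sub>v x) $ i))\<^sup>2 \<le> (\<Sum>j<n. cmod (A $$ (i,j)) * cmod (x $ j))\<^sup>2"
      by (rule power_mono) simp
    also have "\<dots> \<le> (\<Sum>j<n. (cmod (A $$ (i,j)))\<^sup>2) * (\<Sum>j<n. (cmod (x $ j))\<^sup>2)"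
      by (rule Cauchy_Schwarz_ineq_sum)
    finally show ?thesis using x by (simp add: norm_sq_def)
  qed
  hence "norm_sq (A *\<^sub>v x) \<le> ?K * norm_sq x"
    unfolding sum_distrib_right using A by (subst norm_sq_def) (auto simp: sum_distrib_right intro!: sum_mono)
  thus "norm_sq (A *\<^sub>v x) \<le> (?K + 1) * norm_sq x"
    by (simp add: distrib_right add_increasing2)
qed

lemma Re_cscalar_prod_le:
  assumes "x \<in> carrier_vec n" "y \<in> carrier_vec n"
  shows "2 * Re (x \<bullet>c y) \<le> norm_sq x + norm_sq y"
proof -
  have "2 * Re (a * cnj b) \<le> (cmod a)\<^sup>2 + (cmod b)\<^sup>2" for a b
    using sum_squares_ge_zero[of "Re a - Re b" "Im a - Im b"]
    unfolding cmod_power2 by (simp add: power2_eq_square algebra_simps)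
  hence "(\<Sum>i<n. 2 * Re (x $ i * cnj (y $ i))) \<le> (\<Sum>i<n. (cmod (x $ i))\<^sup>2 + (cmod (y $ i))\<^sup>2)"
    by (rule sum_mono)
  thus ?thesis using assms
    by (simp add: cscalar_prod_sum norm_sq_def sum.distrib flip: sum_distrib_left)
qed

lemma hermitian_entry:
  assumes "mat_adjoint M = M" "M \<in> carrier_mat n n" "i < n" "j < n"
  shows "cnj (M $$ (j,i)) = M $$ (i,j)"
  using assms by (metis carrier_matD mat_adjoint_index)

text \<open>If \<open>K\<close> bounds \<open>y\<^sup>* P y / y\<^sup>* y\<close>, expanding the form at \<open>x - t P x\<close> with \<open>t = 1 / K\<close> gives
  \<open>norm_sq (P x) \<le> K x\<^sup>* P x\<close>, and \<open>x\<close> is recovered boundedly from \<open>P x\<close>.\<close>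

lemma psd_nonsingular_coercive:
  assumes P: "P \<in> carrier_mat n n" and herm: "mat_adjoint P = P"
    and psd: "\<And>x. x \<in> carrier_vec n \<Longrightarrow> 0 \<le> Re ((P *\<^sub>v x) \<bullet>c x)"
    and det: "det P \<noteq> 0"
  obtains c where "0 < c" "\<And>x. x \<in> carrier_vec n \<Longrightarrow> c * norm_sq x \<le> Re ((P *\<^sub>v x) \<bullet>c x)"
proof -
  let ?B = "(1 / det P) \<cdot>\<^sub>m adj_mat P"
  have B: "?B \<in> carrier_mat n n" using adj_mat(1)[OF P] by simp
  have BP: "?B * P = 1\<^sub>m n"
    unfolding mult_smult_assoc_mat[OF adj_mat(1)[OF P] P] adj_mat(3)[OF P]
    using det by (auto intro!: eq_matI)
  obtain K where K: "0 < K" "\<And>x. x \<in> carrier_vec n \<Longrightarrow> norm_sq (P *\<^sub>v x) \<le> K * norm_sq x"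
    using norm_sq_mult_bound[OF P] by blast
  obtain K' where K': "0 < K'" "\<And>x. x \<in> carrier_vec n \<Longrightarrow> norm_sq (?B *\<^sub>v x) \<le> K' * norm_sq x"
    using norm_sq_mult_bound[OF B] by blast
  have "norm_sq x \<le> K' * (K + 1) * Re ((P *\<^sub>v x) \<bullet>c x)" if x: "x \<in> carrier_vec n" for x
  proof -
    define y where "y = P *\<^sub>v x"
    have y: "y \<in> carrier_vec n" and Py: "P *\<^sub>v y \<in> carrier_vec n" using P x by (auto simp: y_def)
    \<comment> \<open>\<open>K + 1\<close> serves as the bound on the form: twice the form at y is
      at most the squared norm of P y plus that of y.\<close>
    have yy: "Re ((P *\<^sub>v y) \<bullet>c y) \<le> (K + 1) * norm_sq y"
    proof -
      have "0 \<le> (K + 1) * norm_sq y" using K(1) by simp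
      moreover have "2 * Re ((P *\<^sub>v y) \<bullet>c y) \<le> (K + 1) * norm_sq y"
        using Re_cscalar_prod_le[OF Py y] K(2)[OF y] by (simp add: distrib_right)
      ultimately show ?thesis by linarith
    qed
    \<comment> \<open>The minimizer of \<open>-2 t + (K + 1) t^2\<close>; the minimum is
      \<open>-t\<close>.\<close>
    let ?t = "1 / (K + 1)"
    let ?z = "x - complex_of_real ?t \<cdot>\<^sub>v y"
    have "(P *\<^sub>v y) \<bullet>c x = y \<bullet>c y"
      using cscalar_prod_adjoint[OF P y x] herm by (simp add: y_def)
    moreover have Pz: "P *\<^sub>v ?z = y - complex_of_real ?t \<cdot>\<^sub>v (P *\<^sub>v y)"
      using P x y by (simp add: mult_minus_distrib_mat_vec mult_mat_vec y_def)
    ultimately have "(P *\<^sub>v ?z) \<bullet>c ?z =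
        y \<bullet>c x - 2 * complex_of_real ?t * (y \<bullet>c y) + (complex_of_real ?t)\<^sup>2 * ((P *\<^sub>v y) \<bullet>c y)"
      unfolding Pz cscalar_prod_diff_smult[OF y Py x y] by (simp add: power2_eq_square algebra_simps)
    hence "Re ((P *\<^sub>v ?z) \<bullet>c ?z) =
        Re (y \<bullet>c x) - 2 * ?t * norm_sq y + ?t\<^sup>2 * Re ((P *\<^sub>v y) \<bullet>c y)"
      unfolding cscalar_prod_self[of y] of_real_power[symmetric] by simp
    moreover have "0 \<le> Re ((P *\<^sub>v ?z) \<bullet>c ?z)" using x y by (intro psd) auto
    ultimately have "2 * ?t * norm_sq y \<le> Re (y \<bullet>c x) + ?t\<^sup>2 * Re ((P *\<^sub>v y) \<bullet>c y)"
      by linarith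
    also have "\<dots> \<le> Re (y \<bullet>c x) + ?t\<^sup>2 * ((K + 1) * norm_sq y)"
      using yy by (intro add_left_mono mult_left_mono) auto
    also have "?t\<^sup>2 * ((K + 1) * norm_sq y) = ?t * norm_sq y"
      using K(1) by (simp add: power2_eq_square)
    finally have "norm_sq y / (K + 1) \<le> Re (y \<bullet>c x)" by simp
    hence *: "norm_sq y \<le> (K + 1) * Re (y \<bullet>c x)"
      using K(1) by (simp add: pos_divide_le_eq mult.commute)
    have "?B *\<^sub>v y = x"
      unfolding y_def using assoc_mult_mat_vec[OF B P x] BP x by simp
    hence "norm_sq x \<le> K' * norm_sq y" using K'(2)[OF y] by simp
    also have "\<dots> \<le> K' * ((K + 1) * Re (y \<bullet>c x))" using * K'(1) by simp
    finally show ?thesis by (simp add: y_def mult.assoc)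
  qed
  thus thesis using K(1) K'(1)
    by (intro that[of "1 / (K' * (K + 1))"]) (auto simp: divide_simps mult_ac)
qed

text \<open>If the supremum \<open>m\<close> of the form on the unit sphere were not an eigenvalue, \<open>m - M\<close> would be
  coercive and a smaller \<open>m\<close> would do. This needs neither compactness nor diagonalization.\<close>

lemma hermitian_max_eigenvalue:
  assumes M: "M \<in> carrier_mat n n" and herm: "mat_adjoint M = M" and n: "0 < n"
  obtains m where "eigenvalue M (complex_of_real m)"
    "\<And>x. x \<in> carrier_vec n \<Longrightarrow> Re ((M *\<^sub>v x) \<bullet>c x) \<le> m * norm_sq x"
proof -
  let ?f = "\<lambda>x. Re ((M *\<^sub>v x) \<bullet>c x)"
  let ?S = "{?f x | x. x \<in> carrier_vec n \<and> norm_sq x = 1}"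
  define m where "m = Sup ?S"
  obtain K where K: "0 < K" "\<And>x. x \<in> carrier_vec n \<Longrightarrow> norm_sq (M *\<^sub>v x) \<le> K * norm_sq x"
    using norm_sq_mult_bound[OF M] by blast
  have bdd: "bdd_above ?S"
  proof (rule bdd_aboveI)
    fix y assume "y \<in> ?S"
    then obtain x where x: "x \<in> carrier_vec n" "norm_sq x = 1" "y = ?f x" by blast
    with Re_cscalar_prod_le[of "M *\<^sub>v x" n x] K(2)[OF x(1)] M show "y \<le> K + 1"
      using K(1) by simp
  qed
  have "unit_vec n 0 \<in> carrier_vec n" "norm_sq (unit_vec n 0) = 1"
    using n cscalar_prod_self[of "unit_vec n 0"] by simp_all
  hence ne: "?S \<noteq> {}" by blast
  have scale: "\<exists>u. u \<in> carrier_vec n \<and> norm_sq u = 1 \<and> ?f x = norm_sq x * ?f u"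
    if x: "x \<in> carrier_vec n" "x \<noteq> 0\<^sub>v n" for x
  proof -
    define c where "c = complex_of_real (1 / sqrt (norm_sq x))"
    have c: "(cmod c)\<^sup>2 * norm_sq x = 1"
      using norm_sq_pos[OF x] by (simp add: c_def norm_divide power_divide)
    have eq: "M *\<^sub>v (c \<cdot>\<^sub>v x) = c \<cdot>\<^sub>v (M *\<^sub>v x)" using M x by (simp add: mult_mat_vec)
    have "(M *\<^sub>v (c \<cdot>\<^sub>v x)) \<bullet>c (c \<cdot>\<^sub>v x) = c * cnj c * ((M *\<^sub>v x) \<bullet>c x)"
      unfolding eq by (rule cscalar_prod_smult) (use M x in auto)
    also have "c * cnj c = complex_of_real ((cmod c)\<^sup>2)" by (simp only: complex_norm_square)
    finally have "?f (c \<cdot>\<^sub>v x) = (cmod c)\<^sup>2 * ?f x" by simp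
    hence "norm_sq x * ?f (c \<cdot>\<^sub>v x) = ?f x" using c by (simp add: mult.assoc[symmetric] mult.commute)
    thus ?thesis using x c by (intro exI[of _ "c \<cdot>\<^sub>v x"]) (auto simp: norm_sq_smult)
  qed
  have bound: "?f x \<le> b * norm_sq x" if "\<And>y. y \<in> ?S \<Longrightarrow> y \<le> b" "x \<in> carrier_vec n" for b x
  proof (cases "x = 0\<^sub>v n")
    case True
    hence 0: "norm_sq x = 0" "M *\<^sub>v x = 0\<^sub>v n" using M norm_sq_eq_0[of x n] by auto
    have "0\<^sub>v n \<bullet>c x = 0" using that(2) by (intro scalar_prod_left_zero) auto
    thus ?thesis unfolding 0 by simp
  next
    case False
    from scale[OF that(2) this] obtain u
      where u: "u \<in> carrier_vec n" "norm_sq u = 1" and eq: "?f x = norm_sq x * ?f u"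
      by (elim exE conjE)
    have "?f u \<le> b" using u by (intro that(1)) blast
    hence "norm_sq x * ?f u \<le> norm_sq x * b" by (intro mult_left_mono) simp_all
    thus ?thesis unfolding eq by (simp only: mult.commute)
  qed
  have max: "?f x \<le> m * norm_sq x" if "x \<in> carrier_vec n" for x
    unfolding m_def by (rule bound[OF cSup_upper[OF _ bdd] that])
  define P where "P = complex_of_real m \<cdot>\<^sub>m 1\<^sub>m n - M"
  have P: "P \<in> carrier_mat n n" using M unfolding P_def by auto
  have Pf: "Re ((P *\<^sub>v x) \<bullet>c x) = m * norm_sq x - ?f x" if x: "x \<in> carrier_vec n" for x
  proof -
    have "P *\<^sub>v x = complex_of_real m \<cdot>\<^sub>v x - M *\<^sub>v x"
      using M x unfolding P_def
      by (subst minus_mult_distrib_mat_vec) (auto simp: smult_scalar_prod_distrib[of _ n] intro!: eq_vecI)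
    moreover have "(complex_of_real m \<cdot>\<^sub>v x - M *\<^sub>v x) \<bullet>c x = complex_of_real m * (x \<bullet>c x) - (M *\<^sub>v x) \<bullet>c x"
      using M x by (subst minus_scalar_prod_distrib[of _ n]) auto
    ultimately show ?thesis by (simp add: cscalar_prod_self)
  qed
  have "det P = 0"
  proof (rule ccontr)
    assume d: "det P \<noteq> 0"
    have h: "mat_adjoint P = P"
      using M hermitian_entry[OF herm M] by (auto simp: P_def intro!: eq_matI)
    obtain c where c: "0 < c" "\<And>x. x \<in> carrier_vec n \<Longrightarrow> c * norm_sq x \<le> Re ((P *\<^sub>v x) \<bullet>c x)"
      using psd_nonsingular_coercive[OF P h _ d] Pf max by auto
    have "m \<le> m - c"
      unfolding m_def
    proof (rule cSup_least[OF ne])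
      fix y assume "y \<in> ?S"
      then obtain x where x: "x \<in> carrier_vec n" "norm_sq x = 1" "y = ?f x" by blast
      with c(2)[OF x(1)] Pf[OF x(1)] show "y \<le> Sup ?S - c" by (simp add: m_def)
    qed
    with c(1) show False by simp
  qed
  moreover have "P = - char_matrix M (complex_of_real m)"
    using M by (auto simp: P_def char_matrix_def intro!: eq_matI)
  ultimately have "eigenvalue M (complex_of_real m)"
    using eigenvalue_det[OF M] det_0_negate[of "char_matrix M (complex_of_real m)" n] M by (simp add: char_matrix_def)
  with max show thesis using that by blast
qed

section \<open>Singular values as extreme gains\<close>

lemma cscalar_prod_gram:
  assumes A: "A \<in> carrier_mat m n" and x: "x \<in> carrier_vec n"
  shows "((mat_adjoint A * A) *\<^sub>v x) \<bullet>c x = complex_of_real (norm_sq (A *\<^sub>v x))"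
proof -
  have Ax: "A *\<^sub>v x \<in> carrier_vec m" using A x by auto
  have "(A *\<^sub>v x) \<bullet>c (A *\<^sub>v x) = x \<bullet>c (mat_adjoint A *\<^sub>v (A *\<^sub>v x))"
    by (rule cscalar_prod_adjoint[OF A x Ax])
  also have "mat_adjoint A *\<^sub>v (A *\<^sub>v x) = (mat_adjoint A * A) *\<^sub>v x"
    using A x by (intro assoc_mult_mat_vec[symmetric]) auto
  finally have "x \<bullet>c ((mat_adjoint A * A) *\<^sub>v x) = complex_of_real (norm_sq (A *\<^sub>v x))"
    by (simp only: cscalar_prod_self)
  thus ?thesis
    using cscalar_prod_cnj[of x n "(mat_adjoint A * A) *\<^sub>v x"] A x by fastforce
qed

text \<open>Ensures that \<open>sqrt k\<close> squares back to \<open>k\<close>, so that it is a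
  singular value in the sense of the definition.\<close>

lemma gram_eigenvalue_nonneg:
  assumes A: "A \<in> carrier_mat m n" and ev: "eigenvalue (mat_adjoint A * A) (complex_of_real k)"
  shows "0 \<le> k"
proof -
  obtain v where v: "v \<in> carrier_vec n" "v \<noteq> 0\<^sub>v n"
    and eq: "(mat_adjoint A * A) *\<^sub>v v = complex_of_real k \<cdot>\<^sub>v v"
    using ev A unfolding eigenvalue_def eigenvector_def by auto
  have "(complex_of_real k \<cdot>\<^sub>v v) \<bullet>c v = complex_of_real k * (v \<bullet>c v)"
    using v by (intro smult_scalar_prod_distrib[of _ n]) auto
  hence "complex_of_real (k * norm_sq v) = complex_of_real (norm_sq (A *\<^sub>v v))"
    using cscalar_prod_gram[OF A v(1)] unfolding eq cscalar_prod_self by simp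
  hence "k * norm_sq v = norm_sq (A *\<^sub>v v)" unfolding of_real_eq_iff .
  thus ?thesis using norm_sq_pos[OF v] norm_sq_nonneg[of "A *\<^sub>v v"]
    by (metis not_le mult_neg_pos)
qed

text \<open>\<open>Max\<close> and \<open>Min\<close> are meaningful only on finite sets. Squaring
  is injective on nonnegative reals and sends singular values to roots of a nonzero characteristic
  polynomial.\<close>

lemma finite_singular_values:
  assumes A: "A \<in> carrier_mat m n"
  shows "finite (singular_values A)"
proof -
  let ?M = "mat_adjoint A * A"
  have M: "?M \<in> carrier_mat n n" using A by auto
  have "char_poly ?M \<noteq> 0" using degree_monic_char_poly[OF M] by auto
  hence "finite {z. poly (char_poly ?M) z = 0}" by (rule poly_roots_finite)
  moreover have "inj_on (\<lambda>s. complex_of_real (s\<^sup>2)) (singular_values A)"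
    by (auto simp: inj_on_def singular_values_def simp del: of_real_power)
  moreover have "(\<lambda>s. complex_of_real (s\<^sup>2)) ` singular_values A \<subseteq> {z. poly (char_poly ?M) z = 0}"
    by (auto simp: singular_values_def eigenvalue_root_char_poly[OF M])
  ultimately show ?thesis by (meson finite_imageD finite_subset)
qed

text \<open>The extreme values of the Rayleigh quotient of the Gram matrix are eigenvalues; the
  minimum comes from \<open>hermitian_max_eigenvalue\<close> applied to the negated Gram matrix.
  Some singular value with each bound is enough: \<open>sigma_max\<close> lies above it and
  \<open>sigma_min\<close> below it. Nonemptiness of the set comes along.\<close>

lemma singular_value_bounds:
  assumes A: "A \<in> carrier_mat m n" and n: "0 < n"
  shows "\<exists>\<sigma> \<in> singular_values A. \<forall>x \<in> carrier_vec n. norm_sq (A *\<^sub>v x) \<le> \<sigma>\<^sup>2 * norm_sq x"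
    and "\<exists>\<sigma> \<in> singular_values A. \<forall>x \<in> carrier_vec n. \<sigma>\<^sup>2 * norm_sq x \<le> norm_sq (A *\<^sub>v x)"
proof -
  let ?M = "mat_adjoint A * A"
  have M: "?M \<in> carrier_mat n n" using A by auto
  have herm: "mat_adjoint ?M = ?M"
    using A by (intro eq_matI) (auto simp: scalar_prod_def mult.commute)
  have form: "Re ((?M *\<^sub>v x) \<bullet>c x) = norm_sq (A *\<^sub>v x)" if "x \<in> carrier_vec n" for x
    using cscalar_prod_gram[OF A that] by simp
  have sv: "sqrt k \<in> singular_values A" "(sqrt k)\<^sup>2 = k" if "eigenvalue ?M (complex_of_real k)" for k
    using gram_eigenvalue_nonneg[OF A that] that by (simp_all add: singular_values_def del: of_real_power)
  obtain k where k: "eigenvalue ?M (complex_of_real k)"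
    "\<And>x. x \<in> carrier_vec n \<Longrightarrow> Re ((?M *\<^sub>v x) \<bullet>c x) \<le> k * norm_sq x"
    using hermitian_max_eigenvalue[OF M herm n] by blast
  show "\<exists>\<sigma> \<in> singular_values A. \<forall>x \<in> carrier_vec n. norm_sq (A *\<^sub>v x) \<le> \<sigma>\<^sup>2 * norm_sq x"
    using k(2) form sv[OF k(1)] by (intro bexI[of _ "sqrt k"]) auto
  have M': "- ?M \<in> carrier_mat n n" using M by auto
  have herm': "mat_adjoint (- ?M) = - ?M"
    using M hermitian_entry[OF herm M] by (intro eq_matI) (auto simp del: index_mult_mat)
  obtain l where l: "eigenvalue (- ?M) (complex_of_real l)"
    "\<And>x. x \<in> carrier_vec n \<Longrightarrow> Re ((- ?M *\<^sub>v x) \<bullet>c x) \<le> l * norm_sq x"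
    using hermitian_max_eigenvalue[OF M' herm' n] by blast
  have "eigenvalue ?M (complex_of_real (- l))"
  proof -
    obtain v where v: "v \<in> carrier_vec n" "v \<noteq> 0\<^sub>v n" "- ?M *\<^sub>v v = complex_of_real l \<cdot>\<^sub>v v"
      using l(1) M unfolding eigenvalue_def eigenvector_def by auto
    have "?M *\<^sub>v v = - (- ?M *\<^sub>v v)"
      using M v(1) by (intro eq_vecI) (auto simp: scalar_prod_def sum_negf)
    also have "\<dots> = complex_of_real (- l) \<cdot>\<^sub>v v" unfolding v(3) by auto
    finally show ?thesis
      using A v(1,2) unfolding eigenvalue_def eigenvector_def by (intro exI[of _ v]) simp
  qed
  note sv = sv[OF this]
  have "- l * norm_sq x \<le> norm_sq (A *\<^sub>v x)" if x: "x \<in> carrier_vec n" for x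
  proof -
    have "(- ?M *\<^sub>v x) \<bullet>c x = - ((?M *\<^sub>v x) \<bullet>c x)" using A x by simp
    with l(2)[OF x] form[OF x] show ?thesis by simp
  qed
  with sv show "\<exists>\<sigma> \<in> singular_values A. \<forall>x \<in> carrier_vec n. \<sigma>\<^sup>2 * norm_sq x \<le> norm_sq (A *\<^sub>v x)"
    by (intro bexI[of _ "sqrt (- l)"]) auto
qed

lemma sigma_max_bound:
  assumes A: "A \<in> carrier_mat m n" and n: "0 < n"
  shows "0 \<le> sigma_max A" "x \<in> carrier_vec n \<Longrightarrow> norm_sq (A *\<^sub>v x) \<le> (sigma_max A)\<^sup>2 * norm_sq x"
proof -
  obtain \<sigma> where s: "\<sigma> \<in> singular_values A"
    "\<And>x. x \<in> carrier_vec n \<Longrightarrow> norm_sq (A *\<^sub>v x) \<le> \<sigma>\<^sup>2 * norm_sq x"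
    using singular_value_bounds(1)[OF A n] by blast
  have le: "\<sigma> \<le> sigma_max A" and s0: "0 \<le> \<sigma>"
    using s(1) finite_singular_values[OF A] by (auto simp: sigma_max_def singular_values_def)
  thus "0 \<le> sigma_max A" by simp
  assume x: "x \<in> carrier_vec n"
  have "\<sigma>\<^sup>2 * norm_sq x \<le> (sigma_max A)\<^sup>2 * norm_sq x"
    using le s0 by (intro mult_right_mono power_mono) auto
  with s(2)[OF x] show "norm_sq (A *\<^sub>v x) \<le> (sigma_max A)\<^sup>2 * norm_sq x" by linarith
qed

lemma sigma_min_bound:
  assumes A: "A \<in> carrier_mat m n" and n: "0 < n"
  shows "0 \<le> sigma_min A" "x \<in> carrier_vec n \<Longrightarrow> (sigma_min A)\<^sup>2 * norm_sq x \<le> norm_sq (A *\<^sub>v x)"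
proof -
  obtain \<sigma> where s: "\<sigma> \<in> singular_values A"
    "\<And>x. x \<in> carrier_vec n \<Longrightarrow> \<sigma>\<^sup>2 * norm_sq x \<le> norm_sq (A *\<^sub>v x)"
    using singular_value_bounds(2)[OF A n] by blast
  have "sigma_min A \<in> singular_values A"
    using s(1) finite_singular_values[OF A] unfolding sigma_min_def by (intro Min_in) auto
  thus 0: "0 \<le> sigma_min A" by (simp add: singular_values_def)
  have le: "sigma_min A \<le> \<sigma>"
    using s(1) finite_singular_values[OF A] by (simp add: sigma_min_def)
  assume x: "x \<in> carrier_vec n"
  have "(sigma_min A)\<^sup>2 * norm_sq x \<le> \<sigma>\<^sup>2 * norm_sq x"
    using le 0 by (intro mult_right_mono power_mono) auto
  with s(2)[OF x] show "(sigma_min A)\<^sup>2 * norm_sq x \<le> norm_sq (A *\<^sub>v x)" by linarith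
qed

section \<open>Phases\<close>

text \<open>For \<open>b - a < pi\<close> this is the sector of all \<open>r * cis \<alpha>\<close> with \<open>r > 0\<close> and \<open>a \<le> \<alpha> \<le> b\<close>;
  the linear inequalities make closure under addition immediate.\<close>

definition phase_cone :: "real \<Rightarrow> real \<Rightarrow> complex set" where
  "phase_cone a b = {z. 0 < Re (z * cis (- ((a + b) / 2))) \<and> 0 \<le> Im (z * cis (- a)) \<and> Im (z * cis (- b)) \<le> 0}"

lemma phase_cone_nonzero: "z \<in> phase_cone a b \<Longrightarrow> z \<noteq> 0"
  by (auto simp: phase_cone_def)

lemma phase_cone_add: "z \<in> phase_cone a b \<Longrightarrow> w \<in> phase_cone a b \<Longrightarrow> z + w \<in> phase_cone a b"
  by (simp add: phase_cone_def distrib_right del: mult_cancel_left)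

text \<open>Zero lies outside the cone, yet zero summands do occur: a nonzero vector may have zero
  coordinates or zero blocks.\<close>

lemma phase_cone_sum:
  assumes "finite I" and f: "\<And>i. i \<in> I \<Longrightarrow> f i = 0 \<or> f i \<in> phase_cone a b" and "\<exists>i\<in>I. f i \<noteq> 0"
  shows "sum f I \<in> phase_cone a b"
proof -
  have "sum f I = sum f {i\<in>I. f i \<noteq> 0}"
    using assms(1) by (intro sum.mono_neutral_right) auto
  moreover have "sum f J \<in> phase_cone a b"
    if "finite J" "J \<noteq> {}" "\<And>i. i \<in> J \<Longrightarrow> f i \<in> phase_cone a b" for J
    using that by (induction J rule: finite_ne_induct) (auto intro: phase_cone_add)
  moreover have "finite {i\<in>I. f i \<noteq> 0}" "{i\<in>I. f i \<noteq> 0} \<noteq> {}" using assms(1,3) by auto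
  ultimately show ?thesis using f by (metis (mono_tags, lifting) mem_Collect_eq)
qed

lemma cis_in_phase_cone:
  assumes "0 < r" "a \<le> \<alpha>" "\<alpha> \<le> b" "b - a < pi"
  shows "complex_of_real r * cis \<alpha> \<in> phase_cone a b"
proof -
  have e: "complex_of_real r * cis \<alpha> * cis t = complex_of_real r * cis (\<alpha> + t)" for t
    by (simp add: cis_mult mult.assoc)
  have "0 < cos (\<alpha> + - ((a + b) / 2))"
    using assms by (intro cos_gt_zero_pi) (simp_all add: field_simps)
  moreover have "0 \<le> sin (\<alpha> + - a)" using assms by (intro sin_ge_zero) simp_all
  moreover have "sin (\<alpha> + - b) \<le> 0"
    using assms sin_ge_zero[of "b - \<alpha>"] sin_minus[of "b - \<alpha>"] by simp
  ultimately show ?thesis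
    using assms(1) unfolding phase_cone_def mem_Collect_eq e
    by (simp add: mult_le_0_iff)
qed

text \<open>The angle obtained is a real number in the prescribed interval, not just an angle modulo
  2 pi. Rotating by minus the midpoint moves the cone into the right half plane, where
  \<open>Arg\<close> needs no branch correction; the midpoint is then added back.\<close>

lemma phase_cone_polar:
  assumes z: "z \<in> phase_cone a b" and ab: "b - a < pi" "a \<le> b"
  obtains r \<alpha> where "0 < r" "a \<le> \<alpha>" "\<alpha> \<le> b" "z = complex_of_real r * cis \<alpha>"
proof -
  define m where "m = (a + b) / 2"
  define w where "w = z * cis (- m)"
  define \<gamma> where "\<gamma> = Arg w"
  have w: "0 < Re w" using z by (simp add: phase_cone_def w_def m_def)
  hence w0: "w \<noteq> 0" by auto
  have r: "0 < cmod w" using w0 by simp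
  have polar: "w = complex_of_real (cmod w) * cis \<gamma>"
    using w0 by (simp add: \<gamma>_def cis_Arg sgn_eq)
  have "cmod w * cos \<gamma> = Re w" using arg_cong[OF polar, of Re] by simp
  hence "0 < cos \<gamma>" using w r by (metis zero_less_mult_pos)
  moreover have "- pi < \<gamma>" "\<gamma> \<le> pi" using Arg_bounded[of w] by (auto simp: \<gamma>_def)
  \<comment> \<open>Cosine decreases on [0, pi], so from pi / 2 on it cannot be positive.\<close>
  moreover have "cos \<bar>\<gamma>\<bar> \<le> cos (pi / 2)" if "pi / 2 \<le> \<bar>\<gamma>\<bar>" "\<bar>\<gamma>\<bar> \<le> pi"
    using that by (intro cos_monotone_0_pi_le) auto
  ultimately have "\<bar>\<gamma>\<bar> < pi / 2" by (force simp: not_le[symmetric])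
  hence g: "- (pi / 2) < \<gamma>" "\<gamma> < pi / 2" by auto
  have zt: "z * cis t = complex_of_real (cmod w) * cis (\<gamma> + m + t)" for t
  proof -
    have "z * cis t = w * cis (m + t)" by (simp add: w_def mult.assoc cis_mult)
    also have "\<dots> = complex_of_real (cmod w) * cis (\<gamma> + m + t)"
      by (subst polar) (simp add: mult.assoc cis_mult add.assoc)
    finally show ?thesis .
  qed
  have "0 \<le> Im (complex_of_real (cmod w) * cis (\<gamma> + m + - a))"
    "Im (complex_of_real (cmod w) * cis (\<gamma> + m + - b)) \<le> 0"
    using z unfolding zt[symmetric] by (simp_all only: phase_cone_def mem_Collect_eq)
  hence "0 \<le> sin (\<gamma> + m - a)" "sin (\<gamma> + m - b) \<le> 0"
    using r by (simp_all add: zero_le_mult_iff mult_le_0_iff)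
  \<comment> \<open>Beyond either end of the interval the angular distance to that end would lie
    strictly between 0 and pi, where sine is positive.\<close>
  hence "a \<le> \<gamma> + m" "\<gamma> + m \<le> b"
  proof -
    assume s: "0 \<le> sin (\<gamma> + m - a)" "sin (\<gamma> + m - b) \<le> 0"
    show "a \<le> \<gamma> + m"
    proof (rule ccontr)
      assume "\<not> ?thesis"
      hence "0 < sin (a - (\<gamma> + m))" using g ab by (intro sin_gt_zero) (simp_all add: m_def field_simps)
      with s(1) sin_minus[of "\<gamma> + m - a"] show False by simp
    qed
    show "\<gamma> + m \<le> b"
    proof (rule ccontr)
      assume "\<not> ?thesis"
      hence "0 < sin (\<gamma> + m - b)" using g ab by (intro sin_gt_zero) (simp_all add: m_def field_simps)
      with s(2) show False by simp
    qed
  qed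
  with r zt[of 0] show thesis by (intro that[of "cmod w" "\<gamma> + m"]) simp_all
qed

text \<open>The cones themselves do not change when both angles are shifted by the same multiple of
  2 pi, but the hypotheses on \<open>b + d\<close> and \<open>a + c\<close> compare real numbers.
  Hence the detour through actual angles: their sum lies strictly between -pi and pi, and there the
  cosine can be negative only where the sine is nonzero.\<close>

lemma phase_cone_mult_not_negative:
  assumes z: "z \<in> phase_cone a b" "b - a < pi" "a \<le> b" and w: "w \<in> phase_cone c d" "d - c < pi" "c \<le> d"
    and sum: "b + d < pi" "- pi < a + c"
  shows "z * w \<noteq> - complex_of_real t \<or> t \<le> 0"
proof -
  obtain r \<alpha> where r: "0 < r" "a \<le> \<alpha>" "\<alpha> \<le> b" "z = complex_of_real r * cis \<alpha>"
    using phase_cone_polar[OF z] by blast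
  obtain s \<beta> where s: "0 < s" "c \<le> \<beta>" "\<beta> \<le> d" "w = complex_of_real s * cis \<beta>"
    using phase_cone_polar[OF w] by blast
  have "z * w = complex_of_real (r * s) * cis (\<alpha> + \<beta>)"
    using r(4) s(4) by (simp add: cis_mult[symmetric])
  hence e: "Re (z * w) = r * s * cos (\<alpha> + \<beta>)" "Im (z * w) = r * s * sin (\<alpha> + \<beta>)"
    by (simp_all del: of_real_mult)
  have b: "- pi < \<alpha> + \<beta>" "\<alpha> + \<beta> < pi" using r s sum by linarith+
  show ?thesis
  proof (rule ccontr)
    assume "\<not> ?thesis"
    hence neg: "r * s * cos (\<alpha> + \<beta>) < 0" "r * s * sin (\<alpha> + \<beta>) = 0" unfolding e[symmetric] by auto
    hence "sin (\<alpha> + \<beta>) = 0" using r(1) s(1) by simp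
    moreover have "\<not> 0 < \<alpha> + \<beta>" using b(2) sin_gt_zero[of "\<alpha> + \<beta>"] calculation by auto
    moreover have "\<not> 0 < - (\<alpha> + \<beta>)"
      using b(1) sin_gt_zero[of "- (\<alpha> + \<beta>)"] calculation(1) unfolding sin_minus by linarith
    ultimately have "\<alpha> + \<beta> = 0" by linarith
    with neg(1) r(1) s(1) show False by (simp add: mult_less_0_iff)
  qed
qed

text \<open>With y = T x the form becomes the sum of |y_k|^2 \<open>cis (\<phi> k)\<close>, a
  nonnegative combination of points of the cone. Since T is invertible and x is nonzero, some
  coefficient is positive.\<close>

lemma is_phases_form_in_cone:
  assumes ph: "is_phases A \<phi>" and A: "A \<in> carrier_mat n n" and x: "x \<in> carrier_vec n" "x \<noteq> 0\<^sub>v n"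
    and bounds: "a \<le> \<phi> (n - 1)" "\<phi> 0 \<le> b" "b - a < pi"
  shows "(A *\<^sub>v x) \<bullet>c x \<in> phase_cone a b"
proof -
  from ph A obtain T where T: "T \<in> carrier_mat n n" "invertible_mat T"
    and eq: "A = mat_adjoint T * mat_diag n (\<lambda>k. cis (\<phi> k)) * T"
    and mono: "\<And>i j. i \<le> j \<Longrightarrow> j < n \<Longrightarrow> \<phi> j \<le> \<phi> i"
    by (auto simp: is_phases_def Let_def)
  let ?D = "mat_diag n (\<lambda>k. cis (\<phi> k))"
  define y where "y = T *\<^sub>v x"
  have y: "y \<in> carrier_vec n" using T x by (auto simp: y_def)
  have D: "?D \<in> carrier_mat n n" by simp
  obtain B where B: "B * T = 1\<^sub>m n" "B \<in> carrier_mat n n"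
    using T unfolding invertible_mat_def inverts_mat_def
    by (metis carrier_matD carrier_matI index_mult_mat(2,3) index_one_mat(2,3))
  have "B *\<^sub>v y = x" unfolding y_def using assoc_mult_mat_vec[OF B(2) T(1) x(1)] B x by simp
  hence "y \<noteq> 0\<^sub>v n" using B x by auto
  then obtain k where k: "k < n" "y $ k \<noteq> 0" using y by (metis eq_vecI carrier_vecD index_zero_vec)
  have "A *\<^sub>v x = mat_adjoint T *\<^sub>v (?D *\<^sub>v y)"
    using T x D unfolding eq y_def
    by (simp add: assoc_mult_mat_vec[of _ n n _ n])
  moreover have "(mat_adjoint T *\<^sub>v (?D *\<^sub>v y)) \<bullet>c x = (?D *\<^sub>v y) \<bullet>c (mat_adjoint (mat_adjoint T) *\<^sub>v x)"
    using T x mult_mat_vec_carrier[OF D y] by (intro cscalar_prod_adjoint[of _ n n]) auto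
  moreover have "mat_adjoint (mat_adjoint T) = T" using T by (intro eq_matI) auto
  ultimately have "(A *\<^sub>v x) \<bullet>c x = (?D *\<^sub>v y) \<bullet>c y" by (simp add: y_def)
  also have "\<dots> = (\<Sum>k<n. complex_of_real ((cmod (y $ k))\<^sup>2) * cis (\<phi> k))"
  proof -
    have "(?D *\<^sub>v y) $ k = cis (\<phi> k) * y $ k" if "k < n" for k
      using that y by (simp add: scalar_prod_def mat_diag_def if_distrib[of "\<lambda>c. c * _"] cong: if_cong)
    thus ?thesis
      using y mult_mat_vec_carrier[OF D y] by (subst cscalar_prod_sum[of _ n])
        (auto simp: complex_norm_square mult_ac simp del: of_real_power intro!: sum.cong)
  qed
  also have "\<dots> \<in> phase_cone a b"
  proof (rule phase_cone_sum)
    show "\<exists>i\<in>{..<n}. complex_of_real ((cmod (y $ i))\<^sup>2) * cis (\<phi> i) \<noteq> 0" using k by auto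
    fix i assume i: "i \<in> {..<n}"
    hence "\<phi> (n - 1) \<le> \<phi> i" "\<phi> i \<le> \<phi> 0" by (auto intro!: mono)
    hence "a \<le> \<phi> i" "\<phi> i \<le> b" using bounds by linarith+
    thus "complex_of_real ((cmod (y $ i))\<^sup>2) * cis (\<phi> i) = 0
        \<or> complex_of_real ((cmod (y $ i))\<^sup>2) * cis (\<phi> i) \<in> phase_cone a b"
      using bounds(3) by (cases "y $ i = 0") (auto intro!: cis_in_phase_cone simp del: of_real_power)
  qed simp
  finally show ?thesis .
qed

section \<open>Nonsingularity from small gain or small phase\<close>

lemma smult_mat_mult_vec:
  fixes A :: "'a::comm_ring_1 mat"
  assumes "A \<in> carrier_mat m n" "v \<in> carrier_vec n"
  shows "(c \<cdot>\<^sub>m A) *\<^sub>v v = c \<cdot>\<^sub>v (A *\<^sub>v v)"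
  using assms by (intro eq_vecI) (auto simp: smult_scalar_prod_distrib[of _ n])

lemma det_one_plus_eq_0E:
  fixes G H :: "complex mat"
  assumes G: "G \<in> carrier_mat n n" and H: "H \<in> carrier_mat n n"
    and "det (1\<^sub>m n + c \<cdot>\<^sub>m (H * G)) = 0"
  obtains v where "v \<in> carrier_vec n" "v \<noteq> 0\<^sub>v n" "v = (- c) \<cdot>\<^sub>v (H *\<^sub>v (G *\<^sub>v v))"
proof -
  have "1\<^sub>m n + c \<cdot>\<^sub>m (H * G) \<in> carrier_mat n n" using G H by auto
  then obtain v where v: "v \<in> carrier_vec n" "v \<noteq> 0\<^sub>v n"
    and 0: "(1\<^sub>m n + c \<cdot>\<^sub>m (H * G)) *\<^sub>v v = 0\<^sub>v n"
    using det_0_iff_vec_prod_zero_field assms(3) by blast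
  have HGv: "H *\<^sub>v (G *\<^sub>v v) \<in> carrier_vec n" using G H v by auto
  have "(c \<cdot>\<^sub>m (H * G)) *\<^sub>v v = c \<cdot>\<^sub>v (H *\<^sub>v (G *\<^sub>v v))"
    using G H v smult_mat_mult_vec[of "H * G" n n v c] assoc_mult_mat_vec[OF H G v(1)] by simp
  hence "v + c \<cdot>\<^sub>v (H *\<^sub>v (G *\<^sub>v v)) = 0\<^sub>v n"
    using 0 G H v by (subst (asm) add_mult_distrib_mat_vec[of _ n n]) auto
  hence 0: "(v + c \<cdot>\<^sub>v (H *\<^sub>v (G *\<^sub>v v))) $ i = 0" if "i < n" for i
    using that by simp
  have "v $ i = - c * (H *\<^sub>v (G *\<^sub>v v)) $ i" if "i < n" for i
    using 0[OF that] that carrier_vecD[OF HGv] by (simp add: eq_neg_iff_add_eq_0)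
  hence "v = (- c) \<cdot>\<^sub>v (H *\<^sub>v (G *\<^sub>v v))" using v H by (intro eq_vecI) auto
  with v show thesis using that by blast
qed

lemma small_gain_nonsingular:
  assumes G: "G \<in> carrier_mat n n" and H: "H \<in> carrier_mat n n"
    and g: "\<And>x. x \<in> carrier_vec n \<Longrightarrow> norm_sq (G *\<^sub>v x) \<le> g\<^sup>2 * norm_sq x"
    and h: "\<And>x. x \<in> carrier_vec n \<Longrightarrow> norm_sq (H *\<^sub>v x) \<le> h\<^sup>2 * norm_sq x"
    and gh: "0 \<le> g" "0 \<le> h" "h * g < 1" and \<tau>: "0 \<le> \<tau>" "\<tau> \<le> 1"
  shows "det (1\<^sub>m n + complex_of_real \<tau> \<cdot>\<^sub>m (H * G)) \<noteq> 0"
proof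
  assume "det (1\<^sub>m n + complex_of_real \<tau> \<cdot>\<^sub>m (H * G)) = 0"
  then obtain v where v: "v \<in> carrier_vec n" "v \<noteq> 0\<^sub>v n"
    and eq: "v = (- complex_of_real \<tau>) \<cdot>\<^sub>v (H *\<^sub>v (G *\<^sub>v v))"
    using det_one_plus_eq_0E[OF G H] by blast
  have Gv: "G *\<^sub>v v \<in> carrier_vec n" using G v by auto
  have "norm_sq v = \<tau>\<^sup>2 * norm_sq (H *\<^sub>v (G *\<^sub>v v))"
    by (subst eq) (simp add: norm_sq_smult)
  also have "\<dots> \<le> 1 * norm_sq (H *\<^sub>v (G *\<^sub>v v))"
    using \<tau> by (intro mult_right_mono) (auto simp: power_le_one)
  also have "\<dots> \<le> h\<^sup>2 * (g\<^sup>2 * norm_sq v)"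
    using h[OF Gv] g[OF v(1)] mult_left_mono[OF g[OF v(1)], of "h\<^sup>2"] by simp
  also have "\<dots> = (h * g)\<^sup>2 * norm_sq v" by (simp add: power_mult_distrib)
  also have "\<dots> < 1 * norm_sq v"
    using gh norm_sq_pos[OF v] by (intro mult_strict_right_mono power_less_one_iff[THEN iffD2]) auto
  finally show False by simp
qed

lemma small_phase_nonsingular:
  assumes G: "G \<in> carrier_mat n n" and H: "H \<in> carrier_mat n n"
    and g: "\<And>x. x \<in> carrier_vec n \<Longrightarrow> x \<noteq> 0\<^sub>v n \<Longrightarrow> (G *\<^sub>v x) \<bullet>c x \<in> phase_cone a b" "b - a < pi" "a \<le> b"
    and h: "\<And>x. x \<in> carrier_vec n \<Longrightarrow> x \<noteq> 0\<^sub>v n \<Longrightarrow> (H *\<^sub>v x) \<bullet>c x \<in> phase_cone c d" "d - c < pi" "c \<le> d"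
    and sum: "b + d < pi" "- pi < a + c" and \<tau>: "0 \<le> \<tau>"
  shows "det (1\<^sub>m n + complex_of_real \<tau> \<cdot>\<^sub>m (H * G)) \<noteq> 0"
proof
  assume "det (1\<^sub>m n + complex_of_real \<tau> \<cdot>\<^sub>m (H * G)) = 0"
  then obtain v where v: "v \<in> carrier_vec n" "v \<noteq> 0\<^sub>v n"
    and eq: "v = (- complex_of_real \<tau>) \<cdot>\<^sub>v (H *\<^sub>v (G *\<^sub>v v))"
    using det_one_plus_eq_0E[OF G H] by blast
  define y where "y = G *\<^sub>v v"
  have y: "y \<in> carrier_vec n" and Hy: "H *\<^sub>v y \<in> carrier_vec n" using G H v by (auto simp: y_def)
  let ?z = "y \<bullet>c v" and ?w = "(H *\<^sub>v y) \<bullet>c y"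
  have z: "?z \<in> phase_cone a b" using g(1)[OF v] by (simp add: y_def)
  have "y \<noteq> 0\<^sub>v n"
  proof
    assume "y = 0\<^sub>v n"
    hence "?z = 0" using v by simp
    with phase_cone_nonzero[OF z] show False by simp
  qed
  hence w: "?w \<in> phase_cone c d" by (rule h(1)[OF y])
  \<comment> \<open>For tau = 0 the kernel equation would read v = 0.\<close>
  have t: "0 < \<tau>"
  proof (rule ccontr)
    assume "\<not> 0 < \<tau>"
    hence "v = 0 \<cdot>\<^sub>v (H *\<^sub>v y)" using \<tau> eq by (simp add: y_def)
    also have "\<dots> = 0\<^sub>v n" using H by (intro eq_vecI) auto
    finally show False using v by simp
  qed
  \<comment> \<open>Substituting v = - tau H y in the second, conjugated argument gives z = - tau
    cnj w, so z w is the negative real number - tau |w|^2.\<close>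
  have "?z = y \<bullet>c ((- complex_of_real \<tau>) \<cdot>\<^sub>v (H *\<^sub>v y))"
    using eq by (simp add: y_def)
  also have "\<dots> = (1 \<cdot>\<^sub>v y) \<bullet>c ((- complex_of_real \<tau>) \<cdot>\<^sub>v (H *\<^sub>v y))" by simp
  also have "\<dots> = - complex_of_real \<tau> * cnj ?w"
    unfolding cscalar_prod_smult[OF y Hy] cscalar_prod_cnj[OF Hy y] by simp
  finally have "?z * ?w = - complex_of_real (\<tau> * (cmod ?w)\<^sup>2)"
    by (simp add: complex_norm_square mult_ac del: of_real_power)
  moreover have "0 < \<tau> * (cmod ?w)\<^sup>2" using t phase_cone_nonzero[OF w] by simp
  ultimately show False
    using phase_cone_mult_not_negative[OF z g(2,3) w h(2,3) sum, of "\<tau> * (cmod ?w)\<^sup>2"] by linarith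
qed

section \<open>Block diagonal matrices\<close>

text \<open>\<open>mat_inv\<close> is specified only where \<open>mat_inverse\<close> succeeds, so
  success is shown first, through the units of the matrix ring. Over a field a left inverse of a
  square matrix is already two-sided.\<close>

lemma mat_inv_eqI:
  fixes A :: "'a::field mat"
  assumes A: "A \<in> carrier_mat n n" and B: "B \<in> carrier_mat n n" and BA: "B * A = 1\<^sub>m n"
  shows "mat_inv A = B" "A * B = 1\<^sub>m n"
proof -
  show AB: "A * B = 1\<^sub>m n" using mat_mult_left_right_inverse[OF B A BA] .
  have "A \<in> Units (ring_mat TYPE('a) n ())"
    using A B AB BA by (auto simp: Units_def ring_mat_def)
  then obtain C where C: "mat_inverse A = Some C"
    using mat_inverse(1)[OF A, of "()"] by (cases "mat_inverse A") auto
  have C': "A * C = 1\<^sub>m n" "C \<in> carrier_mat n n" using mat_inverse(2)[OF A C] by auto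
  have "C = (B * A) * C" using C'(2) by (simp add: BA)
  also have "\<dots> = B * (A * C)" by (rule assoc_mult_mat[OF B A C'(2)])
  also have "\<dots> = B" using B C'(1) by simp
  finally show "mat_inv A = B" by (simp add: mat_inv_def C)
qed

lemma invertible_matE:
  fixes A :: "'a::field mat"
  assumes A: "A \<in> carrier_mat n n" and inv: "invertible_mat A"
  obtains B where "B \<in> carrier_mat n n" "A * B = 1\<^sub>m n" "B * A = 1\<^sub>m n"
proof -
  obtain B where B: "A * B = 1\<^sub>m n" "B * A = 1\<^sub>m (dim_row B)"
    using A inv unfolding invertible_mat_def inverts_mat_def by auto
  have "dim_col (A * B) = n" "dim_col (B * A) = dim_row B" using B by simp_all
  hence "B \<in> carrier_mat n n" using A by auto
  with B show thesis using that by auto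
qed

lemma invertible_matI:
  "A \<in> carrier_mat n n \<Longrightarrow> B \<in> carrier_mat n n \<Longrightarrow> A * B = 1\<^sub>m n \<Longrightarrow> B * A = 1\<^sub>m n \<Longrightarrow> invertible_mat A"
  unfolding invertible_mat_def inverts_mat_def by auto

lemma mat_inv:
  fixes A :: "'a::field mat"
  assumes "A \<in> carrier_mat n n" "invertible_mat A"
  shows "mat_inv A \<in> carrier_mat n n" "A * mat_inv A = 1\<^sub>m n" "mat_inv A * A = 1\<^sub>m n"
  using invertible_matE[OF assms] mat_inv_eqI[OF assms(1)] by metis+

section \<open>Two by two matrices and their block diagonal assembly\<close>

lemma mult_2x2_index:
  fixes A B :: "'a::comm_ring_1 mat"
  assumes "A \<in> carrier_mat 2 2" "B \<in> carrier_mat 2 2" "i < 2" "j < 2"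
  shows "(A * B) $$ (i,j) = A $$ (i,0) * B $$ (0,j) + A $$ (i,1) * B $$ (1,j)"
  using assms by (simp add: scalar_prod_def numeral_2_eq_2)

lemma eq_mat_2x2I:
  assumes "A \<in> carrier_mat 2 2" "B \<in> carrier_mat 2 2"
    "A $$ (0,0) = B $$ (0,0)" "A $$ (0,1) = B $$ (0,1)" "A $$ (1,0) = B $$ (1,0)" "A $$ (1,1) = B $$ (1,1)"
  shows "A = B"
proof (rule eq_matI)
  fix i j assume "i < dim_row B" "j < dim_col B"
  hence "i = 0 \<or> i = 1" "j = 0 \<or> j = 1" using assms(2) by auto
  thus "A $$ (i,j) = B $$ (i,j)" using assms(3-) by (elim disjE) simp_all
qed (use assms in auto)

text \<open>An index-based form of \<^const>\<open>diag_block_mat\<close> for \<open>2 \<times> 2\<close> blocks.\<close>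

definition block_diag :: "nat \<Rightarrow> (nat \<Rightarrow> 'a::zero mat) \<Rightarrow> 'a mat" where
  "block_diag N f = Matrix.mat (2 * N) (2 * N)
     (\<lambda>(r,c). if r div 2 = c div 2 then f (r div 2) $$ (r mod 2, c mod 2) else 0)"

lemma block_diag_carrier [simp]: "block_diag N f \<in> carrier_mat (2 * N) (2 * N)"
  by (simp add: block_diag_def)

lemma block_diag_dim [simp]: "dim_row (block_diag N f) = 2 * N" "dim_col (block_diag N f) = 2 * N"
  by (simp_all add: block_diag_def)

lemma block_diag_index:
  "r < 2 * N \<Longrightarrow> c < 2 * N \<Longrightarrow> block_diag N f $$ (r,c) =
    (if r div 2 = c div 2 then f (r div 2) $$ (r mod 2, c mod 2) else 0)"
  by (simp add: block_diag_def)

lemma block_diag_block: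
  "i < N \<Longrightarrow> a < 2 \<Longrightarrow> b < 2 \<Longrightarrow> block_diag N f $$ (2 * i + a, 2 * i + b) = f i $$ (a,b)"
  by (subst block_diag_index) auto

lemma block_diag_cong: "(\<And>i. i < N \<Longrightarrow> f i = g i) \<Longrightarrow> block_diag N f = block_diag N g"
  by (auto simp: block_diag_index intro!: eq_matI)

lemma block_diag_one: "block_diag N (\<lambda>_. 1\<^sub>m 2) = (1\<^sub>m (2 * N) :: 'a::comm_ring_1 mat)"
proof -
  have eq: "r = c \<longleftrightarrow> r div 2 = c div 2 \<and> r mod 2 = c mod 2" for r c :: nat
    by (metis div_mult_mod_eq)
  show ?thesis
  proof (rule eq_matI)
    fix r c assume "r < dim_row (1\<^sub>m (2 * N) :: 'a mat)" "c < dim_col (1\<^sub>m (2 * N) :: 'a mat)"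
    hence rc: "r < 2 * N" "c < 2 * N" by simp_all
    show "block_diag N (\<lambda>_. 1\<^sub>m 2) $$ (r, c) = (1\<^sub>m (2 * N) :: 'a mat) $$ (r, c)"
      unfolding block_diag_index[OF rc] index_one_mat(1)[OF rc] eq[of r c]
      by (simp only: index_one_mat(1) mod_less_divisor zero_less_numeral)
        (cases "r div 2 = c div 2"; cases "r mod 2 = c mod 2"; simp only: simp_thms if_True if_False)
  qed simp_all
qed

lemma diag_block_mat_eq_block_diag:
  assumes "\<And>i. i < N \<Longrightarrow> f i \<in> carrier_mat 2 2"
  shows "diag_block_mat (map f [0..<N]) = block_diag N f"
  using assms
proof (induction N)
  case 0
  show ?case by (auto intro!: eq_matI)
next
  case (Suc N)
  have fN: "f N \<in> carrier_mat 2 2" using Suc.prems by simp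
  have IH: "diag_block_mat (map f [0..<N]) = block_diag N f" using Suc by simp
  have big: "r div 2 = N \<and> r mod 2 = r - 2 * N" if "r < 2 * Suc N" "\<not> r < 2 * N" for r
    using that by presburger
  have small: "r div 2 \<noteq> N" if "r < 2 * N" for r using that by presburger
  show ?case
  proof (rule eq_matI)
    fix r c assume "r < dim_row (block_diag (Suc N) f)" "c < dim_col (block_diag (Suc N) f)"
    hence rc: "r < 2 * Suc N" "c < 2 * Suc N" by simp_all
    hence "diag_block_mat (map f [0..<Suc N]) $$ (r, c) =
      (if r < 2 * N then if c < 2 * N then block_diag N f $$ (r, c) else 0
       else if c < 2 * N then 0 else f N $$ (r - 2 * N, c - 2 * N))"
      using fN by (simp add: diag_block_mat_last Let_def IH)
    also have "\<dots> = block_diag (Suc N) f $$ (r, c)"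
    proof (cases "r < 2 * N"; cases "c < 2 * N")
      assume h: "r < 2 * N" "c < 2 * N"
      show ?thesis by (simp only: h if_True block_diag_index[OF rc] block_diag_index[OF h])
    next
      assume h: "r < 2 * N" "\<not> c < 2 * N"
      show ?thesis
        by (simp only: h if_True if_False block_diag_index[OF rc] big[OF rc(2) h(2)] small[OF h(1)])
    next
      assume h: "\<not> r < 2 * N" "c < 2 * N"
      show ?thesis
        by (simp only: h if_True if_False block_diag_index[OF rc] big[OF rc(1) h(1)] small[OF h(2), symmetric])
    next
      assume h: "\<not> r < 2 * N" "\<not> c < 2 * N"
      show ?thesis
        by (simp only: h if_True if_False block_diag_index[OF rc] big[OF rc(1) h(1)] big[OF rc(2) h(2)] simp_thms)
    qed
    finally show "diag_block_mat (map f [0..<Suc N]) $$ (r, c) = block_diag (Suc N) f $$ (r, c)" .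
  qed (use fN in \<open>simp_all add: diag_block_mat_last Let_def IH\<close>)
qed

lemma sum_lessThan_double:
  fixes h :: "nat \<Rightarrow> 'a::comm_monoid_add"
  shows "(\<Sum>k<2 * N. h k) = (\<Sum>i<N. h (2 * i) + h (2 * i + 1))"
  by (induction N) (simp_all add: add.assoc)

lemma block_diag_mult:
  fixes f g :: "nat \<Rightarrow> 'a::comm_ring_1 mat"
  assumes f: "\<And>i. i < N \<Longrightarrow> f i \<in> carrier_mat 2 2" and g: "\<And>i. i < N \<Longrightarrow> g i \<in> carrier_mat 2 2"
  shows "block_diag N f * block_diag N g = block_diag N (\<lambda>i. f i * g i)"
proof (rule eq_matI)
  fix r c assume "r < dim_row (block_diag N (\<lambda>i. f i * g i))" "c < dim_col (block_diag N (\<lambda>i. f i * g i))"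
  hence rc: "r < 2 * N" "c < 2 * N" by simp_all
  hence rN: "r div 2 < N" by auto
  have "(block_diag N f * block_diag N g) $$ (r,c)
      = (\<Sum>k<2 * N. block_diag N f $$ (r,k) * block_diag N g $$ (k,c))"
    using rc by (simp add: scalar_prod_def atLeast0LessThan)
  \<comment> \<open>The outer condition leaves only the block containing row r; the inner one keeps
    it only if column c meets the same block.\<close>
  also have "\<dots> = (\<Sum>i<N. if i = r div 2 then
      (if i = c div 2 then f i $$ (r mod 2, 0) * g i $$ (0, c mod 2) + f i $$ (r mod 2, 1) * g i $$ (1, c mod 2) else 0) else 0)"
    unfolding sum_lessThan_double using rc by (intro sum.cong) (auto simp: block_diag_index)
  also have "\<dots> = (if r div 2 = c div 2 then (f (r div 2) * g (r div 2)) $$ (r mod 2, c mod 2) else 0)"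
    unfolding mult_2x2_index[OF f[OF rN] g[OF rN] mod_less_divisor[OF zero_less_numeral]
        mod_less_divisor[OF zero_less_numeral]]
    using rN by simp
  finally show "(block_diag N f * block_diag N g) $$ (r,c) = block_diag N (\<lambda>i. f i * g i) $$ (r,c)"
    using rc by (simp only: block_diag_index)
qed simp_all

definition block_vec :: "'a vec \<Rightarrow> nat \<Rightarrow> 'a vec" where
  "block_vec x i = Matrix.vec 2 (\<lambda>a. x $ (2 * i + a))"

lemma block_vec_carrier [simp]: "block_vec x i \<in> carrier_vec 2"
  by (simp add: block_vec_def)

lemma block_vec_index: "block_vec x i $ 0 = x $ (2 * i)" "block_vec x i $ 1 = x $ (2 * i + 1)"
  by (simp_all add: block_vec_def)

lemma mult_vec_2_index:
  fixes A :: "'a::comm_ring_1 mat"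
  assumes "A \<in> carrier_mat 2 2" "v \<in> carrier_vec 2" "a < 2"
  shows "(A *\<^sub>v v) $ a = A $$ (a,0) * v $ 0 + A $$ (a,1) * v $ 1"
  using assms by (simp add: scalar_prod_def numeral_2_eq_2)

lemma block_vec_mult:
  fixes f :: "nat \<Rightarrow> 'a::comm_ring_1 mat"
  assumes f: "f i \<in> carrier_mat 2 2" and x: "x \<in> carrier_vec (2 * N)" and i: "i < N"
  shows "block_vec (block_diag N f *\<^sub>v x) i = f i *\<^sub>v block_vec x i"
proof (rule eq_vecI)
  fix a assume "a < dim_vec (f i *\<^sub>v block_vec x i)"
  hence a: "a < 2" using f by simp
  have r: "2 * i + a < 2 * N" using i a by simp
  have "block_vec (block_diag N f *\<^sub>v x) i $ a = (\<Sum>k<2 * N. block_diag N f $$ (2 * i + a, k) * x $ k)"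
    using r a x by (simp add: block_vec_def scalar_prod_def atLeast0LessThan)
  also have "\<dots> = (\<Sum>j<N. if j = i then f i $$ (a,0) * x $ (2 * i) + f i $$ (a,1) * x $ (2 * i + 1) else 0)"
    unfolding sum_lessThan_double using r a by (intro sum.cong) (auto simp: block_diag_index)
  also have "\<dots> = (f i *\<^sub>v block_vec x i) $ a"
    using i by (simp add: mult_vec_2_index[OF f _ a] block_vec_index del: One_nat_def)
  finally show "block_vec (block_diag N f *\<^sub>v x) i $ a = (f i *\<^sub>v block_vec x i) $ a" .
qed (use f in \<open>simp add: block_vec_def\<close>)

lemma norm_sq_block_vec:
  "x \<in> carrier_vec (2 * N) \<Longrightarrow> norm_sq x = (\<Sum>i<N. norm_sq (block_vec x i))"
  by (simp add: norm_sq_def[of x] sum_lessThan_double)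
    (simp add: norm_sq_def block_vec_def numeral_2_eq_2)

lemma cscalar_prod_block_vec:
  fixes x y :: "complex vec"
  assumes "x \<in> carrier_vec (2 * N)" "y \<in> carrier_vec (2 * N)"
  shows "x \<bullet>c y = (\<Sum>i<N. block_vec x i \<bullet>c block_vec y i)"
  unfolding cscalar_prod_sum[OF assms] sum_lessThan_double
  by (simp add: cscalar_prod_sum[of _ 2]) (simp add: block_vec_def numeral_2_eq_2)

lemma tf_const_simps:
  "tf_const (a * b) = tf_const a * tf_const b" "tf_const (a + b) = tf_const a + tf_const b"
  "tf_const (- a) = - tf_const a" "tf_const 0 = 0" "tf_const 1 = 1"
  by (simp_all add: tf_const_def Zero_fract_def One_fract_def one_pCons mult.commute)

lemma kron_diag_const:
  assumes F: "F \<in> carrier_mat 2 2"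
  shows "diag_const N d \<otimes>\<^sub>k F = block_diag N (\<lambda>i. tf_const (d i) \<cdot>\<^sub>m F)"
proof (rule eq_matI)
  fix r c assume "r < dim_row (block_diag N (\<lambda>i. tf_const (d i) \<cdot>\<^sub>m F))"
    "c < dim_col (block_diag N (\<lambda>i. tf_const (d i) \<cdot>\<^sub>m F))"
  hence rc: "r < 2 * N" "c < 2 * N" by simp_all
  hence "r div 2 < N" "c div 2 < N" by auto
  with rc F show "(diag_const N d \<otimes>\<^sub>k F) $$ (r,c) = block_diag N (\<lambda>i. tf_const (d i) \<cdot>\<^sub>m F) $$ (r,c)"
    by (simp add: kron_def diag_const_def mat_diag_def block_diag_index mult.commute[of N 2])
qed (use F in \<open>simp_all add: kron_def diag_const_def mat_diag_def\<close>)

lemma diag_const_mult: "diag_const N a * diag_const N b = diag_const N (\<lambda>i. a i * b i)"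
  by (simp add: diag_const_def tf_const_simps)

lemma invertible_block_diag_smult:
  assumes F: "F \<in> carrier_mat 2 2" "F' \<in> carrier_mat 2 2" "F * F' = 1\<^sub>m 2" "F' * F = 1\<^sub>m 2"
    and d: "\<And>i. i < N \<Longrightarrow> d i \<noteq> 0"
  shows "invertible_mat (block_diag N (\<lambda>i. tf_const (d i) \<cdot>\<^sub>m F))"
proof (rule invertible_matI)
  let ?B = "block_diag N (\<lambda>i. tf_const (1 / d i) \<cdot>\<^sub>m F')"
  have c: "tf_const (d i) * tf_const (1 / d i) = 1" if "i < N" for i
    using d[OF that] by (simp flip: tf_const_simps)
  have 1: "(tf_const (d i) \<cdot>\<^sub>m F) * (tf_const (1 / d i) \<cdot>\<^sub>m F') = 1\<^sub>m 2"
    "(tf_const (1 / d i) \<cdot>\<^sub>m F') * (tf_const (d i) \<cdot>\<^sub>m F) = 1\<^sub>m 2" if "i < N" for i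
  proof -
    have "(tf_const (d i) \<cdot>\<^sub>m F) * (tf_const (1 / d i) \<cdot>\<^sub>m F') =
        tf_const (1 / d i) \<cdot>\<^sub>m (tf_const (d i) \<cdot>\<^sub>m (F * F'))"
      "(tf_const (1 / d i) \<cdot>\<^sub>m F') * (tf_const (d i) \<cdot>\<^sub>m F) =
        tf_const (d i) \<cdot>\<^sub>m (tf_const (1 / d i) \<cdot>\<^sub>m (F' * F))"
      using F(1,2) by (simp_all add: mult_smult_assoc_mat[of _ 2 2] mult_smult_distrib[of _ 2 2])
    thus "(tf_const (d i) \<cdot>\<^sub>m F) * (tf_const (1 / d i) \<cdot>\<^sub>m F') = 1\<^sub>m 2"
      "(tf_const (1 / d i) \<cdot>\<^sub>m F') * (tf_const (d i) \<cdot>\<^sub>m F) = 1\<^sub>m 2"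
      using c[OF that] by (auto simp: F(3,4) mult.commute intro!: eq_matI)
  qed
  show "block_diag N (\<lambda>i. tf_const (d i) \<cdot>\<^sub>m F) * ?B = 1\<^sub>m (2 * N)"
    "?B * block_diag N (\<lambda>i. tf_const (d i) \<cdot>\<^sub>m F) = 1\<^sub>m (2 * N)"
    unfolding block_diag_one[symmetric] using F 1
    by (subst block_diag_mult; auto intro!: block_diag_cong)+
qed simp_all

section \<open>Converters and network\<close>

definition mat_2x2 :: "'a \<Rightarrow> 'a \<Rightarrow> 'a \<Rightarrow> 'a \<Rightarrow> 'a mat" where
  "mat_2x2 a b c d = mat_of_rows_list 2 [[a, b], [c, d]]"

lemma mat_2x2_simps [simp]:
  "mat_2x2 a b c d \<in> carrier_mat 2 2"
  "mat_2x2 a b c d $$ (0, 0) = a" "mat_2x2 a b c d $$ (0, Suc 0) = b"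
  "mat_2x2 a b c d $$ (Suc 0, 0) = c" "mat_2x2 a b c d $$ (Suc 0, Suc 0) = d"
  by (simp_all add: mat_2x2_def mat_of_rows_list_def numeral_2_eq_2)

lemma mat_2x2_mult:
  fixes a :: "'a::comm_ring_1"
  shows "mat_2x2 a b c d * mat_2x2 a' b' c' d' =
    mat_2x2 (a * a' + b * c') (a * b' + b * d') (c * a' + d * c') (c * b' + d * d')"
proof (rule eq_mat_2x2I)
  show "mat_2x2 a b c d * mat_2x2 a' b' c' d' \<in> carrier_mat 2 2"
    by (rule mult_carrier_mat[of _ 2 2]) simp_all
qed (simp_all add: mult_2x2_index[of "mat_2x2 a b c d" "mat_2x2 a' b' c' d'"] del: index_mult_mat(1))

lemma mat_2x2_map: "map_mat h (mat_2x2 a b c d) = mat_2x2 (h a) (h b) (h c) (h d)"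
  using carrier_matD[OF mat_2x2_simps(1)[of a b c d]] by (intro eq_mat_2x2I) simp_all

lemma mat_2x2_one: "mat_2x2 1 0 0 1 = 1\<^sub>m 2"
  by (rule eq_mat_2x2I) simp_all

lemma exp_J_eq:
  "exp_J a = mat_2x2 (tf_const (cos a)) (- tf_const (sin a)) (tf_const (sin a)) (tf_const (cos a))"
  unfolding exp_J_def mat_2x2_def[symmetric]
  by (simp add: mat_2x2_map tf_const_simps)

lemma exp_J_carrier [simp]: "exp_J a \<in> carrier_mat 2 2"
  by (simp add: exp_J_eq)

lemma exp_J_inverse: "exp_J (- a) * exp_J a = 1\<^sub>m 2" "exp_J a * exp_J (- a) = 1\<^sub>m 2"
proof -
  have "tf_const (cos a) * tf_const (cos a) + tf_const (sin a) * tf_const (sin a) = 1"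
    using sin_cos_squared_add3[of a] by (simp flip: tf_const_simps)
  hence 1: "tf_const (cos a) * tf_const (cos a) + tf_const (sin a) * tf_const (sin a) = 1"
    "tf_const (sin a) * tf_const (sin a) + tf_const (cos a) * tf_const (cos a) = 1"
    by (simp_all add: add.commute)
  show "exp_J (- a) * exp_J a = 1\<^sub>m 2" "exp_J a * exp_J (- a) = 1\<^sub>m 2"
    unfolding exp_J_eq mat_2x2_mult mat_2x2_one[symmetric]
    by (simp_all add: 1 tf_const_simps mult.commute)
qed

text \<open>Both matrices are of the form x I + y J with J the rotation by pi / 2, and matrices of
  this form commute.\<close>

lemma exp_J_commute:
  "exp_J a * mat_2x2 x (- 1) 1 x = mat_2x2 x (- 1) 1 x * exp_J a"
  unfolding exp_J_eq mat_2x2_mult by (simp add: mult.commute add.commute)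

definition F_inv :: "real \<Rightarrow> real \<Rightarrow> tf mat" where
  "F_inv \<omega>\<^sub>0 \<epsilon> = mat_2x2 (tf_s / tf_const \<omega>\<^sub>0 + tf_const \<epsilon>) (- 1) 1 (tf_s / tf_const \<omega>\<^sub>0 + tf_const \<epsilon>)"

lemma F_inv_carrier [simp]: "F_inv \<omega>\<^sub>0 \<epsilon> \<in> carrier_mat 2 2"
  by (simp add: F_inv_def)

text \<open>With a = s / omega0 + epsilon, \<open>F_inv\<close> has determinant a^2 + 1, which is
  nonzero as a rational function. The explicit inverse built from it justifies both the inversion
  inside \<open>F_tilde\<close> and the inversion back.\<close>

lemma F_tilde:
  assumes "\<omega>\<^sub>0 \<noteq> 0"
  shows "mat_inv (F_tilde \<omega>\<^sub>0 \<epsilon>) = F_inv \<omega>\<^sub>0 \<epsilon>" "F_tilde \<omega>\<^sub>0 \<epsilon> \<in> carrier_mat 2 2"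
    "F_inv \<omega>\<^sub>0 \<epsilon> * F_tilde \<omega>\<^sub>0 \<epsilon> = 1\<^sub>m 2" "F_tilde \<omega>\<^sub>0 \<epsilon> * F_inv \<omega>\<^sub>0 \<epsilon> = 1\<^sub>m 2"
proof -
  let ?a = "tf_s / tf_const \<omega>\<^sub>0 + tf_const \<epsilon>"
  let ?p = "[:\<epsilon>, 1 / \<omega>\<^sub>0:]"
  have "tf_s / tf_const \<omega>\<^sub>0 = tf_s * tf_const (1 / \<omega>\<^sub>0)"
  proof -
    have "tf_const \<omega>\<^sub>0 * tf_const (1 / \<omega>\<^sub>0) = 1"
      using assms by (simp flip: tf_const_simps)
    thus ?thesis by (metis inverse_unique divide_inverse)
  qed
  hence "?a = Fract ?p 1"
    by (simp add: tf_s_def tf_const_def)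
  hence "?a * ?a + 1 = Fract (?p * ?p + 1) 1"
    by (simp add: One_fract_def)
  moreover have "?p * ?p + 1 \<noteq> 0"
  proof
    assume "?p * ?p + 1 = 0"
    \<comment> \<open>At s = 0 the value is epsilon^2 + 1, which is positive.\<close>
    hence "poly (?p * ?p + 1) 0 = 0" by (simp only: poly_0)
    hence "\<epsilon> * \<epsilon> + 1 = 0" by simp
    moreover have "0 \<le> \<epsilon> * \<epsilon>" by simp
    ultimately show False by linarith
  qed
  ultimately have nz: "?a * ?a + 1 \<noteq> 0"
    by (simp only: eq_fract(1) Zero_fract_def) (simp add: eq_fract)
  let ?d = "?a * ?a + 1"
  let ?B = "mat_2x2 (?a / ?d) (1 / ?d) (- 1 / ?d) (?a / ?d)"
  have e: "?a / ?d * ?a + 1 / ?d * 1 = 1" "?a / ?d * - 1 + 1 / ?d * ?a = 0"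
    "- 1 / ?d * ?a + ?a / ?d * 1 = 0" "- 1 / ?d * - 1 + ?a / ?d * ?a = 1"
    using nz by (simp_all add: add_divide_distrib[symmetric] add.commute)
  have B: "?B * F_inv \<omega>\<^sub>0 \<epsilon> = 1\<^sub>m 2"
    unfolding F_inv_def mat_2x2_mult e mat_2x2_one ..
  have eq: "F_tilde \<omega>\<^sub>0 \<epsilon> = ?B"
    unfolding F_tilde_def mat_2x2_def[symmetric] F_inv_def[symmetric]
    by (rule mat_inv_eqI(1)[OF F_inv_carrier _ B]) simp
  show "F_tilde \<omega>\<^sub>0 \<epsilon> \<in> carrier_mat 2 2" unfolding eq by simp
  show "F_tilde \<omega>\<^sub>0 \<epsilon> * F_inv \<omega>\<^sub>0 \<epsilon> = 1\<^sub>m 2" unfolding eq by (rule B)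
  show FB: "F_inv \<omega>\<^sub>0 \<epsilon> * F_tilde \<omega>\<^sub>0 \<epsilon> = 1\<^sub>m 2"
    unfolding eq by (rule mat_inv_eqI(2)[OF F_inv_carrier _ B]) simp
  show "mat_inv (F_tilde \<omega>\<^sub>0 \<epsilon>) = F_inv \<omega>\<^sub>0 \<epsilon>"
    by (rule mat_inv_eqI(1)[OF _ F_inv_carrier FB]) (simp add: eq)
qed

lemma rescaled_converter_carrier:
  "YC i \<in> carrier_mat 2 2 \<Longrightarrow> \<omega>\<^sub>0 \<noteq> 0 \<Longrightarrow> rescaled_converter YC D \<omega>\<^sub>0 \<epsilon> i \<in> carrier_mat 2 2"
  unfolding rescaled_converter_def by (simp add: F_tilde(1) mult_carrier_mat[of _ 2 2])

lemma converter_loop_eq_block_diag: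
  assumes YC: "\<And>i. i < N \<Longrightarrow> YC i \<in> carrier_mat 2 2" and w: "\<omega>\<^sub>0 \<noteq> 0"
  shows "converter_loop N YC \<theta> D \<omega>\<^sub>0 \<epsilon> =
    block_diag N (\<lambda>i. exp_J (\<theta> i) * rescaled_converter YC D \<omega>\<^sub>0 \<epsilon> i * exp_J (- \<theta> i))"
proof -
  let ?F = "F_inv \<omega>\<^sub>0 \<epsilon>"
  have "exp_J (\<theta> i) * YC i * exp_J (- \<theta> i) * (tf_const (D i) \<cdot>\<^sub>m ?F) =
      exp_J (\<theta> i) * rescaled_converter YC D \<omega>\<^sub>0 \<epsilon> i * exp_J (- \<theta> i)" if i: "i < N" for i
  proof -
    note c = YC[OF i] exp_J_carrier[of "\<theta> i"] exp_J_carrier[of "- \<theta> i"] F_inv_carrier[of \<omega>\<^sub>0 \<epsilon>]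
    have EY: "exp_J (\<theta> i) * YC i \<in> carrier_mat 2 2" by (rule mult_carrier_mat[OF c(2,1)])
    have "exp_J (\<theta> i) * YC i * exp_J (- \<theta> i) * (tf_const (D i) \<cdot>\<^sub>m ?F)
        = tf_const (D i) \<cdot>\<^sub>m (exp_J (\<theta> i) * YC i * exp_J (- \<theta> i) * ?F)"
      by (rule mult_smult_distrib[OF mult_carrier_mat[OF EY c(3)] c(4)])
    also have "exp_J (\<theta> i) * YC i * exp_J (- \<theta> i) * ?F = exp_J (\<theta> i) * YC i * (exp_J (- \<theta> i) * ?F)"
      by (rule assoc_mult_mat[OF EY c(3,4)])
    \<comment> \<open>The one real exchange of factors; the surrounding steps are associativity and
      moving the scalar \<open>D i\<close>.\<close>
    also have "exp_J (- \<theta> i) * ?F = ?F * exp_J (- \<theta> i)"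
      unfolding F_inv_def by (rule exp_J_commute)
    also have "exp_J (\<theta> i) * YC i * (?F * exp_J (- \<theta> i)) = exp_J (\<theta> i) * YC i * ?F * exp_J (- \<theta> i)"
      by (rule assoc_mult_mat[OF EY c(4,3), symmetric])
    also have "exp_J (\<theta> i) * YC i * ?F = exp_J (\<theta> i) * (YC i * ?F)"
      by (rule assoc_mult_mat[OF c(2,1,4)])
    finally have eq: "exp_J (\<theta> i) * YC i * exp_J (- \<theta> i) * (tf_const (D i) \<cdot>\<^sub>m ?F) =
        tf_const (D i) \<cdot>\<^sub>m (exp_J (\<theta> i) * (YC i * ?F) * exp_J (- \<theta> i))" .
    have YF: "YC i * ?F \<in> carrier_mat 2 2" by (rule mult_carrier_mat[OF c(1,4)])
    have r: "rescaled_converter YC D \<omega>\<^sub>0 \<epsilon> i = tf_const (D i) \<cdot>\<^sub>m (YC i * ?F)"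
      unfolding rescaled_converter_def F_tilde(1)[OF w] by (rule mult_smult_assoc_mat[OF c(1,4)])
    show ?thesis
      unfolding eq r mult_smult_distrib[OF c(2) YF] mult_smult_assoc_mat[OF mult_carrier_mat[OF c(2) YF] c(3)] ..
  qed
  note e = this
  have c1: "exp_J (\<theta> i) * YC i \<in> carrier_mat 2 2" if "i < N" for i
    using YC[OF that] by (intro mult_carrier_mat[of _ 2 2]) simp_all
  have c2: "exp_J (\<theta> i) * YC i * exp_J (- \<theta> i) \<in> carrier_mat 2 2" if "i < N" for i
    using c1[OF that] by (rule mult_carrier_mat) simp
  have c3: "tf_const (D i) \<cdot>\<^sub>m ?F \<in> carrier_mat 2 2" for i by simp
  have "converter_loop N YC \<theta> D \<omega>\<^sub>0 \<epsilon> = block_diag N (\<lambda>i. exp_J (\<theta> i)) * block_diag N YC *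
      block_diag N (\<lambda>i. exp_J (- \<theta> i)) * block_diag N (\<lambda>i. tf_const (D i) \<cdot>\<^sub>m ?F)"
    unfolding converter_loop_def F_tilde(1)[OF w] kron_diag_const[OF F_inv_carrier]
    using YC by (simp add: diag_block_mat_eq_block_diag)
  also have "\<dots> = block_diag N (\<lambda>i. exp_J (\<theta> i) * YC i * exp_J (- \<theta> i) * (tf_const (D i) \<cdot>\<^sub>m ?F))"
    using YC c1 c2 c3 by (simp add: block_diag_mult)
  also have "\<dots> = block_diag N (\<lambda>i. exp_J (\<theta> i) * rescaled_converter YC D \<omega>\<^sub>0 \<epsilon> i * exp_J (- \<theta> i))"
    by (rule block_diag_cong) (rule e)
  finally show ?thesis .
qed

section \<open>The Kron-reduced network\<close>

lemma Y_grid_carrier: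
  assumes "N \<le> M" "invertible_mat (interior_block N M Yb)"
  shows "Y_grid N M Yb \<in> carrier_mat (2 * N) (2 * N)"
proof -
  obtain Y1 Y2 Y3 Y4 where s: "split_block (grounded_laplacian M Yb) (2 * N) (2 * N) = (Y1, Y2, Y3, Y4)"
    by (metis surj_pair)
  have "dim_row (grounded_laplacian M Yb) = 2 * N + 2 * (M - N)"
    "dim_col (grounded_laplacian M Yb) = 2 * N + 2 * (M - N)"
    using assms(1) by (simp_all add: grounded_laplacian_def)
  note c = split_block[OF s this]
  have "invertible_mat Y4" using assms(2) by (simp add: interior_block_def s)
  hence "mat_inv Y4 \<in> carrier_mat (2 * (M - N)) (2 * (M - N))"
    using mat_inv(1)[OF c(4)] by simp
  thus ?thesis using c(1-3) by (auto simp: Y_grid_def s)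
qed

text \<open>The product has three invertible factors, the outer ones because S and D are positive
  and \<open>F_inv\<close> is invertible; the inverse is assembled in reverse order. The equation
  \<open>Yg * mat_inv Yg = 1\<close> is what later turns a lower gain bound for the grid into an
  upper one for its inverse.\<close>

lemma rescaled_grid_invertible:
  fixes \<epsilon> :: real
  assumes NM: "N \<le> M" "invertible_mat (interior_block N M Yb)" "invertible_mat (Y_grid N M Yb)"
    and S: "\<And>i. i < N \<Longrightarrow> 0 < S i" and D: "\<And>i. i < N \<Longrightarrow> 0 < D i" and w: "\<omega>\<^sub>0 \<noteq> 0"
  defines "Yg \<equiv> rescaled_grid N M Yb S D \<omega>\<^sub>0 \<epsilon>"
  shows "Yg \<in> carrier_mat (2 * N) (2 * N)" "mat_inv Yg \<in> carrier_mat (2 * N) (2 * N)"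
    "Yg * mat_inv Yg = 1\<^sub>m (2 * N)"
proof -
  let ?s = "\<lambda>i. S i powr (- 1 / 2)"
  let ?F = "F_inv \<omega>\<^sub>0 \<epsilon>"
  let ?A = "block_diag N (\<lambda>i. tf_const (?s i) \<cdot>\<^sub>m 1\<^sub>m 2)"
  let ?C = "block_diag N (\<lambda>i. tf_const (?s i * D i) \<cdot>\<^sub>m ?F)"
  have Y: "Y_grid N M Yb \<in> carrier_mat (2 * N) (2 * N)" by (rule Y_grid_carrier[OF NM(1,2)])
  have eq: "Yg = ?A * Y_grid N M Yb * ?C"
    unfolding Yg_def rescaled_grid_def Let_def F_tilde(1)[OF w] diag_const_mult
    by (simp only: kron_diag_const[OF F_inv_carrier] kron_diag_const[OF one_carrier_mat])
  have s: "?s i \<noteq> 0" if "i < N" for i using S[OF that] by simp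
  have "invertible_mat ?A" using s by (intro invertible_block_diag_smult[of _ "1\<^sub>m 2"]) simp_all
  then obtain A' where A': "A' \<in> carrier_mat (2 * N) (2 * N)" "?A * A' = 1\<^sub>m (2 * N)" "A' * ?A = 1\<^sub>m (2 * N)"
    using invertible_matE[OF block_diag_carrier] by blast
  have "?s i * D i \<noteq> 0" if "i < N" for i using s[OF that] D[OF that] by simp
  hence "invertible_mat ?C"
    using F_tilde[OF w] by (intro invertible_block_diag_smult[of _ "F_tilde \<omega>\<^sub>0 \<epsilon>"]) simp_all
  then obtain C' where C': "C' \<in> carrier_mat (2 * N) (2 * N)" "?C * C' = 1\<^sub>m (2 * N)" "C' * ?C = 1\<^sub>m (2 * N)"
    using invertible_matE[OF block_diag_carrier] by blast
  obtain Y' where Y': "Y' \<in> carrier_mat (2 * N) (2 * N)" "Y_grid N M Yb * Y' = 1\<^sub>m (2 * N)" "Y' * Y_grid N M Yb = 1\<^sub>m (2 * N)"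
    using invertible_matE[OF Y NM(3)] by blast
  show Yg: "Yg \<in> carrier_mat (2 * N) (2 * N)"
    unfolding eq by (rule mult_carrier_mat[OF mult_carrier_mat[OF block_diag_carrier Y] block_diag_carrier])
  let ?B = "C' * (Y' * A')"
  have YA: "Y' * A' \<in> carrier_mat (2 * N) (2 * N)" using A' Y' by simp
  have AY: "?A * Y_grid N M Yb \<in> carrier_mat (2 * N) (2 * N)"
    by (rule mult_carrier_mat[OF block_diag_carrier Y])
  have B: "?B \<in> carrier_mat (2 * N) (2 * N)" using C' YA by simp
  have "(Y' * A') * (?A * Y_grid N M Yb) = Y' * (A' * (?A * Y_grid N M Yb))"
    by (rule assoc_mult_mat[OF Y'(1) A'(1) AY])
  also have "A' * (?A * Y_grid N M Yb) = (A' * ?A) * Y_grid N M Yb"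
    by (rule assoc_mult_mat[OF A'(1) block_diag_carrier Y, symmetric])
  also have "\<dots> = Y_grid N M Yb" unfolding A'(3) using Y by simp
  finally have 1: "(Y' * A') * (?A * Y_grid N M Yb) = 1\<^sub>m (2 * N)" by (simp add: Y'(3))
  have "?B * Yg = C' * ((Y' * A') * (?A * Y_grid N M Yb * ?C))"
    unfolding eq by (rule assoc_mult_mat[OF C'(1) YA mult_carrier_mat[OF AY block_diag_carrier]])
  also have "(Y' * A') * (?A * Y_grid N M Yb * ?C) = (Y' * A') * (?A * Y_grid N M Yb) * ?C"
    by (rule assoc_mult_mat[OF YA AY block_diag_carrier, symmetric])
  also have "\<dots> = ?C" unfolding 1 by (rule left_mult_one_mat[OF block_diag_carrier])
  also have "C' * ?C = 1\<^sub>m (2 * N)" by (rule C'(3))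
  finally have BY: "?B * Yg = 1\<^sub>m (2 * N)" .
  show "mat_inv Yg \<in> carrier_mat (2 * N) (2 * N)" "Yg * mat_inv Yg = 1\<^sub>m (2 * N)"
    unfolding mat_inv_eqI(1)[OF Yg B BY] using B mat_inv_eqI(2)[OF Yg B BY] by simp_all
qed

section \<open>Feedback stability\<close>

definition rot :: "real \<Rightarrow> complex mat" where
  "rot a = mat_2x2 (complex_of_real (cos a)) (complex_of_real (- sin a)) (complex_of_real (sin a)) (complex_of_real (cos a))"

lemma rot_carrier [simp]: "rot a \<in> carrier_mat 2 2"
  by (simp add: rot_def)

lemma rot_mult: "rot a * rot b = rot (a + b)"
  by (simp add: rot_def mat_2x2_mult cos_add sin_add algebra_simps)

lemma rot_0: "rot 0 = 1\<^sub>m 2"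
  by (simp add: rot_def mat_2x2_one)

lemma mat_adjoint_rot: "mat_adjoint (rot a) = rot (- a)"
proof (rule eq_mat_2x2I)
  show "mat_adjoint (rot a) \<in> carrier_mat 2 2" by simp
qed (use carrier_matD[OF rot_carrier[of a]] in \<open>simp_all add: rot_def\<close>)

lemma norm_sq_rot:
  assumes "x \<in> carrier_vec 2" shows "norm_sq (rot a *\<^sub>v x) = norm_sq x"
proof -
  have "complex_of_real (norm_sq (rot a *\<^sub>v x)) = complex_of_real (norm_sq x)"
    unfolding cscalar_prod_gram[OF rot_carrier assms, symmetric] mat_adjoint_rot rot_mult
    using assms by (simp add: rot_0 cscalar_prod_self)
  thus ?thesis unfolding of_real_eq_iff .
qed

lemma freq_exp_J:
  "freq (exp_J a) \<omega> = rot a" "exp_J a \<in> partial_hom.MR {f. tf_finite_at f \<omega>}"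
proof -
  have eq: "exp_J a = mat_2x2 (tf_const (cos a)) (tf_const (- sin a)) (tf_const (sin a)) (tf_const (cos a))"
    unfolding exp_J_eq tf_const_simps(3) ..
  show "freq (exp_J a) \<omega> = rot a"
    unfolding eq freq_def mat_2x2_map tf_freq_const rot_def ..
  have "exp_J a $$ (i,j) \<in> {f. tf_finite_at f \<omega>}" if "i < 2" "j < 2" for i j
    using that unfolding eq by (auto simp: less_2_cases_iff)
  thus "exp_J a \<in> partial_hom.MR {f. tf_finite_at f \<omega>}"
    using carrier_matD[OF exp_J_carrier[of a]] unfolding partial_hom.MR_def[OF partial_hom_tf_freq] by simp
qed

lemma map_block_diag:
  assumes "h 0 = 0" "\<And>i. i < N \<Longrightarrow> f i \<in> carrier_mat 2 2"
  shows "map_mat h (block_diag N f) = block_diag N (\<lambda>i. map_mat h (f i))"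
proof (rule eq_matI)
  fix r c assume "r < dim_row (block_diag N (\<lambda>i. map_mat h (f i)))" "c < dim_col (block_diag N (\<lambda>i. map_mat h (f i)))"
  hence rc: "r < 2 * N" "c < 2 * N" by simp_all
  hence rN: "r div 2 < N" by auto
  have e: "map_mat h (f (r div 2)) $$ (r mod 2, c mod 2) = h (f (r div 2) $$ (r mod 2, c mod 2))"
    using carrier_matD[OF assms(2)[OF rN]] by simp
  show "map_mat h (block_diag N f) $$ (r,c) = block_diag N (\<lambda>i. map_mat h (f i)) $$ (r,c)"
    using rc e assms(1) by (cases "r div 2 = c div 2") (simp_all add: block_diag_index)
qed simp_all

section \<open>The ring of proper stable functions and its units\<close>

definition RH :: "tf set" where
  "RH = {f. tf_proper f \<and> tf_stable f}"

lemma RH_finite: "f \<in> RH \<Longrightarrow> tf_finite_at f \<omega>"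
  by (auto simp: RH_def tf_finite_at_def tf_stable_def)

text \<open>\<open>RH\<close> is the intersection of the proper functions with, for each s in the
  closed right half plane, the functions without a pole at s. Each of these is a subring by the
  earlier \<open>partial_hom\<close> facts, and the value at infinity is a homomorphism on the
  first.\<close>

interpretation rh: partial_hom RH "\<lambda>f. tf_freq f \<infinity>"
proof -
  have RH: "RH = {f. tf_proper f} \<inter> (\<Inter>s\<in>{s. 0 \<le> Re s}. {f. cpoly (tf_den f) s \<noteq> 0})"
    by (auto simp: RH_def tf_stable_def)
  note p = partial_hom_tf_infinity and e = partial_hom_tf_eval
  show "partial_hom RH (\<lambda>f. tf_freq f \<infinity>)"
  proof unfold_locales
    show "1 \<in> RH" "tf_freq 1 \<infinity> = 1"
      unfolding RH using partial_hom.one[OF p] partial_hom.one(1)[OF e] by simp_all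
    fix f g assume "f \<in> RH" "g \<in> RH"
    thus "f + g \<in> RH \<and> tf_freq (f + g) \<infinity> = tf_freq f \<infinity> + tf_freq g \<infinity>"
      "f * g \<in> RH \<and> tf_freq (f * g) \<infinity> = tf_freq f \<infinity> * tf_freq g \<infinity>"
      unfolding RH using partial_hom.add[OF p, of f g] partial_hom.mult[OF p, of f g]
        partial_hom.add[OF e, of f _ g] partial_hom.mult[OF e, of f _ g] by simp_all
  next
    fix f assume "f \<in> RH"
    thus "- f \<in> RH \<and> tf_freq (- f) \<infinity> = - tf_freq f \<infinity>"
      unfolding RH using partial_hom.uminus[OF p, of f] partial_hom.uminus[OF e, of f] by simp
  qed
qed

lemma RH_inf_iff: "A \<in> RH_inf m \<longleftrightarrow> A \<in> carrier_mat m m \<and> A \<in> rh.MR"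
  unfolding RH_inf_def rh.MR_def by (auto simp: RH_def)

lemma RH_entry: "A \<in> rh.MR \<Longrightarrow> A \<in> carrier_mat m n \<Longrightarrow> i < m \<Longrightarrow> j < n \<Longrightarrow> A $$ (i,j) \<in> RH"
  unfolding rh.MR_def by auto

lemma RH_D: "f \<in> RH \<Longrightarrow> tf_proper f" "f \<in> RH \<Longrightarrow> 0 \<le> Re s \<Longrightarrow> cpoly (tf_den f) s \<noteq> 0"
  by (simp_all add: RH_def tf_stable_def)

lemma MR_RH_finite: "A \<in> rh.MR \<Longrightarrow> A \<in> partial_hom.MR {f. tf_finite_at f \<omega>}"
  unfolding rh.MR_def partial_hom.MR_def[OF partial_hom_tf_freq] using RH_finite by blast

text \<open>Taking the reciprocal swaps numerator and denominator. No zeros in the closed right half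
  plane makes the result stable, and a nonzero value at infinity forces equal degrees, which makes
  it proper.\<close>

lemma RH_inverse:
  assumes f: "f \<in> RH" and s: "\<And>s. 0 \<le> Re s \<Longrightarrow> tf_eval f s \<noteq> 0" and inf: "tf_freq f \<infinity> \<noteq> 0"
  shows "f \<noteq> 0" "1 / f \<in> RH"
proof -
  have d: "degree (tf_num f) = degree (tf_den f)"
    using tf_freq_infinity(2)[OF _ inf] f by (simp add: RH_def)
  have n: "cpoly (tf_num f) s \<noteq> 0" if "0 \<le> Re s" for s
    using s[OF that] by (auto simp: tf_eval_def)
  from n[of 0] have n0: "tf_num f \<noteq> 0" by auto
  thus f0: "f \<noteq> 0" by (auto simp: tf_num_def)
  have "1 / f = 1 / Fract (tf_num f) (tf_den f)" using tf_eq_Fract[of f] by simp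
  also have "\<dots> = Fract (tf_den f) (tf_num f)" by (simp add: One_fract_def)
  finally have eq: "1 / f = Fract (tf_den f) (tf_num f)" .
  have "tf_proper (1 / f)" unfolding eq using d n0 by (simp add: tf_proper_Fract)
  moreover have "tf_stable (1 / f)"
    unfolding eq tf_stable_def using cpoly_dvd_zero[OF tf_den_dvd[OF n0]] n by blast
  ultimately show "1 / f \<in> RH" by (simp add: RH_def)
qed

text \<open>Cramer's rule: the entries of the adjugate are signed minors and stay in
  \<open>RH\<close>, so the only division is by the determinant.\<close>

lemma inverse_RH:
  assumes A: "A \<in> carrier_mat m m" "A \<in> rh.MR" and det: "det A \<noteq> 0" "1 / det A \<in> RH"
  shows "invertible_mat A" "mat_inv A \<in> carrier_mat m m" "mat_inv A \<in> rh.MR"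
proof -
  let ?B = "(1 / det A) \<cdot>\<^sub>m adj_mat A"
  have B: "?B \<in> carrier_mat m m" using adj_mat(1)[OF A(1)] by simp
  have BA: "?B * A = 1\<^sub>m m"
    unfolding mult_smult_assoc_mat[OF adj_mat(1)[OF A(1)] A(1)] adj_mat(3)[OF A(1)]
    using det by (auto intro!: eq_matI)
  have inv: "mat_inv A = ?B" and AB: "A * ?B = 1\<^sub>m m" using mat_inv_eqI[OF A(1) B BA] by auto
  show "invertible_mat A" by (rule invertible_matI[OF A(1) B AB BA])
  show "mat_inv A \<in> carrier_mat m m" unfolding inv by (rule B)
  have "cofactor A i j \<in> RH" if "i < m" "j < m" for i j
  proof -
    have c: "mat_delete A i j \<in> carrier_mat (m - 1) (m - 1)"
      by (rule mat_delete_carrier[OF A(1)])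
    have "mat_delete A i j \<in> rh.MR"
      using A that unfolding rh.MR_def mat_delete_def by auto
    hence "det (mat_delete A i j) \<in> RH" using rh.MR_det[OF c] by blast
    moreover have "(-1) ^ k \<in> RH" for k :: nat
      by (induction k) (simp_all add: rh.one rh.uminus rh.mult)
    ultimately show ?thesis unfolding cofactor_def using rh.mult by blast
  qed
  hence "1 / det A * cofactor A j i \<in> RH" if "i < m" "j < m" for i j
    using that rh.mult[OF det(2)] by blast
  thus "mat_inv A \<in> rh.MR"
    unfolding inv rh.MR_def using A(1) by (auto simp: adj_mat_def)
qed

lemma MR_four_block:
  assumes c: "A \<in> carrier_mat m m" "B \<in> carrier_mat m m" "C \<in> carrier_mat m m" "D \<in> carrier_mat m m"
    and R: "A \<in> rh.MR" "B \<in> rh.MR" "C \<in> rh.MR" "D \<in> rh.MR"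
  shows "four_block_mat A B C D \<in> RH_inf (2 * m)"
proof -
  have "four_block_mat A B C D $$ (i,j) \<in> RH" if ij: "i < m + m" "j < m + m" for i j
  proof -
    have "four_block_mat A B C D $$ (i,j) = (if i < m then if j < m then A $$ (i,j) else B $$ (i,j - m)
        else if j < m then C $$ (i - m, j) else D $$ (i - m, j - m))"
      using c ij by simp
    moreover have "i - m < m" if "\<not> i < m" using that ij by linarith
    moreover have "j - m < m" if "\<not> j < m" using that ij by linarith
    ultimately show ?thesis
      using RH_entry[OF R(1) c(1)] RH_entry[OF R(2) c(2)] RH_entry[OF R(3) c(3)] RH_entry[OF R(4) c(4)]
      by (cases "i < m"; cases "j < m") simp_all
  qed
  moreover have f: "four_block_mat A B C D \<in> carrier_mat (m + m) (m + m)"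
    by (rule four_block_carrier_mat[OF c(1,4)])
  ultimately show ?thesis
    unfolding RH_inf_iff mult_2 rh.MR_def mem_Collect_eq carrier_matD[OF f] by blast
qed

text \<open>The four blocks of the closed loop are products of G, H and the inverse of 1 + H G, so
  only that inverse has to be placed in \<open>RH\<close>, and the two conditions make its
  determinant a unit there.\<close>

lemma feedback_stableI:
  assumes G: "G \<in> RH_inf m" and H: "H \<in> RH_inf m"
    and s: "\<And>s. 0 \<le> Re s \<Longrightarrow> tf_eval (det (1\<^sub>m m + H * G)) s \<noteq> 0"
    and inf: "tf_freq (det (1\<^sub>m m + H * G)) \<infinity> \<noteq> 0"
  shows "feedback_stable m G H"
proof -
  let ?A = "1\<^sub>m m + H * G" and ?R = "mat_inv (1\<^sub>m m + H * G)"
  have c: "G \<in> carrier_mat m m" "G \<in> rh.MR" "H \<in> carrier_mat m m" "H \<in> rh.MR"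
    using G H by (auto simp: RH_inf_iff)
  have HG: "H * G \<in> rh.MR" using rh.MR_mult[OF c(4,2)] c(1,3) by simp
  have A: "?A \<in> carrier_mat m m" using c by auto
  have AR: "?A \<in> rh.MR"
    using rh.MR_add[OF rh.MR_one[THEN conjunct1, of m] HG] c(1,3) by simp
  have det: "det ?A \<in> RH" using rh.MR_det[OF A AR] by blast
  note R = inverse_RH[OF A AR RH_inverse[OF det s inf]]
  have RH: "?R * H \<in> rh.MR" "?R * H \<in> carrier_mat m m"
    using rh.MR_mult[OF R(3) c(4)] R(2) c(3) by auto
  have GR: "G * ?R \<in> rh.MR" "G * ?R \<in> carrier_mat m m"
    using rh.MR_mult[OF c(2) R(3)] R(2) c(1) by auto
  have GRH: "G * ?R * H \<in> rh.MR" "G * ?R * H \<in> carrier_mat m m"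
    using rh.MR_mult[OF GR(1) c(4)] GR(2) c(3) by auto
  show ?thesis
    unfolding feedback_stable_def feedback_def Let_def
    using R(1) MR_four_block[OF R(2) RH(2) GR(2) GRH(2) R(3) RH(1) GR(1) GRH(1)] by (rule conjI)
qed

section \<open>From nonsingularity at each frequency to stability\<close>

lemma det_cnj: "det (map_mat cnj A) = cnj (det A)"
proof -
  have "comm_ring_hom cnj" by unfold_locales simp_all
  thus ?thesis by (rule comm_ring_hom.hom_det)
qed

text \<open>\<open>d\<close> is the product of all reduced denominators, which has no zero in the
  closed right half plane because the entries are stable. The identity is confined to that half
  plane, since at a pole \<open>tf_eval\<close> divides by zero.\<close>

lemma common_denominator:
  fixes L :: "tf mat"
  assumes L: "L \<in> carrier_mat n n" "L \<in> rh.MR"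
  obtains d :: "complex poly" and P where "P \<in> carrier_mat n n"
    "\<And>s. 0 \<le> Re s \<Longrightarrow> poly d s \<noteq> 0"
    "\<And>s i j. 0 \<le> Re s \<Longrightarrow> i < n \<Longrightarrow> j < n \<Longrightarrow> poly d s * tf_eval (L $$ (i,j)) s = poly (P $$ (i,j)) s"
proof -
  let ?I = "{..<n} \<times> {..<n}"
  let ?c = "map_poly complex_of_real"
  let ?d = "\<Prod>k\<in>?I. tf_den (L $$ k)"
  let ?p = "\<lambda>k. tf_num (L $$ k) * (\<Prod>l\<in>?I - {k}. tf_den (L $$ l))"
  have nz: "cpoly (tf_den (L $$ k)) s \<noteq> 0" if "k \<in> ?I" "0 \<le> Re s" for k s
    using that RH_D(2)[OF RH_entry[OF L(2,1)]] by auto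
  show thesis
  proof (rule that[of "Matrix.mat n n (\<lambda>k. ?c (?p k))" "?c ?d"])
    show "poly (?c ?d) s \<noteq> 0" if "0 \<le> Re s" for s
      unfolding cpoly_def[symmetric] cpoly_prod using nz that by simp
    show "poly (?c ?d) s * tf_eval (L $$ (i,j)) s = poly (Matrix.mat n n (\<lambda>k. ?c (?p k)) $$ (i,j)) s"
      if s: "0 \<le> Re s" and ij: "i < n" "j < n" for s i j
    proof -
      have k: "(i,j) \<in> ?I" using ij by simp
      have "cpoly ?d s = cpoly (tf_den (L $$ (i,j))) s * cpoly (\<Prod>l\<in>?I - {(i,j)}. tf_den (L $$ l)) s"
        using prod.remove[OF _ k, of "\<lambda>l. tf_den (L $$ l)"] by simp
      hence "cpoly ?d s * tf_eval (L $$ (i,j)) s = cpoly (?p (i,j)) s"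
        using nz[OF k s] by (simp add: tf_eval_def)
      thus ?thesis unfolding cpoly_def[symmetric] using ij by (simp add: cpoly_def)
    qed
  qed simp
qed

text \<open>The hypothesis covers frequencies in [0, \<infinity>]. Negative ones follow by
  conjugation, the coefficients being real, and \<infinity> supplies the limit matrix of the
  homotopy. Stability of G and H lets \<open>freq\<close> pass through the product H G.\<close>

lemma feedback_stable_homotopy:
  assumes G: "G \<in> RH_inf m" and H: "H \<in> RH_inf m"
    and ns: "\<And>\<omega> \<tau>. 0 \<le> \<omega> \<Longrightarrow> 0 \<le> \<tau> \<Longrightarrow> \<tau> \<le> 1 \<Longrightarrow>
      det (1\<^sub>m m + complex_of_real \<tau> \<cdot>\<^sub>m (freq H \<omega> * freq G \<omega>)) \<noteq> 0"
  shows "feedback_stable m G H"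
proof -
  have c: "G \<in> carrier_mat m m" "G \<in> rh.MR" "H \<in> carrier_mat m m" "H \<in> rh.MR"
    using G H by (auto simp: RH_inf_iff)
  let ?A = "1\<^sub>m m + H * G"
  have A: "?A \<in> carrier_mat m m" using c by auto
  have HG: "H * G \<in> rh.MR" "H * G \<in> carrier_mat m m" using rh.MR_mult[OF c(4,2)] c(1,3) by auto
  have AR: "?A \<in> rh.MR"
    using rh.MR_add[OF rh.MR_one[THEN conjunct1, of m] HG(1)] c(1,3) by simp
  define L where "L s = map_mat (\<lambda>f. tf_eval f s) (H * G)" for s
  have L: "L s \<in> carrier_mat m m" for s using HG(2) by (simp add: L_def)
  have fr: "freq (H * G) \<omega> = freq H \<omega> * freq G \<omega>" for \<omega>
    using partial_hom.MR_mult[OF partial_hom_tf_freq MR_RH_finite[OF c(4)] MR_RH_finite[OF c(2)], of \<omega>] c(1,3)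
    by (simp add: freq_def)
  have freal: "freq (H * G) (ereal y) = L (\<i> * complex_of_real y)" for y
    by (simp add: freq_def L_def tf_freq_def)
  obtain d P where P: "P \<in> carrier_mat m m" and d: "\<And>s. 0 \<le> Re s \<Longrightarrow> poly d s \<noteq> 0"
    and LP: "\<And>s i j. 0 \<le> Re s \<Longrightarrow> i < m \<Longrightarrow> j < m \<Longrightarrow> poly d s * tf_eval ((H * G) $$ (i,j)) s = poly (P $$ (i,j)) s"
    by (rule common_denominator[OF HG(2,1)]) (rule that)
  have ij: "L s $$ (i,j) = tf_eval ((H * G) $$ (i,j)) s" if "i < m" "j < m" for s i j
    using HG(2) that unfolding L_def by (simp del: index_mult_mat)
  have det: "det (1\<^sub>m m + L s) \<noteq> 0" if s: "0 \<le> Re s" for s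
  proof (rule det_homotopy_nonzero[OF P L _ d _ _ _ _ s, of "freq (H * G) \<infinity>"])
    show "freq (H * G) \<infinity> \<in> carrier_mat m m" using HG(2) by (simp add: freq_def)
    show "poly d s * L s $$ (i,j) = poly (P $$ (i,j)) s" if "0 \<le> Re s" "i < m" "j < m" for s i j
      using LP[OF that] ij[OF that(2,3)] by simp
    show "((\<lambda>s. L s $$ (i,j)) \<longlongrightarrow> freq (H * G) \<infinity> $$ (i,j)) at_infinity" if "i < m" "j < m" for i j
    proof -
      have "tf_proper ((H * G) $$ (i,j))"
        by (rule RH_D(1)[OF RH_entry[OF HG that]])
      hence "(tf_eval ((H * G) $$ (i,j)) \<longlongrightarrow> tf_freq ((H * G) $$ (i,j)) \<infinity>) at_infinity"
        by (rule tf_freq_infinity(1))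
      moreover have "freq (H * G) \<infinity> $$ (i,j) = tf_freq ((H * G) $$ (i,j)) \<infinity>"
        using HG(2) that unfolding freq_def by (simp del: index_mult_mat)
      ultimately show ?thesis unfolding ij[OF that] by simp
    qed
    show "det (1\<^sub>m m + complex_of_real \<tau> \<cdot>\<^sub>m freq (H * G) \<infinity>) \<noteq> 0" if "0 \<le> \<tau>" "\<tau> \<le> 1" for \<tau>
      unfolding fr by (rule ns) (use that in simp_all)
    show "det (1\<^sub>m m + complex_of_real \<tau> \<cdot>\<^sub>m L (\<i> * complex_of_real y)) \<noteq> 0" if "0 \<le> \<tau>" "\<tau> \<le> 1" for \<tau> y
    proof (cases "0 \<le> y")
      case True
      thus ?thesis unfolding freal[symmetric] fr by (intro ns) (use that in simp_all)
    next
      case False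
      let ?B = "1\<^sub>m m + complex_of_real \<tau> \<cdot>\<^sub>m L (\<i> * complex_of_real (- y))"
      have "\<i> * complex_of_real y = cnj (\<i> * complex_of_real (- y))" by simp
      hence "L (\<i> * complex_of_real y) $$ (i,j) = cnj (L (\<i> * complex_of_real (- y)) $$ (i,j))"
        if "i < m" "j < m" for i j
        unfolding ij[OF that] using tf_eval_cnj by metis
      hence "1\<^sub>m m + complex_of_real \<tau> \<cdot>\<^sub>m L (\<i> * complex_of_real y) = map_mat cnj ?B"
        using carrier_matD[OF L] by (intro eq_matI) simp_all
      moreover have "det ?B \<noteq> 0"
        unfolding freal[symmetric] fr by (intro ns) (use that False in simp_all)
      ultimately show ?thesis by (simp add: det_cnj)
    qed
  qed
  show ?thesis
  proof (rule feedback_stableI[OF G H])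
    fix s assume s: "0 \<le> Re s"
    let ?R = "{f. cpoly (tf_den f) s \<noteq> 0}"
    note e = partial_hom_tf_eval[of s]
    have HGs: "H * G \<in> partial_hom.MR ?R" "?A \<in> partial_hom.MR ?R"
      using HG(1) AR RH_D(2)[OF _ s] unfolding rh.MR_def partial_hom.MR_def[OF e] by blast+
    have "tf_eval (det ?A) s = det (map_mat (\<lambda>f. tf_eval f s) ?A)"
      using partial_hom.MR_det[OF e A HGs(2)] by blast
    also have "map_mat (\<lambda>f. tf_eval f s) ?A = 1\<^sub>m m + L s"
      using partial_hom.MR_add[OF e partial_hom.MR_one[OF e, THEN conjunct1, of m] HGs(1)]
        partial_hom.MR_one[OF e, of m] c(1,3) by (simp add: L_def)
    finally show "tf_eval (det ?A) s \<noteq> 0" using det[OF s] by simp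
  next
    have "tf_freq (det ?A) \<infinity> = det (map_mat (\<lambda>f. tf_freq f \<infinity>) ?A)"
      using rh.MR_det[OF A AR] by blast
    also have "map_mat (\<lambda>f. tf_freq f \<infinity>) ?A = 1\<^sub>m m + freq (H * G) \<infinity>"
      using rh.MR_add[OF rh.MR_one[THEN conjunct1, of m] HG(1)] rh.MR_one[of m] c(1,3) by (simp add: freq_def)
    also have "freq (H * G) \<infinity> = complex_of_real 1 \<cdot>\<^sub>m (freq H \<infinity> * freq G \<infinity>)"
      unfolding fr by (intro eq_matI) simp_all
    finally show "tf_freq (det ?A) \<infinity> \<noteq> 0" using ns[of \<infinity> 1] by simp
  qed
qed

section \<open>The decentralized conditions\<close>

text \<open>Only the assembled matrix is known to be stable, while \<open>freq\<close> is
  multiplicative only on entries finite at the frequency. Each \<open>Y i\<close> is therefore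
  recovered from its rotated block by undoing the constant rotations, which shows that it is finite
  as well; only then may \<open>freq\<close> be distributed.\<close>

lemma rotated_blocks_freq:
  assumes Y: "\<And>i. i < N \<Longrightarrow> Y i \<in> carrier_mat 2 2"
    and G: "block_diag N (\<lambda>i. exp_J (\<theta> i) * Y i * exp_J (- \<theta> i)) \<in> RH_inf (2 * N)" (is "?G \<in> _")
  shows "freq ?G \<omega> = block_diag N (\<lambda>i. rot (\<theta> i) * freq (Y i) \<omega> * rot (- \<theta> i))"
proof -
  let ?R = "{f. tf_finite_at f \<omega>}"
  note p = partial_hom_tf_freq[of \<omega>]
  have freq: "freq (exp_J (\<theta> i) * Y i * exp_J (- \<theta> i)) \<omega> = rot (\<theta> i) * freq (Y i) \<omega> * rot (- \<theta> i)"
    and B: "exp_J (\<theta> i) * Y i * exp_J (- \<theta> i) \<in> carrier_mat 2 2" if i: "i < N" for i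
  proof -
    let ?E = "exp_J (\<theta> i)" and ?E' = "exp_J (- \<theta> i)"
    let ?B = "?E * Y i * ?E'"
    have EY: "?E * Y i \<in> carrier_mat 2 2" by (rule mult_carrier_mat[OF exp_J_carrier Y[OF i]])
    show Bc: "?B \<in> carrier_mat 2 2" by (rule mult_carrier_mat[OF EY exp_J_carrier])
    have E'B: "?E' * ?B \<in> carrier_mat 2 2" by (rule mult_carrier_mat[OF exp_J_carrier Bc])
    have "?B $$ (a,b) \<in> ?R" if "a < 2" "b < 2" for a b
    proof -
      have "?G \<in> rh.MR" using G by (simp add: RH_inf_iff)
      hence "?G $$ (2 * i + a, 2 * i + b) \<in> RH"
        using i that by (intro RH_entry[OF _ block_diag_carrier]) simp_all
      thus ?thesis unfolding block_diag_block[OF i that] by (simp add: RH_finite)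
    qed
    hence BR: "?B \<in> partial_hom.MR ?R"
      unfolding partial_hom.MR_def[OF p] mem_Collect_eq carrier_matD[OF Bc] by blast
    have "?E' * ?B * ?E = Y i"
    proof -
      have "?E' * ?B = ?E' * (?E * Y i) * ?E'"
        by (rule assoc_mult_mat[OF exp_J_carrier EY exp_J_carrier, symmetric])
      also have "?E' * (?E * Y i) = ?E' * ?E * Y i"
        by (rule assoc_mult_mat[OF exp_J_carrier exp_J_carrier Y[OF i], symmetric])
      also have "\<dots> = Y i" unfolding exp_J_inverse(1) by (rule left_mult_one_mat[OF Y[OF i]])
      finally have "?E' * ?B * ?E = Y i * ?E' * ?E" by simp
      also have "\<dots> = Y i * (?E' * ?E)" by (rule assoc_mult_mat[OF Y[OF i] exp_J_carrier exp_J_carrier])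
      also have "\<dots> = Y i" unfolding exp_J_inverse(1) by (rule right_mult_one_mat[OF Y[OF i]])
      finally show ?thesis .
    qed
    moreover have "?E' * ?B * ?E \<in> partial_hom.MR ?R"
      using partial_hom.MR_mult[OF p _ freq_exp_J(2)] partial_hom.MR_mult[OF p freq_exp_J(2) BR]
        carrier_matD[OF exp_J_carrier] carrier_matD[OF Bc] carrier_matD[OF E'B] by metis
    ultimately have YR: "Y i \<in> partial_hom.MR ?R" by simp
    have 1: "?E * Y i \<in> partial_hom.MR ?R \<and> freq (?E * Y i) \<omega> = rot (\<theta> i) * freq (Y i) \<omega>"
      using partial_hom.MR_mult[OF p freq_exp_J(2) YR] carrier_matD[OF exp_J_carrier] carrier_matD[OF Y[OF i]]
      unfolding freq_exp_J(1)[of _ \<omega>, symmetric] freq_def by metis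
    show "freq ?B \<omega> = rot (\<theta> i) * freq (Y i) \<omega> * rot (- \<theta> i)"
      using partial_hom.MR_mult[OF p 1[THEN conjunct1] freq_exp_J(2)[of "- \<theta> i"]] 1
        carrier_matD[OF exp_J_carrier] carrier_matD[OF EY]
      unfolding freq_exp_J(1)[of "- \<theta> i" \<omega>, symmetric] freq_def by metis
  qed
  have "freq ?G \<omega> = block_diag N (\<lambda>i. freq (exp_J (\<theta> i) * Y i * exp_J (- \<theta> i)) \<omega>)"
    unfolding freq_def using B partial_hom.zero(2)[OF p] by (intro map_block_diag) simp_all
  also have "\<dots> = block_diag N (\<lambda>i. rot (\<theta> i) * freq (Y i) \<omega> * rot (- \<theta> i))"
    by (intro block_diag_cong freq)
  finally show ?thesis .
qed

lemma block_vec_rotated: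
  assumes Y: "Y i \<in> carrier_mat 2 2" and x: "x \<in> carrier_vec (2 * N)" and i: "i < N"
  shows "block_vec (block_diag N (\<lambda>i. rot (\<theta> i) * Y i * rot (- \<theta> i)) *\<^sub>v x) i
      = rot (\<theta> i) *\<^sub>v (Y i *\<^sub>v (rot (- \<theta> i) *\<^sub>v block_vec x i))"
proof -
  have RY: "rot (\<theta> i) * Y i \<in> carrier_mat 2 2" by (rule mult_carrier_mat[OF rot_carrier Y])
  have r: "rot (- \<theta> i) *\<^sub>v block_vec x i \<in> carrier_vec 2"
    by (rule mult_mat_vec_carrier[OF rot_carrier block_vec_carrier])
  show ?thesis
    using block_vec_mult[of "\<lambda>i. rot (\<theta> i) * Y i * rot (- \<theta> i)", OF mult_carrier_mat[OF RY rot_carrier] x i]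
      assoc_mult_mat_vec[OF RY rot_carrier block_vec_carrier] assoc_mult_mat_vec[OF rot_carrier Y r]
    by simp
qed

lemma rotated_blocks_norm_bound:
  assumes Y: "\<And>i. i < N \<Longrightarrow> Y i \<in> carrier_mat 2 2" and g: "\<And>i. i < N \<Longrightarrow> sigma_max (Y i) \<le> g"
    and x: "x \<in> carrier_vec (2 * N)"
  shows "norm_sq (block_diag N (\<lambda>i. rot (\<theta> i) * Y i * rot (- \<theta> i)) *\<^sub>v x) \<le> g\<^sup>2 * norm_sq x"
proof -
  let ?G = "block_diag N (\<lambda>i. rot (\<theta> i) * Y i * rot (- \<theta> i))"
  have Gx: "?G *\<^sub>v x \<in> carrier_vec (2 * N)" by (rule mult_mat_vec_carrier[OF block_diag_carrier x])
  have "norm_sq (block_vec (?G *\<^sub>v x) i) \<le> g\<^sup>2 * norm_sq (block_vec x i)" if i: "i < N" for i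
  proof -
    let ?u = "rot (- \<theta> i) *\<^sub>v block_vec x i"
    have u: "?u \<in> carrier_vec 2" by (rule mult_mat_vec_carrier[OF rot_carrier block_vec_carrier])
    have "norm_sq (block_vec (?G *\<^sub>v x) i) = norm_sq (Y i *\<^sub>v ?u)"
      unfolding block_vec_rotated[where Y = Y, OF Y[OF i] x i]
      by (rule norm_sq_rot[OF mult_mat_vec_carrier[OF Y[OF i] u]])
    also have "\<dots> \<le> (sigma_max (Y i))\<^sup>2 * norm_sq ?u"
      using sigma_max_bound(2)[OF Y[OF i] _ u] by simp
    also have "\<dots> \<le> g\<^sup>2 * norm_sq ?u"
      using g[OF i] sigma_max_bound(1)[OF Y[OF i]] by (intro mult_right_mono power_mono) simp_all
    finally show ?thesis by (simp add: norm_sq_rot)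
  qed
  thus ?thesis
    unfolding norm_sq_block_vec[OF Gx] norm_sq_block_vec[OF x] sum_distrib_left
    by (intro sum_mono) simp
qed

text \<open>The form splits into the forms of the single blocks, each at the rotated block of x.
  Blocks where x vanishes contribute 0; rotations preserve norms, so some rotated block of a nonzero
  x is nonzero.\<close>

lemma rotated_blocks_form_in_cone:
  assumes Y: "\<And>i. i < N \<Longrightarrow> Y i \<in> carrier_mat 2 2"
    and cone: "\<And>i u. i < N \<Longrightarrow> u \<in> carrier_vec 2 \<Longrightarrow> u \<noteq> 0\<^sub>v 2 \<Longrightarrow> (Y i *\<^sub>v u) \<bullet>c u \<in> phase_cone a b"
    and x: "x \<in> carrier_vec (2 * N)" "x \<noteq> 0\<^sub>v (2 * N)"
  shows "(block_diag N (\<lambda>i. rot (\<theta> i) * Y i * rot (- \<theta> i)) *\<^sub>v x) \<bullet>c x \<in> phase_cone a b"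
proof -
  let ?G = "block_diag N (\<lambda>i. rot (\<theta> i) * Y i * rot (- \<theta> i))"
  let ?u = "\<lambda>i. rot (- \<theta> i) *\<^sub>v block_vec x i"
  have u: "?u i \<in> carrier_vec 2" for i by (rule mult_mat_vec_carrier[OF rot_carrier block_vec_carrier])
  have Gx: "?G *\<^sub>v x \<in> carrier_vec (2 * N)" by (rule mult_mat_vec_carrier[OF block_diag_carrier x(1)])
  have e: "block_vec (?G *\<^sub>v x) i \<bullet>c block_vec x i = (Y i *\<^sub>v ?u i) \<bullet>c ?u i" if i: "i < N" for i
    unfolding block_vec_rotated[where Y = Y, OF Y[OF i] x(1) i]
      cscalar_prod_adjoint[OF rot_carrier mult_mat_vec_carrier[OF Y[OF i] u] block_vec_carrier] mat_adjoint_rot ..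
  have u0: "norm_sq (?u i) = norm_sq (block_vec x i)" for i by (rule norm_sq_rot[OF block_vec_carrier])
  have "(?G *\<^sub>v x) \<bullet>c x = (\<Sum>i<N. (Y i *\<^sub>v ?u i) \<bullet>c ?u i)"
    unfolding cscalar_prod_block_vec[OF Gx x(1)] using e by (intro sum.cong) simp_all
  also have "\<dots> \<in> phase_cone a b"
  proof (rule phase_cone_sum)
    fix i assume "i \<in> {..<N}"
    hence i: "i < N" by simp
    show "(Y i *\<^sub>v ?u i) \<bullet>c ?u i = 0 \<or> (Y i *\<^sub>v ?u i) \<bullet>c ?u i \<in> phase_cone a b"
    proof (cases "?u i = 0\<^sub>v 2")
      case True
      have "(Y i *\<^sub>v ?u i) \<bullet>c 0\<^sub>v 2 = 0"
        unfolding cscalar_prod_sum[OF mult_mat_vec_carrier[OF Y[OF i] u] zero_carrier_vec] by simp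
      thus ?thesis by (simp only: True simp_thms)
    next
      case False
      thus ?thesis using cone[OF i u] by blast
    qed
  next
    have "norm_sq x \<noteq> 0" using x norm_sq_eq_0 by blast
    then obtain i where i: "i < N" "norm_sq (block_vec x i) \<noteq> 0"
      unfolding norm_sq_block_vec[OF x(1)] by (metis lessThan_iff sum.neutral)
    hence "?u i \<noteq> 0\<^sub>v 2" using u0[of i] norm_sq_eq_0[OF u] by metis
    hence "(Y i *\<^sub>v ?u i) \<bullet>c ?u i \<noteq> 0" using phase_cone_nonzero[OF cone[OF i(1) u]] by blast
    thus "\<exists>i\<in>{..<N}. (Y i *\<^sub>v ?u i) \<bullet>c ?u i \<noteq> 0" using i(1) by blast
  qed simp
  finally show ?thesis .
qed

text \<open>The condition bounds the grid from below, whereas the small gain argument wants an upper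
  bound h for its inverse. The bound is obtained differently at poles of \<open>Yg\<close> and away
  from them.\<close>

lemma gain_condition_nonsingular:
  assumes N: "1 \<le> N" and Y: "\<And>i. i < N \<Longrightarrow> Yc i \<in> carrier_mat 2 2"
    and Yg: "Yg \<in> carrier_mat (2 * N) (2 * N)" "Yg * mat_inv Yg = 1\<^sub>m (2 * N)"
    and H: "mat_inv Yg \<in> RH_inf (2 * N)"
    and gain: "gain_condition N Yc Yg \<omega>" and \<tau>: "0 \<le> \<tau>" "\<tau> \<le> 1"
  shows "det (1\<^sub>m (2 * N) + complex_of_real \<tau> \<cdot>\<^sub>m (freq (mat_inv Yg) \<omega> *
    block_diag N (\<lambda>i. rot (\<theta> i) * freq (Yc i) \<omega> * rot (- \<theta> i)))) \<noteq> 0"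
proof -
  let ?H = "freq (mat_inv Yg) \<omega>" and ?\<sigma> = "\<lambda>i. ereal (sigma_max (freq (Yc i) \<omega>))"
  have Hc: "?H \<in> carrier_mat (2 * N) (2 * N)" using H by (simp add: RH_inf_iff freq_def)
  have Yf: "freq (Yc i) \<omega> \<in> carrier_mat 2 2" if "i < N" for i using Y[OF that] by (simp add: freq_def)
  have N0: "0 < 2 * N" using N by simp
  have "Max (?\<sigma> ` {..<N}) \<in> ?\<sigma> ` {..<N}" using N by (intro Max_in) (auto simp: lessThan_empty_iff)
  then obtain i0 where i0: "i0 < N" "Max (?\<sigma> ` {..<N}) = ?\<sigma> i0" by auto
  define g where "g = sigma_max (freq (Yc i0) \<omega>)"
  have g0: "0 \<le> g" using sigma_max_bound(1)[OF Yf[OF i0(1)]] by (simp add: g_def)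
  have g: "sigma_max (freq (Yc i) \<omega>) \<le> g" if "i < N" for i
  proof -
    have "?\<sigma> i \<le> Max (?\<sigma> ` {..<N})" using that by (intro Max_ge) auto
    thus ?thesis unfolding i0(2) g_def by simp
  qed
  have lt: "ereal g < grid_sigma_min Yg \<omega>" using gain unfolding gain_condition_def i0(2) g_def .
  obtain h where h: "0 \<le> h" "h * g < 1"
    "\<And>x. x \<in> carrier_vec (2 * N) \<Longrightarrow> norm_sq (?H *\<^sub>v x) \<le> h\<^sup>2 * norm_sq x"
  proof (cases "finite_at Yg \<omega>")
    case True
    let ?Y = "freq Yg \<omega>"
    define s where "s = sigma_min ?Y"
    have Yc: "?Y \<in> carrier_mat (2 * N) (2 * N)" using Yg(1) by (simp add: freq_def)
    have gs: "g < s" using lt True by (simp add: grid_sigma_min_def s_def)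
    have YR: "Yg \<in> partial_hom.MR {f. tf_finite_at f \<omega>}"
      using True unfolding partial_hom.MR_def[OF partial_hom_tf_freq] finite_at_def by simp
    have HR: "mat_inv Yg \<in> partial_hom.MR {f. tf_finite_at f \<omega>}"
      using H by (simp add: RH_inf_iff MR_RH_finite)
    have "dim_col Yg = dim_row (mat_inv Yg)" using Yg(1) H by (auto simp: RH_inf_iff)
    hence YH: "?Y * ?H = 1\<^sub>m (2 * N)"
      using partial_hom.MR_mult[OF partial_hom_tf_freq YR HR] partial_hom.MR_one[OF partial_hom_tf_freq, of "2 * N" \<omega>]
      by (simp add: freq_def Yg(2))
    show thesis
    \<comment> \<open>From 0 <= g < s the number s is positive. As \<open>?Y\<close> undoes
      \<open>?H\<close>, stretching by at least s under \<open>?Y\<close> means stretching by at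
      most 1 / s under \<open>?H\<close>.\<close>
    proof (rule that[of "1 / s"])
      show "0 \<le> 1 / s" "1 / s * g < 1" using g0 gs by simp_all
      fix x :: "complex Matrix.vec" assume x: "x \<in> carrier_vec (2 * N)"
      have Hx: "?H *\<^sub>v x \<in> carrier_vec (2 * N)" by (rule mult_mat_vec_carrier[OF Hc x])
      have "?Y *\<^sub>v (?H *\<^sub>v x) = x"
        using assoc_mult_mat_vec[OF Yc Hc x] x by (simp add: YH)
      hence "s\<^sup>2 * norm_sq (?H *\<^sub>v x) \<le> norm_sq x"
        using sigma_min_bound(2)[OF Yc N0 Hx] by (simp add: s_def)
      thus "norm_sq (?H *\<^sub>v x) \<le> (1 / s)\<^sup>2 * norm_sq x"
        using g0 gs by (simp add: power_divide pos_le_divide_eq mult.commute)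
    qed
  next
    case False
    \<comment> \<open>At a pole of \<open>Yg\<close> the stable inverse still has a finite value,
      and the condition refers directly to its largest singular value.\<close>
    define h where "h = sigma_max ?H"
    have h0: "0 \<le> h" using sigma_max_bound(1)[OF Hc N0] by (simp add: h_def)
    have "ereal g < 1 / ereal h" using lt False by (simp add: grid_sigma_min_def h_def)
    \<comment> \<open>For h = 0 the upper bound \<open>1 / ereal h\<close> is infinite and says
      nothing, but then h g = 0.\<close>
    hence "h * g < 1"
      using h0 by (cases "h = 0") (simp_all add: one_ereal_def pos_less_divide_eq mult.commute)
    with h0 sigma_max_bound(2)[OF Hc N0] show thesis by (intro that[of h]) (simp_all add: h_def)
  qed
  show ?thesis
    by (rule small_gain_nonsingular[OF block_diag_carrier Hc _ h(3) g0 h(1,2) \<tau>])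
      (rule rotated_blocks_norm_bound[OF Yf g])
qed

text \<open>One cone from a to b has to serve all converters at once, because the form of the block
  diagonal matrix adds up their forms. So a and b are the extreme phases over all converters, and d)
  keeps the opening of this cone below pi.\<close>

lemma phase_condition_nonsingular:
  assumes N: "1 \<le> N" and Y: "\<And>i. i < N \<Longrightarrow> Yc i \<in> carrier_mat 2 2"
    and H: "mat_inv Yg \<in> carrier_mat (2 * N) (2 * N)"
    and phases_C: "\<And>i. i < N \<Longrightarrow> sectorial (freq (Yc i) \<omega>) \<Longrightarrow> is_phases (freq (Yc i) \<omega>) (\<phi>C i \<omega>)"
    and phases_G: "sectorial (freq (mat_inv Yg) \<omega>) \<Longrightarrow> is_phases (freq (mat_inv Yg) \<omega>) (\<phi>G \<omega>)"
    and phase: "phase_condition N Yc Yg \<phi>C \<phi>G \<omega>" and \<tau>: "0 \<le> \<tau>"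
  shows "det (1\<^sub>m (2 * N) + complex_of_real \<tau> \<cdot>\<^sub>m (freq (mat_inv Yg) \<omega> *
    block_diag N (\<lambda>i. rot (\<theta> i) * freq (Yc i) \<omega> * rot (- \<theta> i)))) \<noteq> 0"
proof -
  let ?H = "freq (mat_inv Yg) \<omega>" and ?Y = "\<lambda>i. freq (Yc i) \<omega>"
  let ?M = "\<lambda>i. phase_max (?Y i) (\<phi>C i \<omega>)" and ?m = "\<lambda>i. phase_min (?Y i) (\<phi>C i \<omega>)"
  have Hc: "?H \<in> carrier_mat (2 * N) (2 * N)" using H by (simp add: freq_def)
  have Yf: "?Y i \<in> carrier_mat 2 2" if "i < N" for i using Y[OF that] by (simp add: freq_def)
  have c: "Max (?M ` {..<N}) < ereal pi - phase_max ?H (\<phi>G \<omega>)"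
    "- ereal pi - phase_min ?H (\<phi>G \<omega>) < Min (?m ` {..<N})"
    "Max (?M ` {..<N}) - Min (?m ` {..<N}) < ereal pi"
    using phase unfolding phase_condition_def Let_def by simp_all
  \<comment> \<open>An infinite phase makes the corresponding inequality fail, so everything is sectorial.\<close>
  have secH: "sectorial ?H"
  proof (rule ccontr)
    assume "\<not> sectorial ?H"
    with c(1) show False by (simp add: phase_max_def)
  qed
  have secY: "sectorial (?Y i)" if "i < N" for i
  proof (rule ccontr)
    assume "\<not> sectorial (?Y i)"
    hence "?M i = \<infinity>" by (simp add: phase_max_def)
    moreover have "?M i \<le> Max (?M ` {..<N})" using that by (intro Max_ge) auto
    ultimately show False using c(1) by simp
  qed
  \<comment> \<open>The phases of a 2 x 2 block have indices 0 and 1, so the smallest has index 1;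
    for \<open>?H\<close> it will be \<open>2 * N - 1\<close>.\<close>
  have M: "?M i = ereal (\<phi>C i \<omega> 0)" "?m i = ereal (\<phi>C i \<omega> 1)" if "i < N" for i
    using secY[OF that] carrier_matD[OF Yf[OF that]] by (simp_all add: phase_max_def phase_min_def)
  have "Max (?M ` {..<N}) \<in> ?M ` {..<N}" "Min (?m ` {..<N}) \<in> ?m ` {..<N}"
    using N by (intro Max_in Min_in; simp add: lessThan_empty_iff)+
  then obtain i0 i1 where i: "i0 < N" "i1 < N" "Max (?M ` {..<N}) = ?M i0" "Min (?m ` {..<N}) = ?m i1" by auto
  define b where "b = \<phi>C i0 \<omega> 0"
  define a where "a = \<phi>C i1 \<omega> 1"
  have eq: "Max (?M ` {..<N}) = ereal b" "Min (?m ` {..<N}) = ereal a"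
    unfolding i(3,4) M(1)[OF i(1)] M(2)[OF i(2)] a_def b_def by simp_all
  have b: "\<phi>C i \<omega> 0 \<le> b" and a: "a \<le> \<phi>C i \<omega> 1" if "i < N" for i
  proof -
    have "?M i \<le> Max (?M ` {..<N})" "Min (?m ` {..<N}) \<le> ?m i"
      using that by (auto intro!: Max_ge Min_le)
    thus "\<phi>C i \<omega> 0 \<le> b" "a \<le> \<phi>C i \<omega> 1" unfolding eq M[OF that] by simp_all
  qed
  let ?d = "\<phi>G \<omega> 0" and ?c = "\<phi>G \<omega> (2 * N - 1)"
  have "phase_max ?H (\<phi>G \<omega>) = ereal ?d" "phase_min ?H (\<phi>G \<omega>) = ereal ?c"
    using secH carrier_matD[OF Hc] by (simp_all add: phase_max_def phase_min_def)
  hence sum: "b + ?d < pi" "- pi < a + ?c" "b - a < pi"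
    using c unfolding eq by simp_all
  have mono: "\<phi> (n - 1) \<le> \<phi> 0 \<and> \<phi> 0 - \<phi> (n - 1) < pi"
    if "is_phases A \<phi>" "A \<in> carrier_mat n n" "0 < n" for A \<phi> n
    using that unfolding is_phases_def Let_def by auto
  note pG = phases_G[OF secH]
  \<comment> \<open>Through the converter attaining the maximum: a is at most its smallest phase,
    which is at most its largest phase b.\<close>
  have ab: "a \<le> b"
    using mono[OF phases_C[OF i(1) secY[OF i(1)]] Yf[OF i(1)]] a[OF i(1)] by (simp add: b_def)
  have cd: "?c \<le> ?d" "?d - ?c < pi" using mono[OF pG Hc] N by simp_all
  show ?thesis
  proof (rule small_phase_nonsingular[OF block_diag_carrier Hc _ sum(3) ab _ cd(2,1) sum(1,2) \<tau>])
    fix x :: "complex Matrix.vec" assume x: "x \<in> carrier_vec (2 * N)" "x \<noteq> 0\<^sub>v (2 * N)"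
    show "(?H *\<^sub>v x) \<bullet>c x \<in> phase_cone ?c ?d"
      by (rule is_phases_form_in_cone[OF pG Hc x order_refl order_refl cd(2)])
    show "(block_diag N (\<lambda>i. rot (\<theta> i) * ?Y i * rot (- \<theta> i)) *\<^sub>v x) \<bullet>c x \<in> phase_cone a b"
    proof (rule rotated_blocks_form_in_cone[OF Yf _ x])
      fix i and u :: "complex Matrix.vec" assume i: "i < N" and u: "u \<in> carrier_vec 2" "u \<noteq> 0\<^sub>v 2"
      show "(?Y i *\<^sub>v u) \<bullet>c u \<in> phase_cone a b"
        using is_phases_form_in_cone[OF phases_C[OF i secY[OF i]] Yf[OF i] u _ b[OF i] sum(3)] a[OF i] by simp
    qed
  qed
qed

theorem mainTheorem1:
  fixes N M :: nat
    and YC :: "nat \<Rightarrow> tf mat"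
    and Yb :: "nat \<Rightarrow> nat \<Rightarrow> tf mat"
    and \<theta> S D :: "nat \<Rightarrow> real"
    and \<omega>\<^sub>0 \<epsilon> :: real
    and \<phi>C :: "nat \<Rightarrow> ereal \<Rightarrow> nat \<Rightarrow> real"
    and \<phi>G :: "ereal \<Rightarrow> nat \<Rightarrow> real"
  defines "G \<equiv> converter_loop N YC \<theta> D \<omega>\<^sub>0 \<epsilon>"
    and "Yc \<equiv> rescaled_converter YC D \<omega>\<^sub>0 \<epsilon>"
    and "Yg \<equiv> rescaled_grid N M Yb S D \<omega>\<^sub>0 \<epsilon>"
  assumes N: "1 \<le> N" and M: "N \<le> M"
    and YC: "\<And>i. i < N \<Longrightarrow> YC i \<in> carrier_mat 2 2"
    and S: "\<And>i. i < N \<Longrightarrow> 0 < S i"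
    and D: "\<And>i. i < N \<Longrightarrow> 0 < D i"
    and omega0: "0 < \<omega>\<^sub>0" and eps: "0 \<le> \<epsilon>"
    and Yb: "\<And>i j. i \<le> M \<Longrightarrow> j \<le> M \<Longrightarrow> i \<noteq> j \<Longrightarrow> Yb i j \<in> carrier_mat 2 2"
    and Yb_sym: "\<And>i j. i \<le> M \<Longrightarrow> j \<le> M \<Longrightarrow> i \<noteq> j \<Longrightarrow> Yb i j = Yb j i"
    and inv_interior: "invertible_mat (interior_block N M Yb)"
    and inv_grid: "invertible_mat (Y_grid N M Yb)"
    and stable_G: "G \<in> RH_inf (2 * N)"
    and stable_H: "mat_inv Yg \<in> RH_inf (2 * N)"
    and phases_C: "\<And>i \<omega>. i < N \<Longrightarrow> 0 \<le> \<omega> \<Longrightarrow> sectorial (freq (Yc i) \<omega>)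
                     \<Longrightarrow> is_phases (freq (Yc i) \<omega>) (\<phi>C i \<omega>)"
    and phases_G: "\<And>\<omega>. 0 \<le> \<omega> \<Longrightarrow> sectorial (freq (mat_inv Yg) \<omega>)
                     \<Longrightarrow> is_phases (freq (mat_inv Yg) \<omega>) (\<phi>G \<omega>)"
    and conditions: "\<And>\<omega>. 0 \<le> \<omega> \<Longrightarrow>
                       gain_condition N Yc Yg \<omega> \<or> phase_condition N Yc Yg \<phi>C \<phi>G \<omega>"
  shows "feedback_stable (2 * N) G (mat_inv Yg)"
proof (rule feedback_stable_homotopy[OF stable_G stable_H])
  fix \<omega> :: ereal and \<tau> :: real
  assume \<omega>: "0 \<le> \<omega>" and \<tau>: "0 \<le> \<tau>" "\<tau> \<le> 1"
  have w: "\<omega>\<^sub>0 \<noteq> 0" using omega0 by simp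
  have Yc: "Yc i \<in> carrier_mat 2 2" if "i < N" for i
    unfolding Yc_def by (rule rescaled_converter_carrier[where YC = YC, OF YC[OF that] w])
  have G: "G = block_diag N (\<lambda>i. exp_J (\<theta> i) * Yc i * exp_J (- \<theta> i))"
    unfolding G_def Yc_def by (rule converter_loop_eq_block_diag[OF YC w])
  have freqG: "freq G \<omega> = block_diag N (\<lambda>i. rot (\<theta> i) * freq (Yc i) \<omega> * rot (- \<theta> i))"
    unfolding G by (rule rotated_blocks_freq[OF Yc stable_G[unfolded G]])
  note Yg = rescaled_grid_invertible[OF M inv_interior inv_grid _ _ w, where S = S and D = D and \<epsilon> = \<epsilon>, folded Yg_def, OF S D]
  from conditions[OF \<omega>]
  show "det (1\<^sub>m (2 * N) + complex_of_real \<tau> \<cdot>\<^sub>m (freq (mat_inv Yg) \<omega> * freq G \<omega>)) \<noteq> 0"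
  proof
    assume gain: "gain_condition N Yc Yg \<omega>"
    show ?thesis
      unfolding freqG
      by (rule gain_condition_nonsingular[where Yc = Yc, OF N Yc Yg(1,3) stable_H gain \<tau>])
  next
    assume phase: "phase_condition N Yc Yg \<phi>C \<phi>G \<omega>"
    show ?thesis
      unfolding freqG
      by (rule phase_condition_nonsingular[where Yc = Yc and \<phi>C = \<phi>C and \<phi>G = \<phi>G,
            OF N Yc Yg(2) phases_C[OF _ \<omega>] phases_G[OF \<omega>] phase \<tau>(1)])
  qed
qed

end
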